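(* Assume that the period lattice $\mathcal{L}_f$ is non-rectangular. Let $m=q_1\cdots q_{r(m)}$ be a product of $r(m)\ge1$ distinct odd primes with $\gcd(m,N)=1$. (i) If $q_i\in\mathcal{S}_0\cup\mathcal{S}_1\cup\mathcal{S}_2$ for all $i$, then $$v_2\left(\frac{L(f,\chi_m,1)}{\Omega_f^{\mathrm{sgn}(\chi_m)}}\right)\ \ge\ \mathfrak{w}_m\cdot r(m)+\min\left\{\delta_{\mathfrak{v}_m,0},\ v_2\left(\frac{L(f,1)}{\Omega_f^+}\right)\right\},$$ and if $v_2(L(f,1)/\Omega_f^+)=0$ and $q_i\in\mathcal{S}_0$ for all $i$, equality holds. (ii) If $q_i\in\mathcal{S}_0^+\cup\mathcal{S}_1^+\cup\mathcal{S}_2^+$ for all $i$, then $$v_2\left(\frac{L(f,\chi_m,1)}{\Omega_f^{\mathrm{sgn}(\chi_m)}}\right)\ \ge\ \mathfrak{w}_m\cdot r(m)+\min\left\{\delta_{\mathfrak{v}_m,0},\ v_2\left(\frac{L(f,1)}{\Omega_f^+}\right)+\delta_{\mathfrak{v}_m,2}\right\},$$ and if $v_2(L(f,1)/\Omega_f^+)=0$ and $q_i\in\mathcal{S}_0^+$ for all $i$, or if $v_2(L(f,1)/\Omega_f^+)<0$ and $q_i\in\mathcal{S}_1^+$ for all $i$, equality holds.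
   Context: Let $f=\sum_{n\ge1}a_nq^n\in S_2(\Gamma_0(N))^{\mathrm{new}}$ be a normalized Hecke eigenform of weight 2 with all Fourier coefficients $a_n\in\mathbb{Q}$. Let $E$ be the optimal elliptic curve over $\mathbb{Q}$ in the isogeny class attached to $f$, with modular parametrization $\Phi:X_0(N)\to E$ and Néron differential $\omega_E$ of a global minimal model; assume the Manin constant is $1$, i.e. $f(q)\,dq/q=\Phi^*\omega_E$. Then the period lattice $\mathcal{L}_f=\{\int_\gamma f(q)\,dq/q:\gamma\in H_1(X_0(N)(\mathbb{C}),\mathbb{Z})\}$ equals the period lattice of $\omega_E$, and there are real numbers $\Omega_f^{\pm}>0$ such that either $\mathcal{L}_f=\Omega_f^+\mathbb{Z}+i\Omega_f^-\mathbb{Z}$ (called rectangular) or $\mathcal{L}_f=\Omega_f^+\mathbb{Z}+\frac{\Omega_f^++i\Omega_f^-}{2}\mathbb{Z}$ (non-rectangular). For an odd squarefree $d$, $\chi_d$ is the primitive quadratic Dirichlet character of conductor $d$ (product of Legendre symbols over primes dividing $d$; $\chi_1$ trivial), and $\mathrm{sgn}(\chi)=\chi(-1)$. $L(f,\chi,s)$ is the analytic continuation of $\sum_n\chi(n)a_nn^{-s}$; these central ratios are algebraic. $v_2$ is a 2-adic valuation on $\overline{\mathbb{Q}}$ with $v_2(2)=1$, $v_2(0)=+\infty$. For an integer $i$, $\mathcal{S}_i^{\pm}$ is the set of odd primes $q\nmid N$ with $\chi_q(-1)=\pm1$ and $v_2(a_q-2)=i$; $\mathcal{S}_i=\mathcal{S}_i^+\cup\mathcal{S}_i^-$.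 Set $\mathfrak{v}_m=\min_{q\mid m\text{ prime}}v_2(a_q-2)$, and $\mathfrak{w}_m=0$ if $\mathfrak{v}_m=0$, $\mathfrak{w}_m=1$ otherwise. $\delta_{i,j}$ is the Kronecker delta. *)

theory Defs
  imports "HOL-Complex_Analysis.Complex_Analysis" "HOL-Number_Theory.Number_Theory"
begin

section \<open>Newforms of weight 2 for the groups Gamma0(N)\<close>

definition upper_half :: "complex set" where
  "upper_half = {z. Im z > 0}"

text \<open>The integer matrix with rows \<open>(a, b)\<close>, \<open>(c, d)\<close> is the tuple \<open>(a, b, c, d)\<close>.\<close>

type_synonym mat2 = "int \<times> int \<times> int \<times> int"

definition SL2Z :: "mat2 set" where
  "SL2Z = {(a, b, c, d). a * d - b * c = 1}"

definition Gamma0 :: "nat \<Rightarrow> mat2 set" where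
  "Gamma0 N = {(a, b, c, d). a * d - b * c = 1 \<and> int N dvd c}"

fun mat2_mult :: "mat2 \<Rightarrow> mat2 \<Rightarrow> mat2" where
  "mat2_mult (a, b, c, d) (a', b', c', d') =
     (a * a' + b * c', a * b' + b * d', c * a' + d * c', c * b' + d * d')"

fun act :: "mat2 \<Rightarrow> complex \<Rightarrow> complex" where
  "act (a, b, c, d) z = (of_int a * z + of_int b) / (of_int c * z + of_int d)"

fun slash2 :: "(complex \<Rightarrow> complex) \<Rightarrow> mat2 \<Rightarrow> complex \<Rightarrow> complex" where
  "slash2 f (a, b, c, d) z = f (act (a, b, c, d) z) / (of_int c * z + of_int d) ^ 2"

text \<open>\<open>S\<^sub>2(\<Gamma>\<^sub>0(N))\<close>. For every \<open>\<gamma>\<close> in \<open>SL2(Z)\<close> the function \<open>f|\<gamma>\<close> is invariant under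
  \<open>z \<mapsto> z + N\<close>; vanishing at the cusp \<open>\<gamma>(\<infinity>)\<close> means that its expansion in \<open>exp(2 \<pi> i z / N)\<close>
  has only terms of positive exponent. The values of \<open>f\<close> outside the upper half plane are
  irrelevant here and in everything below.\<close>

definition cusp_forms2 :: "nat \<Rightarrow> (complex \<Rightarrow> complex) set" where
  "cusp_forms2 N = {f.
     f holomorphic_on upper_half \<and>
     (\<forall>\<gamma>\<in>Gamma0 N. \<forall>z\<in>upper_half. slash2 f \<gamma> z = f z) \<and>
     (\<forall>\<gamma>\<in>SL2Z. \<exists>c :: nat \<Rightarrow> complex. c 0 = 0 \<and>
        (\<forall>z\<in>upper_half.
           (\<lambda>n. c n * exp (2 * of_real pi * \<i> * of_nat n * z / of_nat N)) sums slash2 f \<gamma> z))}"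

inductive_set old_forms2 :: "nat \<Rightarrow> (complex \<Rightarrow> complex) set" for N :: nat where
  gen: "\<lbrakk>M dvd N; M \<noteq> N; d dvd N div M; g \<in> cusp_forms2 M\<rbrakk> \<Longrightarrow>
          (\<lambda>z. g (of_nat d * z)) \<in> old_forms2 N"
| zero: "(\<lambda>z. 0) \<in> old_forms2 N"
| add: "\<lbrakk>g \<in> old_forms2 N; h \<in> old_forms2 N\<rbrakk> \<Longrightarrow> (\<lambda>z. g z + h z) \<in> old_forms2 N"
| scale: "g \<in> old_forms2 N \<Longrightarrow> (\<lambda>z. c * g z) \<in> old_forms2 N"

definition Gamma0_cosets :: "nat \<Rightarrow> mat2 set set" where
  "Gamma0_cosets N = SL2Z // {(\<gamma>, \<gamma>'). \<gamma> \<in> SL2Z \<and> (\<exists>g\<in>Gamma0 N. \<gamma>' = mat2_mult g \<gamma>)}"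

definition fund_domain :: "complex set" where
  "fund_domain = {z. Im z > 0 \<and> \<bar>Re z\<bar> \<le> 1 / 2 \<and> norm z \<ge> 1}"

text \<open>The (unnormalised) Petersson inner product: the integral of
  \<open>f(z) conj(g(z)) y\<^sup>2 dx dy / y\<^sup>2\<close> over \<open>\<Gamma>\<^sub>0(N)\H\<close>, cut into translates of the standard
  fundamental domain of \<open>SL2(Z)\<close>. The integrand depends only on the coset of the
  representative that is chosen.\<close>

definition petersson2 :: "nat \<Rightarrow> (complex \<Rightarrow> complex) \<Rightarrow> (complex \<Rightarrow> complex) \<Rightarrow> complex" where
  "petersson2 N f g =
     (\<Sum>C\<in>Gamma0_cosets N. LINT z:fund_domain|lborel.
        slash2 f (SOME \<gamma>. \<gamma> \<in> C) z * cnj (slash2 g (SOME \<gamma>. \<gamma> \<in> C) z))"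

definition new_forms2 :: "nat \<Rightarrow> (complex \<Rightarrow> complex) set" where
  "new_forms2 N = {f \<in> cusp_forms2 N. \<forall>g\<in>old_forms2 N. petersson2 N f g = 0}"

text \<open>\<open>T\<^sub>n\<close> in level \<open>N\<close>, weight 2 and trivial character; for a prime \<open>n\<close> dividing \<open>N\<close> it is
  the operator usually written \<open>U\<^sub>n\<close>.\<close>

definition hecke2 :: "nat \<Rightarrow> nat \<Rightarrow> (complex \<Rightarrow> complex) \<Rightarrow> complex \<Rightarrow> complex" where
  "hecke2 N n f z =
     of_nat n * (\<Sum>d | d dvd n \<and> coprime (n div d) N.
        (\<Sum>b<d. f ((of_nat (n div d) * z + of_nat b) / of_nat d)) / of_nat d ^ 2)"

definition q_expansion :: "(complex \<Rightarrow> complex) \<Rightarrow> (nat \<Rightarrow> complex) \<Rightarrow> bool" where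
  "q_expansion f a \<longleftrightarrow> a 0 = 0 \<and>
     (\<forall>z\<in>upper_half. (\<lambda>n. a n * exp (2 * of_real pi * \<i> * of_nat n * z)) sums f z)"

definition rational_newform2 :: "nat \<Rightarrow> (complex \<Rightarrow> complex) \<Rightarrow> (nat \<Rightarrow> complex) \<Rightarrow> bool" where
  "rational_newform2 N f a \<longleftrightarrow>
     N \<ge> 1 \<and> f \<in> new_forms2 N \<and> q_expansion f a \<and> a 1 = 1 \<and> (\<forall>n. a n \<in> \<rat>) \<and>
     (\<forall>n\<ge>1. \<exists>t. \<forall>z\<in>upper_half. hecke2 N n f z = t * f z)"


section \<open>Integral cycles and periods\<close>

text \<open>A 1-chain is a finite formal integer combination of paths, given as a list. Points
  related by \<open>R\<close> are identified, and the chain is a cycle if its boundary vanishes after this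
  identification.\<close>

definition cycle_mod ::
    "('a \<Rightarrow> 'a \<Rightarrow> bool) \<Rightarrow> (int \<times> (real \<Rightarrow> 'a::topological_space)) list \<Rightarrow> bool" where
  "cycle_mod R cs \<longleftrightarrow>
     (\<forall>P. (\<Sum>(n, p)\<leftarrow>cs. n * (of_bool (R P (pathfinish p)) - of_bool (R P (pathstart p)))) = 0)"

definition Gamma0_equiv :: "nat \<Rightarrow> complex \<Rightarrow> complex \<Rightarrow> bool" where
  "Gamma0_equiv N z w \<longleftrightarrow> (\<exists>\<gamma>\<in>Gamma0 N. w = act \<gamma> z)"

text \<open>Piecewise smooth integral 1-cycles on \<open>X\<^sub>0(N)(C)\<close>, given by lifts of their paths to the
  upper half plane. Every class in \<open>H\<^sub>1(X\<^sub>0(N)(C), Z)\<close> contains such a cycle, because the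
  finitely many cusps can be avoided.\<close>

definition X0_cycles :: "nat \<Rightarrow> (int \<times> (real \<Rightarrow> complex)) list set" where
  "X0_cycles N = {cs. cycle_mod (Gamma0_equiv N) cs \<and>
     (\<forall>(n, p)\<in>set cs. valid_path p \<and> path_image p \<subseteq> upper_half)}"

text \<open>With \<open>q = exp(2 \<pi> i z)\<close> one has \<open>f(q) dq/q = 2 \<pi> i f(z) dz\<close>.\<close>

definition period_lattice :: "nat \<Rightarrow> (complex \<Rightarrow> complex) \<Rightarrow> complex set" where
  "period_lattice N f =
     (\<lambda>cs. \<Sum>(n, p)\<leftarrow>cs. of_int n * contour_integral p (\<lambda>z. 2 * of_real pi * \<i> * f z)) ` X0_cycles N"

definition nonrectangular :: "complex set \<Rightarrow> real \<Rightarrow> real \<Rightarrow> bool" where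
  "nonrectangular L \<Omega>p \<Omega>m \<longleftrightarrow> \<Omega>p > 0 \<and> \<Omega>m > 0 \<and>
     L = {of_int j * of_real \<Omega>p + of_int k * ((of_real \<Omega>p + \<i> * of_real \<Omega>m) / 2) | j k. True}"


section \<open>The optimal elliptic curve\<close>

text \<open>\<open>WModel a1 a2 a3 a4 a6\<close> is the equation
  \<open>y\<^sup>2 + a1 x y + a3 y = x\<^sup>3 + a2 x\<^sup>2 + a4 x + a6\<close>.\<close>

datatype wmodel = WModel (wa1: int) (wa2: int) (wa3: int) (wa4: int) (wa6: int)

definition wdisc :: "wmodel \<Rightarrow> int" where
  "wdisc W =
    (let b2 = wa1 W ^ 2 + 4 * wa2 W;
         b4 = 2 * wa4 W + wa1 W * wa3 W;
         b6 = wa3 W ^ 2 + 4 * wa6 W;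
         b8 = wa1 W ^ 2 * wa6 W + 4 * wa2 W * wa6 W - wa1 W * wa3 W * wa4 W
              + wa2 W * wa3 W ^ 2 - wa4 W ^ 2
     in - (b2 ^ 2) * b8 - 8 * b4 ^ 3 - 27 * b6 ^ 2 + 9 * b2 * b4 * b6)"

text \<open>Isomorphism over the rationals, by the substitution
  \<open>x = u\<^sup>2 x' + r\<close>, \<open>y = u\<^sup>3 y' + u\<^sup>2 s x' + t\<close>.\<close>

definition wiso :: "wmodel \<Rightarrow> wmodel \<Rightarrow> bool" where
  "wiso W W' \<longleftrightarrow> (\<exists>u r s t :: rat. u \<noteq> 0 \<and>
     u * of_int (wa1 W') = of_int (wa1 W) + 2 * s \<and>
     u ^ 2 * of_int (wa2 W') = of_int (wa2 W) - s * of_int (wa1 W) + 3 * r - s ^ 2 \<and>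
     u ^ 3 * of_int (wa3 W') = of_int (wa3 W) + r * of_int (wa1 W) + 2 * t \<and>
     u ^ 4 * of_int (wa4 W') = of_int (wa4 W) - s * of_int (wa3 W) + 2 * r * of_int (wa2 W)
        - (t + r * s) * of_int (wa1 W) + 3 * r ^ 2 - 2 * s * t \<and>
     u ^ 6 * of_int (wa6 W') = of_int (wa6 W) + r * of_int (wa4 W) + r ^ 2 * of_int (wa2 W)
        + r ^ 3 - t * of_int (wa3 W) - t ^ 2 - r * t * of_int (wa1 W))"

definition global_minimal :: "wmodel \<Rightarrow> bool" where
  "global_minimal W \<longleftrightarrow> wdisc W \<noteq> 0 \<and>
     (\<forall>W'. wiso W W' \<longrightarrow>
        (\<forall>p::nat. prime p \<longrightarrow> multiplicity (int p) (wdisc W) \<le> multiplicity (int p) (wdisc W')))"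

definition wpoly :: "wmodel \<Rightarrow> 'a::comm_ring_1 \<Rightarrow> 'a \<Rightarrow> 'a" where
  "wpoly W x y = y ^ 2 + of_int (wa1 W) * x * y + of_int (wa3 W) * y
     - (x ^ 3 + of_int (wa2 W) * x ^ 2 + of_int (wa4 W) * x + of_int (wa6 W))"

text \<open>The derivative of \<open>wpoly\<close> in \<open>y\<close>; the Neron differential of a global minimal model is
  \<open>dx / wpoly_y\<close>.\<close>

definition wpoly_y :: "wmodel \<Rightarrow> 'a::comm_ring_1 \<Rightarrow> 'a \<Rightarrow> 'a" where
  "wpoly_y W x y = 2 * y + of_int (wa1 W) * x + of_int (wa3 W)"

text \<open>Membership of the curve in the isogeny class attached to \<open>f\<close>:
  \<open>a\<^sub>p = p + 1 - #E(F\<^sub>p)\<close> at the primes not dividing \<open>N\<close>. The set below contains the affine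
  points, so that \<open>#E(F\<^sub>p)\<close> is one more than its cardinality.\<close>

definition attached_curve :: "nat \<Rightarrow> (nat \<Rightarrow> complex) \<Rightarrow> wmodel \<Rightarrow> bool" where
  "attached_curve N a W \<longleftrightarrow>
     (\<forall>p. prime p \<and> \<not> p dvd N \<longrightarrow>
        a p = of_nat p -
          of_nat (card {(x, y). x \<in> {0..<int p} \<and> y \<in> {0..<int p} \<and> int p dvd wpoly W x y}))"

text \<open>Integral 1-cycles on \<open>E(C)\<close> and the periods of the Neron differential. Cycles are taken
  away from the point at infinity and the 2-torsion points, where \<open>dx / wpoly_y\<close> is
  a quotient \<open>0/0\<close>; every homology class contains such a cycle.\<close>

definition E_cycles :: "wmodel \<Rightarrow> (int \<times> (real \<Rightarrow> complex \<times> complex)) list set" where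
  "E_cycles W = {cs. cycle_mod (=) cs \<and>
     (\<forall>(n, p)\<in>set cs. valid_path (fst \<circ> p) \<and> valid_path (snd \<circ> p) \<and>
        (\<forall>(x, y)\<in>path_image p. wpoly W x y = 0 \<and> wpoly_y W x y \<noteq> 0))}"

definition E_period_lattice :: "wmodel \<Rightarrow> complex set" where
  "E_period_lattice W =
     (\<lambda>cs. \<Sum>(n, p)\<leftarrow>cs. of_int n *
        integral {0..1} (\<lambda>t. vector_derivative (fst \<circ> p) (at t) / wpoly_y W (fst (p t)) (snd (p t))))
     ` E_cycles W"

text \<open>Near the cusp at infinity, \<open>g\<close> is a Laurent series in \<open>exp(2 \<pi> i z / h)\<close> with finitely many
  negative exponents and all coefficients in \<open>K\<close>.\<close>

definition laurent_at_infinity :: "nat \<Rightarrow> complex set \<Rightarrow> (complex \<Rightarrow> complex) \<Rightarrow> bool" where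
  "laurent_at_infinity h K g \<longleftrightarrow> (\<exists>(k::nat) (M::real) c. (\<forall>n. c n \<in> K) \<and>
     (\<forall>z. Im z > M \<and> Im z > 0 \<longrightarrow>
        (\<lambda>n. c n * exp (2 * of_real pi * \<i> * of_nat n * z / of_nat h))
          sums (exp (2 * of_real pi * \<i> * of_nat k * z / of_nat h) * g z)))"

text \<open>A rational function on \<open>X\<^sub>0(N)\<close> over \<open>Q\<close>, as a function on the upper half plane.
  It takes the value 0 at its poles.\<close>

definition X0_function :: "nat \<Rightarrow> (complex \<Rightarrow> complex) \<Rightarrow> bool" where
  "X0_function N g \<longleftrightarrow>
     g nicely_meromorphic_on upper_half \<and>
     (\<forall>\<gamma>\<in>Gamma0 N. \<forall>z\<in>upper_half. g (act \<gamma> z) = g z) \<and>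
     (\<forall>\<gamma>\<in>SL2Z. laurent_at_infinity N UNIV (\<lambda>z. g (act \<gamma> z))) \<and>
     laurent_at_infinity 1 \<rat> g"

text \<open>\<open>\<Phi> = (X, Y)\<close> is a morphism from \<open>X\<^sub>0(N)\<close> to \<open>E\<close> over \<open>Q\<close> such that the pullback
  \<open>X'(z) dz / wpoly_y\<close> of the Neron differential is \<open>c\<close> times \<open>f(q) dq/q\<close>.\<close>

definition modular_parametrization ::
    "nat \<Rightarrow> (complex \<Rightarrow> complex) \<Rightarrow> wmodel \<Rightarrow> (complex \<Rightarrow> complex) \<times> (complex \<Rightarrow> complex) \<Rightarrow> complex \<Rightarrow> bool"
  where
  "modular_parametrization N f W \<Phi> c \<longleftrightarrow> (case \<Phi> of (X, Y) \<Rightarrow>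
     c \<noteq> 0 \<and> X0_function N X \<and> X0_function N Y \<and>
     (\<forall>z\<in>upper_half. \<not> is_pole X z \<longrightarrow> \<not> is_pole Y z \<and> wpoly W (X z) (Y z) = 0 \<and>
        deriv X z = c * (2 * of_real pi * \<i> * f z) * wpoly_y W (X z) (Y z)))"

text \<open>The curve is optimal if \<open>\<Phi>\<close> induces a surjection from \<open>H\<^sub>1(X\<^sub>0(N)(C), Z)\<close> to
  \<open>H\<^sub>1(E(C), Z)\<close>, which means that the kernel of \<open>J\<^sub>0(N) \<rightarrow> E\<close> is connected. As a homology
  class on \<open>E(C)\<close> is determined by its period, this says that every period of the Neron
  differential is a period of its pullback. The constant \<open>c\<close> is the Manin constant.\<close>

definition optimal_curve ::
    "nat \<Rightarrow> (complex \<Rightarrow> complex) \<Rightarrow> (nat \<Rightarrow> complex) \<Rightarrow> wmodel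
      \<Rightarrow> (complex \<Rightarrow> complex) \<times> (complex \<Rightarrow> complex) \<Rightarrow> complex \<Rightarrow> bool" where
  "optimal_curve N f a W \<Phi> c \<longleftrightarrow>
     global_minimal W \<and> attached_curve N a W \<and> modular_parametrization N f W \<Phi> c \<and>
     E_period_lattice W \<subseteq> (\<lambda>x. c * x) ` period_lattice N f"


section \<open>Twisted L-values and 2-adic valuations\<close>

definition quad_char :: "nat \<Rightarrow> int \<Rightarrow> int" where
  "quad_char d n = (\<Prod>q\<in>prime_factors d. Legendre n (int q))"

definition L_twist :: "(nat \<Rightarrow> complex) \<Rightarrow> (int \<Rightarrow> int) \<Rightarrow> complex \<Rightarrow> complex" where
  "L_twist a ch = (THE F. F holomorphic_on UNIV \<and>
     (\<forall>s. Re s > 2 \<longrightarrow>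
        (\<lambda>n. of_int (ch (int (Suc n))) * a (Suc n) / of_nat (Suc n) powr s) sums F s))"

definition L_ratio ::
    "(nat \<Rightarrow> complex) \<Rightarrow> real \<Rightarrow> real \<Rightarrow> nat \<Rightarrow> complex" where
  "L_ratio a \<Omega>p \<Omega>m d =
     L_twist a (quad_char d) 1 / of_real (if quad_char d (-1) = 1 then \<Omega>p else \<Omega>m)"

text \<open>The algebraic closure of \<open>Q\<close> is the set of algebraic complex numbers; nothing is required
  of \<open>v\<close> elsewhere.\<close>

definition two_adic_valuation :: "(complex \<Rightarrow> ereal) \<Rightarrow> bool" where
  "two_adic_valuation v \<longleftrightarrow>
     v 2 = 1 \<and>
     (\<forall>x. algebraic x \<longrightarrow> v x \<noteq> - \<infinity> \<and> (v x = \<infinity> \<longleftrightarrow> x = 0)) \<and>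
     (\<forall>x y. algebraic x \<and> algebraic y \<longrightarrow>
        v (x * y) = v x + v y \<and> v (x + y) \<ge> min (v x) (v y))"

definition prime_set_pm ::
    "(complex \<Rightarrow> ereal) \<Rightarrow> nat \<Rightarrow> (nat \<Rightarrow> complex) \<Rightarrow> int \<Rightarrow> int \<Rightarrow> nat set" where
  "prime_set_pm v N a e i =
     {q. prime q \<and> odd q \<and> \<not> q dvd N \<and> quad_char q (-1) = e \<and> v (a q - 2) = ereal (of_int i)}"

definition prime_set ::
    "(complex \<Rightarrow> ereal) \<Rightarrow> nat \<Rightarrow> (nat \<Rightarrow> complex) \<Rightarrow> int \<Rightarrow> nat set" where
  "prime_set v N a i = prime_set_pm v N a 1 i \<union> prime_set_pm v N a (-1) i"

definition frak_v :: "(complex \<Rightarrow> ereal) \<Rightarrow> (nat \<Rightarrow> complex) \<Rightarrow> nat \<Rightarrow> ereal" where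
  "frak_v v a m = Min ((\<lambda>q. v (a q - 2)) ` prime_factors m)"

definition frak_w :: "(complex \<Rightarrow> ereal) \<Rightarrow> (nat \<Rightarrow> complex) \<Rightarrow> nat \<Rightarrow> ereal" where
  "frak_w v a m = (if frak_v v a m = 0 then 0 else 1)"

definition kron :: "ereal \<Rightarrow> ereal \<Rightarrow> ereal" where
  "kron x y = (if x = y then 1 else 0)"

end

theory Submission
  imports Defs "HOL-Probability.Sinc_Integral"
begin

text \<open>
  Let \<open>F(z) = \<Sum> a\<^sub>n/n e(nz)\<close> and let \<open>I(x)\<close> be the limit of \<open>F(x + it)\<close> as \<open>t\<close> tends to \<open>0\<close>, for
  rational \<open>x\<close>. A Mellin transform gives the entire continuation of the twisted L-series and
  \<open>g(\<chi>) L(f,\<chi>,1) = \<Sum>\<^sub>k \<chi>(k) I(k/m)\<close>. If \<open>m\<close> is prime to \<open>N\<close> then \<open>k/m\<close> is equivalent to \<open>0\<close>, so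
  \<open>I(k/m) - I(0)\<close> is a period. On a non-rectangular lattice \<open>\<psi>(z) = Re z/\<Omega>\<^sup>+ + Im z/\<Omega>\<^sup>-\<close> is integral,
  and \<open>x\<^sub>d = \<psi>(\<Sum>\<^sub>k \<chi>\<^sub>d(k) I(k/d))\<close> has the valuation of \<open>L(f,\<chi>\<^sub>d,1)/\<Omega>\<close> for even and for odd
  \<open>\<chi>\<^sub>d\<close>. The Hecke operators turn the sum of \<open>\<chi>\<^sub>d(k) I(k/m)\<close> over \<open>k\<close> prime to \<open>m\<close> into
  \<open>\<Prod>\<^bsub>q|m/d\<^esub> (a\<^sub>q - 2 \<chi>\<^sub>d(q))\<close> times the one for \<open>d\<close>. Summing over all \<open>d\<close> and using that
  \<open>\<Prod>\<^bsub>q|m\<^esub> (1 + \<chi>\<^sub>q(k))\<close> is \<open>0\<close> or \<open>2\<^bsup>r(m)\<^esup>\<close> yields a recursion for \<open>x\<^sub>m\<close> modulo \<open>2\<^bsup>r(m)\<^esup>\<close>, which settles the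
  case that all \<open>a\<^sub>q\<close> are even; comparing \<open>\<chi>\<^sub>m\<close> with the trivial character modulo \<open>2\<close> settles
  the other one.
\<close>

section \<open>Expansions at infinity\<close>

text \<open>Why one functional for both periods: only the sum over all \<open>d\<close> dividing
  \<open>m\<close> is controlled modulo 2^r, and among these \<open>d\<close> both signs of
  \<chi>_d(-1) can occur. Taken separately, Re z/\<Omega>^+ and Im z/\<Omega>^- are merely
  half-integral on a non-rectangular lattice, which would cost a factor 2. The quantity x_1 need not
  be integral. The Hecke relation at 0 makes (q + 1 - a_q) x_1 an integer; the point counts on the
  curve show that a_q is an integer and at most q, so the factor is nonzero and x_1 is rational. The
  recursion expresses x_m through the x_d of proper divisors, the product of all q - 1 times x_1,
  and a multiple of 2^r. When all a_q are even, each prime outside \<open>d\<close> puts a 2 into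
  the Hecke factors and each prime of \<open>d\<close> one into x_d, so every term gains r. An odd
  a_q makes its Hecke factors odd; this is why that case is treated modulo 2 only. The improvements
  in (ii) rest on q \<equiv> 1 modulo 4: the product of the q - 1 is then divisible by 4^r, and the
  term with x_1 is outweighed by the others or leaves room for a larger denominator of x_1.\<close>

abbreviation two_pi_i :: complex where
  "two_pi_i \<equiv> 2 * of_real pi * \<i>"

abbreviation q_series :: "nat \<Rightarrow> (nat \<Rightarrow> complex) \<Rightarrow> (complex \<Rightarrow> complex) \<Rightarrow> bool" where
  "q_series N c g \<equiv> \<forall>z\<in>upper_half. (\<lambda>n. c n * exp (two_pi_i * of_nat n * z / of_nat N)) sums g z"

definition qexp :: "nat \<Rightarrow> complex \<Rightarrow> complex" where
  "qexp N z = exp (two_pi_i * z / of_nat N)"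

lemma norm_qexp: "norm (qexp N z) = exp (- (2 * pi * Im z / N))"
  by (simp add: qexp_def Re_divide_of_nat)

lemma qexp_in_ball: "N \<ge> 1 \<Longrightarrow> z \<in> upper_half \<Longrightarrow> qexp N z \<in> ball 0 1"
  by (simp add: norm_qexp upper_half_def)

lemma qexp_power: "exp (two_pi_i * of_nat n * z / of_nat N) = qexp N z ^ n"
  by (simp add: qexp_def flip: exp_of_nat_mult) (simp add: algebra_simps)

lemma qexp_surj:
  assumes "N \<ge> 1" "w \<in> ball 0 1" "w \<noteq> 0"
  obtains z where "z \<in> upper_half" "w = qexp N z"
proof
  let ?z = "of_nat N * Ln w / two_pi_i"
  have "two_pi_i * ?z / of_nat N = Ln w" using assms by (simp add: field_simps)
  then show "w = qexp N ?z" using assms by (simp add: qexp_def)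
  have "ln (norm w) < 0" using assms by simp
  have "?z = of_real (N / (2*pi)) * (Ln w / \<i>)" by (simp add: field_simps)
  also have "Im \<dots> = - (N / (2*pi)) * ln (norm w)"
    using assms by (simp add: Im_divide power2_eq_square)
  finally show "?z \<in> upper_half" using \<open>ln (norm w) < 0\<close> assms
    by (simp add: upper_half_def mult_neg_neg zero_less_divide_iff divide_less_0_iff mult_less_0_iff)
qed

text \<open>The map \<open>qexp N\<close> sends the upper half plane onto the punctured unit disc,
  so the given sums already make the power series converge on the whole disc. Dividing by the local
  parameter is possible because \<open>c 0 = 0\<close>; the factor split off here is the source of
  the exponential decay below.\<close>

lemma expansion_factor:
  assumes N: "N \<ge> 1" and c0: "c 0 = 0"
    and s: "q_series N c g"
  obtains \<phi> where "\<phi> holomorphic_on ball 0 1"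
    "\<And>w. w \<in> ball 0 1 \<Longrightarrow> (\<lambda>n. c (Suc n) * w ^ n) sums \<phi> w"
    "\<And>z. z \<in> upper_half \<Longrightarrow> g z = qexp N z * \<phi> (qexp N z)"
proof
  define \<phi> where "\<phi> w = (\<Sum>n. c (Suc n) * w ^ n)" for w
  have 1: "(\<lambda>n. c (Suc n) * qexp N z ^ n) sums (g z / qexp N z)" if "z \<in> upper_half" for z
  proof -
    have "(\<lambda>n. c n * qexp N z ^ n) sums g z" using s that by (simp add: qexp_power)
    then have "(\<lambda>n. c (Suc n) * qexp N z ^ Suc n) sums g z"
      using c0 by (subst sums_Suc_iff) simp
    then have "(\<lambda>n. c (Suc n) * qexp N z ^ Suc n / qexp N z) sums (g z / qexp N z)"
      by (rule sums_divide)
    moreover have "qexp N z \<noteq> 0" by (simp add: qexp_def)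
    ultimately show ?thesis by simp
  qed
  show 2: "(\<lambda>n. c (Suc n) * w ^ n) sums \<phi> w" if "w \<in> ball 0 1" for w
  proof (cases "w = 0")
    case True
    have "(\<lambda>n. c (Suc n) * 0 ^ n) sums c (Suc 0)" using sums_finite[of "{0}" "\<lambda>n. c (Suc n) * 0 ^ n"] by simp
    then show ?thesis using True unfolding \<phi>_def by (simp add: sums_iff)
  next
    case False
    then obtain z where "z \<in> upper_half" "w = qexp N z" using qexp_surj[OF N \<open>w \<in> ball 0 1\<close> False] by metis
    then show ?thesis using 1[of z] unfolding \<phi>_def by (simp add: sums_iff)
  qed
  show "\<phi> holomorphic_on ball 0 1"
    using power_series_holomorphic[of 0 1 "\<lambda>n. c (Suc n)" \<phi>] 2 by simp
  show "g z = qexp N z * \<phi> (qexp N z)" if "z \<in> upper_half" for z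
  proof -
    have "\<phi> (qexp N z) = g z / qexp N z" using 1[OF that] unfolding \<phi>_def by (simp add: sums_iff)
    then show ?thesis by (simp add: qexp_def)
  qed
qed

text \<open>The half plane \<open>Im z \<ge> y0\<close> is mapped into a closed disc of radius
  \<open>\<rho> < 1\<close>, where \<open>\<phi>\<close> is bounded by compactness; the exponential
  is the modulus of the factor \<open>qexp N z\<close>.\<close>

lemma expansion_bound:
  assumes N: "N \<ge> 1" and c0: "c 0 = 0"
    and s: "q_series N c g"
    and y0: "y0 > 0"
  obtains K where "K \<ge> 0" "\<And>z. Im z \<ge> y0 \<Longrightarrow> norm (g z) \<le> K * exp (- (2 * pi * Im z / N))"
proof -
  obtain \<phi> where hol: "\<phi> holomorphic_on ball 0 1"
    and \<phi>: "\<And>z. z \<in> upper_half \<Longrightarrow> g z = qexp N z * \<phi> (qexp N z)"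
    using expansion_factor[OF N c0 s] by metis
  define \<rho> where "\<rho> = exp (- (2 * pi * y0 / N))"
  have "\<rho> < 1" using y0 N by (simp add: \<rho>_def)
  then have "continuous_on (cball 0 \<rho>) \<phi>"
    by (intro holomorphic_on_imp_continuous_on holomorphic_on_subset[OF hol]) auto
  then have "compact (\<phi> ` cball 0 \<rho>)" by (intro compact_continuous_image) auto
  then obtain K where K: "K > 0" "\<And>w. w \<in> cball 0 \<rho> \<Longrightarrow> norm (\<phi> w) \<le> K"
    using compact_imp_bounded bounded_pos by (metis imageI)
  show ?thesis
  proof (rule that[of K])
    fix z assume z: "Im z \<ge> y0"
    then have "qexp N z \<in> cball 0 \<rho>" using N by (simp add: norm_qexp \<rho>_def divide_right_mono)
    moreover have "z \<in> upper_half" using z y0 by (simp add: upper_half_def)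
    ultimately show "norm (g z) \<le> K * exp (- (2 * pi * Im z / N))"
      using \<phi>[of z] K(2)[of "qexp N z"] by (simp add: norm_mult norm_qexp mult.commute mult_left_mono)
  qed (use K in simp)
qed

section \<open>The cusp at infinity as a filter, and primitives that vanish there\<close>

abbreviation at_i_inf :: "complex filter" where "at_i_inf \<equiv> filtercomap Im at_top"

lemma at_i_inf_neq_bot [simp]: "at_i_inf \<noteq> bot"
  by (rule filtercomap_neq_bot_surj) (auto intro!: surjI[where f = "\<lambda>y. Complex 0 y"])

lemma eventually_at_i_inf_upper_half: "eventually (\<lambda>z. z \<in> upper_half) at_i_inf"
  by (auto simp: eventually_filtercomap_at_top_dense upper_half_def)

lemma convex_upper_half: "convex upper_half"
  unfolding upper_half_def using convex_halfspace_Im_gt[of 0] by auto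

lemma qexp_tendsto_0:
  assumes "N \<ge> 1" shows "(qexp N \<longlongrightarrow> 0) at_i_inf"
proof (rule tendsto_norm_zero_cancel, unfold norm_qexp)
  have "filterlim Im at_top at_i_inf" by (rule filterlim_filtercomap)
  then have "filterlim (\<lambda>z. Im z * (2 * pi / N)) at_top at_i_inf"
    by (rule filterlim_at_top_mult_tendsto_pos[rotated 2]) (use assms in auto)
  then have "filterlim (\<lambda>z. - (Im z * (2 * pi / N))) at_bot at_i_inf"
    by (simp add: filterlim_uminus_at_bot)
  then have "((\<lambda>z. exp (- (Im z * (2 * pi / N)))) \<longlongrightarrow> 0) at_i_inf"
    by (rule filterlim_compose[OF exp_at_bot])
  then show "((\<lambda>z. exp (- (2 * pi * Im z / N))) \<longlongrightarrow> 0) at_i_inf"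
    by (simp add: mult_ac)
qed

text \<open>With \<open>q = qexp N z\<close> one has \<open>2 \<pi> i g dz = N \<phi>(q) dq\<close>,
  so an antiderivative \<open>\<Psi>\<close> of \<open>\<phi>\<close> on the disc, pulled back and
  normalised by \<open>\<Psi> 0\<close>, has the right derivative; its continuity at 0 gives the
  limit at the cusp.\<close>

lemma expansion_primitive:
  assumes N: "N \<ge> 1" and c0: "c 0 = 0"
    and s: "q_series N c g"
  obtains G where "\<And>z. z \<in> upper_half \<Longrightarrow> (G has_field_derivative two_pi_i * g z) (at z)"
    "(G \<longlongrightarrow> 0) at_i_inf"
proof -
  obtain \<phi> where hol: "\<phi> holomorphic_on ball 0 1"
    and \<phi>: "\<And>z. z \<in> upper_half \<Longrightarrow> g z = qexp N z * \<phi> (qexp N z)"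
    using expansion_factor[OF N c0 s] by metis
  obtain \<Psi> where \<Psi>: "\<And>w. w \<in> ball 0 1 \<Longrightarrow> (\<Psi> has_field_derivative \<phi> w) (at w within ball 0 1)"
    using holomorphic_convex_primitive'[OF convex_ball open_ball hol] by metis
  define G where "G z = of_nat N * (\<Psi> (qexp N z) - \<Psi> 0)" for z
  show ?thesis
  proof (rule that[of G])
    fix z assume z: "z \<in> upper_half"
    have w: "qexp N z \<in> ball 0 1" using qexp_in_ball[OF N z] .
    have d: "(\<Psi> has_field_derivative \<phi> (qexp N z)) (at (qexp N z))"
      using \<Psi>[OF w] at_within_open[OF w open_ball] by simp
    have e: "(qexp N has_field_derivative (two_pi_i / of_nat N) * qexp N z) (at z)"
      unfolding qexp_def by (auto intro!: derivative_eq_intros) (use N in simp)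
    have "(G has_field_derivative of_nat N * (\<phi> (qexp N z) * ((two_pi_i / of_nat N) * qexp N z))) (at z)"
      unfolding G_def by (auto intro!: derivative_eq_intros DERIV_chain2[OF d e])
    then show "(G has_field_derivative two_pi_i * g z) (at z)"
      using N by (simp add: \<phi>[OF z] field_simps)
  next
    have "(\<Psi> has_field_derivative \<phi> 0) (at 0)"
      using \<Psi>[of 0] at_within_open[of "0::complex" "ball 0 1"] by simp
    then have "isCont \<Psi> 0" by (rule DERIV_isCont)
    then have "((\<lambda>z. \<Psi> (qexp N z)) \<longlongrightarrow> \<Psi> 0) at_i_inf"
      using qexp_tendsto_0[OF N] by (rule isCont_tendsto_compose)
    then have "((\<lambda>z. of_nat N * (\<Psi> (qexp N z) - \<Psi> 0)) \<longlongrightarrow> of_nat N * (\<Psi> 0 - \<Psi> 0)) at_i_inf"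
      by (intro tendsto_intros)
    then show "(G \<longlongrightarrow> 0) at_i_inf" by (simp add: G_def[abs_def])
  qed
qed

lemma upper_half_const_diff:
  assumes "\<And>z. z \<in> upper_half \<Longrightarrow> (F has_field_derivative D z) (at z)"
    and "\<And>z. z \<in> upper_half \<Longrightarrow> (G has_field_derivative D z) (at z)"
  obtains C where "\<And>z. z \<in> upper_half \<Longrightarrow> F z = G z + C"
proof -
  have "((\<lambda>z. F z - G z) has_field_derivative 0) (at z within upper_half)" if "z \<in> upper_half" for z
    using DERIV_diff[OF assms(1)[OF that] assms(2)[OF that]] has_field_derivative_at_within by fastforce
  then obtain C where "\<And>z. z \<in> upper_half \<Longrightarrow> F z - G z = C"
    using has_field_derivative_zero_constant[OF convex_upper_half, of "\<lambda>z. F z - G z"] by metis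
  then show ?thesis using that[of C] by (metis add.commute diff_add_cancel)
qed

text \<open>The tool for the functional equations of \<open>F\<close> below: both sides are compared
  through their derivatives and their limits at the cusp.\<close>

lemma upper_half_primitive_unique:
  assumes "\<And>z. z \<in> upper_half \<Longrightarrow> (F has_field_derivative D z) (at z)"
    and "\<And>z. z \<in> upper_half \<Longrightarrow> (G has_field_derivative D z) (at z)"
    and "(F \<longlongrightarrow> 0) at_i_inf" "(G \<longlongrightarrow> 0) at_i_inf" and "z \<in> upper_half"
  shows "F z = G z"
proof -
  obtain C where C: "\<And>z. z \<in> upper_half \<Longrightarrow> F z = G z + C"
    using upper_half_const_diff[of F D G] assms(1,2) by blast
  have "(F \<longlongrightarrow> 0 + C) at_i_inf"
    by (rule Lim_transform_eventually[of "\<lambda>z. G z + C"])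
       (use tendsto_add[OF assms(4) tendsto_const[of C]] C in \<open>auto intro!: eventually_mono[OF eventually_at_i_inf_upper_half]\<close>)
  then have "C = 0" using tendsto_unique[OF at_i_inf_neq_bot assms(3)] by simp
  then show ?thesis using C assms(5) by simp
qed

section \<open>The action of the modular group\<close>

lemma rational_newform2D:
  assumes "rational_newform2 N f a"
  shows "N \<ge> 1" "f \<in> cusp_forms2 N" "a 0 = 0" "a 1 = 1" "\<And>n. a n \<in> \<rat>"
    "q_series 1 a f"
    "\<And>n. n \<ge> 1 \<Longrightarrow> \<exists>t. \<forall>z\<in>upper_half. hecke2 N n f z = t * f z"
  using assms by (auto simp: rational_newform2_def new_forms2_def q_expansion_def)

lemma SL2Z_denom_nz:
  assumes "(a,b,c,d) \<in> SL2Z" "z \<in> upper_half"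
  shows "of_int c * z + of_int d \<noteq> 0"
proof
  assume 0: "of_int c * z + of_int d = 0"
  then have "Im (of_int c * z + of_int d) = 0" by simp
  then have "c = 0" using assms(2) by (simp add: upper_half_def)
  then have "d = 0" using 0 by simp
  then show False using assms(1) \<open>c = 0\<close> by (simp add: SL2Z_def)
qed

lemma Im_act:
  assumes "(a,b,c,d) \<in> SL2Z"
  shows "Im (act (a,b,c,d) z) = Im z / (norm (of_int c * z + of_int d))\<^sup>2"
proof -
  have ad: "real_of_int (a * d - b * c) = 1" using assms by (simp add: SL2Z_def)
  have "Im (act (a,b,c,d) z) = ((a * Im z) * (c * Re z + d) - (a * Re z + b) * (c * Im z)) / (norm (of_int c * z + of_int d))\<^sup>2"
    by (simp add: Im_divide cmod_power2)
  also have "(a * Im z) * (c * Re z + d) - (a * Re z + b) * (c * Im z) = real_of_int (a * d - b * c) * Im z"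
    by (simp add: algebra_simps)
  finally show ?thesis using ad by simp
qed

lemma act_upper_half:
  assumes "(a,b,c,d) \<in> SL2Z" "z \<in> upper_half"
  shows "act (a,b,c,d) z \<in> upper_half"
  using Im_act[OF assms(1), of z] SL2Z_denom_nz[OF assms] assms(2)
  by (simp add: upper_half_def del: act.simps)

lemma SL2Z_inverse: "(a,b,c,d) \<in> SL2Z \<Longrightarrow> (d,-b,-c,a) \<in> SL2Z"
  by (simp add: SL2Z_def mult.commute)

lemma act_inverse:
  assumes "(a,b,c,d) \<in> SL2Z" "z \<in> upper_half"
  shows "act (a,b,c,d) (act (d,-b,-c,a) z) = z"
proof -
  have nz: "- (of_int c * z) + of_int a \<noteq> 0"
    using SL2Z_denom_nz[OF SL2Z_inverse[OF assms(1)] assms(2)] by simp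
  have ad: "of_int a * of_int d - of_int b * of_int c = (1::complex)"
    using assms(1) by (simp add: SL2Z_def flip: of_int_mult of_int_diff)
  let ?w = "(of_int d * z - of_int b) / (- (of_int c * z) + of_int a)"
  have 1: "of_int c * ?w + of_int d = 1 / (- (of_int c * z) + of_int a)"
    using nz ad by (simp add: field_simps)
  have 2: "of_int a * ?w + of_int b = z / (- (of_int c * z) + of_int a)"
    using nz ad by (simp add: field_simps)
  have "act (a,b,c,d) ?w = z" unfolding act.simps 1 2 using nz by simp
  then show ?thesis by simp
qed

lemma act_has_field_derivative:
  assumes "(a,b,c,d) \<in> SL2Z" "z \<in> upper_half"
  shows "(act (a,b,c,d) has_field_derivative 1 / (of_int c * z + of_int d)\<^sup>2) (at z)"
proof -
  have nz: "of_int c * z + of_int d \<noteq> 0" using SL2Z_denom_nz[OF assms] .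
  have ad: "of_int a * of_int d - of_int b * of_int c = (1::complex)"
    using assms(1) by (simp add: SL2Z_def flip: of_int_mult of_int_diff)
  have eq: "act (a,b,c,d) = (\<lambda>z. (of_int a * z + of_int b) / (of_int c * z + of_int d))" by auto
  have "((\<lambda>z. (of_int a * z + of_int b) / (of_int c * z + of_int d)) has_field_derivative
    (of_int a * (of_int c * z + of_int d) - (of_int a * z + of_int b) * of_int c) /
      ((of_int c * z + of_int d) * (of_int c * z + of_int d))) (at z)"
    using nz by (auto intro!: derivative_eq_intros)
  also have "of_int a * (of_int c * z + of_int d) - (of_int a * z + of_int b) * of_int c = 1"
    using ad by (simp add: algebra_simps)
  finally show ?thesis unfolding eq by (simp add: power2_eq_square)
qed

lemma Gamma0_subset_SL2Z: "Gamma0 N \<subseteq> SL2Z"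
  by (auto simp: Gamma0_def SL2Z_def)

lemma mat2_mult_SL2Z:
  assumes "g \<in> SL2Z" "h \<in> SL2Z" shows "mat2_mult g h \<in> SL2Z"
proof -
  obtain a b c d a' b' c' d' where e: "g = (a,b,c,d)" "h = (a',b',c',d')" by (metis prod_cases4)
  have "(a * d - b * c) * (a' * d' - b' * c') = 1" using assms by (simp add: e SL2Z_def)
  then show ?thesis by (simp add: e SL2Z_def algebra_simps)
qed

lemma act_mult:
  assumes "g \<in> SL2Z" "h \<in> SL2Z" "z \<in> upper_half"
  shows "act (mat2_mult g h) z = act g (act h z)"
proof -
  obtain a b c d a' b' c' d' where e: "g = (a,b,c,d)" "h = (a',b',c',d')" by (metis prod_cases4)
  have 1: "of_int c' * z + of_int d' \<noteq> 0" using SL2Z_denom_nz assms e by metis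
  show ?thesis using 1 by (simp add: e add_divide_eq_iff divide_add_eq_iff) (simp add: field_simps)
qed

lemma slash2_mult:
  assumes "g \<in> SL2Z" "h \<in> SL2Z" "z \<in> upper_half"
  shows "slash2 f (mat2_mult g h) z = slash2 (slash2 f g) h z"
proof -
  obtain a b c d a' b' c' d' where e: "g = (a,b,c,d)" "h = (a',b',c',d')" by (metis prod_cases4)
  have 1: "of_int c' * z + of_int d' \<noteq> 0" using SL2Z_denom_nz assms e by metis
  let ?w = "act (a',b',c',d') z"
  have w: "of_int c * ?w + of_int d = (of_int (c * a' + d * c') * z + of_int (c * b' + d * d')) / (of_int c' * z + of_int d')"
    using 1 by (simp add: field_simps)
  have "slash2 (slash2 f g) h z = f (act g ?w) / (of_int c * ?w + of_int d)^2 / (of_int c' * z + of_int d')^2"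
    by (simp add: e del: act.simps)
  also have "act g ?w = act (mat2_mult g h) z" using act_mult[OF assms] e by simp
  also have "f (act (mat2_mult g h) z) / (of_int c * ?w + of_int d)^2 / (of_int c' * z + of_int d')^2
     = f (act (mat2_mult g h) z) / (of_int (c * a' + d * c') * z + of_int (c * b' + d * d'))^2"
    unfolding w using 1 by (simp add: power_divide)
  finally show ?thesis by (simp add: e del: act.simps)
qed

text \<open>The two matrices differ by a left factor in \<open>Gamma0 N\<close>.\<close>

lemma slash2_cong_bottom_row:
  assumes f: "f \<in> cusp_forms2 N" and g: "(a,b,c,d) \<in> SL2Z" and h: "(a',b',c',d') \<in> SL2Z"
    and cd: "[c = c'] (mod int N)" "[d = d'] (mod int N)" and z: "z \<in> upper_half"
  shows "slash2 f (a,b,c,d) z = slash2 f (a',b',c',d') z"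
proof -
  define k where "k = mat2_mult (a,b,c,d) (d',-b',-c',a')"
  have k: "k \<in> SL2Z" unfolding k_def by (intro mat2_mult_SL2Z g SL2Z_inverse h)
  have "int N dvd c * d' - d * c'"
  proof -
    have "[c * d' = c' * d] (mod int N)" using cd by (intro cong_mult) (auto simp: cong_sym)
    then show ?thesis by (simp add: cong_iff_dvd_diff mult.commute)
  qed
  then have "k \<in> Gamma0 N" using k by (auto simp: k_def Gamma0_def SL2Z_def)
  moreover have "mat2_mult k (a',b',c',d') = (a,b,c,d)"
  proof -
    have e: "a' * d' = 1 + b' * c'" using h by (simp add: SL2Z_def)
    have "mat2_mult k (a',b',c',d') = (a * (a'*d' - b'*c'), b * (a'*d' - b'*c'), c * (a'*d' - b'*c'), d * (a'*d' - b'*c'))"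
      by (simp add: k_def algebra_simps)
    then show ?thesis by (simp add: e)
  qed
  ultimately have "slash2 f (a,b,c,d) z = slash2 (slash2 f k) (a',b',c',d') z"
    using slash2_mult[OF k h z, of f] by simp
  also have "\<dots> = slash2 f k (act (a',b',c',d') z) / (of_int c' * z + of_int d')^2"
    by (simp del: act.simps)
  also have "slash2 f k (act (a',b',c',d') z) = f (act (a',b',c',d') z)"
    using f \<open>k \<in> Gamma0 N\<close> act_upper_half[OF h z] by (simp add: cusp_forms2_def del: act.simps)
  finally show ?thesis by (simp del: act.simps)
qed

lemma cusp_form_slash_bound:
  assumes N: "N \<ge> 1" and f: "f \<in> cusp_forms2 N" and g: "g \<in> SL2Z" and y0: "y0 > 0"
  obtains K where "K \<ge> 0" "\<And>z. Im z \<ge> y0 \<Longrightarrow> norm (slash2 f g z) \<le> K * exp (- (2 * pi * Im z / N))"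
proof -
  obtain c where c: "c 0 = 0"
    "q_series N c (slash2 f g)"
    using f g unfolding cusp_forms2_def by blast
  show ?thesis by (rule expansion_bound[OF N c y0 that])
qed

text \<open>By \<open>slash2_cong_bottom_row\<close> the function \<open>slash2 f g\<close> depends
  only on the bottom row of \<open>g\<close> modulo \<open>N\<close>, so finitely many constants
  suffice; pairs of residues that come from no bottom row satisfy \<open>?P\<close>
  vacuously.\<close>

lemma cusp_form_slash_bound_uniform:
  assumes N: "N \<ge> 1" and f: "f \<in> cusp_forms2 N" and y0: "y0 > 0"
  obtains K where "K \<ge> 0" "\<And>g z. g \<in> SL2Z \<Longrightarrow> Im z \<ge> y0 \<Longrightarrow>
    norm (slash2 f g z) \<le> K * exp (- (2 * pi * Im z / N))"
proof -
  have "\<exists>K. \<forall>g\<in>SL2Z. \<forall>z. Im z \<ge> y0 \<longrightarrow> fst (snd (snd g)) mod int N = i \<longrightarrow> snd (snd (snd g)) mod int N = j \<longrightarrow>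
      norm (slash2 f g z) \<le> K * exp (- (2 * pi * Im z / N))" (is "\<exists>K. ?P i j K") for i j
  proof (cases "\<exists>g\<in>SL2Z. fst (snd (snd g)) mod int N = i \<and> snd (snd (snd g)) mod int N = j")
    case True
    then obtain g where g: "g \<in> SL2Z" "fst (snd (snd g)) mod int N = i" "snd (snd (snd g)) mod int N = j"
      by blast
    obtain K where K: "\<And>z. Im z \<ge> y0 \<Longrightarrow> norm (slash2 f g z) \<le> K * exp (- (2 * pi * Im z / N))"
      using cusp_form_slash_bound[OF N f g(1) y0] by blast
    have "?P i j K"
    proof (intro ballI allI impI)
      fix h z assume h: "h \<in> SL2Z" and z: "Im z \<ge> y0" and ij: "fst (snd (snd h)) mod int N = i" "snd (snd (snd h)) mod int N = j"
      obtain a' b' c' d' a b c d where e: "h = (a',b',c',d')" "g = (a,b,c,d)" by (metis prod_cases4)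
      have "slash2 f h z = slash2 f g z" unfolding e
        by (rule slash2_cong_bottom_row[OF f]) (use g h ij e z y0 in \<open>auto simp: cong_def upper_half_def\<close>)
      then show "norm (slash2 f h z) \<le> K * exp (- (2 * pi * Im z / N))" using K[OF z] by simp
    qed
    then show ?thesis by blast
  next
    case False
    then show ?thesis by blast
  qed
  then obtain K where K: "\<And>i j. ?P i j (K i j)" by metis
  define M where "M = (\<Sum>i\<in>{0..<int N}. \<Sum>j\<in>{0..<int N}. \<bar>K i j\<bar>)"
  show ?thesis
  proof (rule that[of M])
    show "M \<ge> 0" unfolding M_def by (intro sum_nonneg) auto
    fix g z assume g: "g \<in> SL2Z" and z: "Im z \<ge> y0"
    define i j where "i = fst (snd (snd g)) mod int N" and "j = snd (snd (snd g)) mod int N"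
    have ij: "i \<in> {0..<int N}" "j \<in> {0..<int N}" using N by (auto simp: i_def j_def)
    have "norm (slash2 f g z) \<le> K i j * exp (- (2 * pi * Im z / N))"
      using K[of i j] g z by (auto simp: i_def j_def)
    also have "K i j \<le> \<bar>K i j\<bar>" by simp
    also have "\<bar>K i j\<bar> \<le> (\<Sum>j\<in>{0..<int N}. \<bar>K i j\<bar>)"
      by (rule member_le_sum[of j _ "\<lambda>j. \<bar>K i j\<bar>"]) (use ij in auto)
    also have "\<dots> \<le> M" unfolding M_def
      by (rule member_le_sum[of i _ "\<lambda>i. \<Sum>j\<in>{0..<int N}. \<bar>K i j\<bar>"]) (use ij in \<open>auto intro: sum_nonneg\<close>)
    finally show "norm (slash2 f g z) \<le> M * exp (- (2 * pi * Im z / N))" by (simp add: mult_right_mono)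
  qed
qed

text \<open>Plays the part of the reduction to a fundamental domain. Dirichlet approximation of
  \<open>Re z\<close> with \<open>n\<close> about \<open>1 / sqrt y\<close> yields a bottom row
  \<open>(k, -h)\<close> with \<open>(k * Re z - h)^2 \<le> 4 * y\<close> and
  \<open>(k * y)^2 \<le> y\<close>; hence the constant \<open>1 / (4 + 1)\<close>.\<close>

lemma SL2Z_reduction:
  assumes z: "Im z > 0" "Im z < 1"
  obtains a b c d where "(a,b,c,d) \<in> SL2Z" "Im (act (a,b,c,d) z) \<ge> 1 / 5"
proof -
  define y where "y = Im z"
  define n where "n = nat \<lfloor>1 / sqrt y\<rfloor>"
  have y: "0 < y" "y < 1" using z by (auto simp: y_def)
  have s: "0 < sqrt y" "sqrt y < 1" using y by auto
  then have "1 / sqrt y \<ge> 1" by simp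
  then have n1: "n > 0" "real n \<le> 1 / sqrt y" unfolding n_def by linarith+
  have "real n + 1 > 1 / sqrt y" unfolding n_def using \<open>1 / sqrt y \<ge> 1\<close> by linarith
  obtain h k where hk: "coprime h k" "0 < k" "k \<le> int n" "\<bar>of_int k * Re z - of_int h\<bar> < 1 / n"
    using Dirichlet_approx_coprime[OF n1(1)] by metis
  obtain u w where "u * h + w * k = 1" using hk(1) by (metis bezout_int coprime_imp_gcd_eq_1)
  then have g: "(-u, -w, k, -h) \<in> SL2Z" by (simp add: SL2Z_def algebra_simps)
  have "1 / real n \<le> 2 * sqrt y"
  proof -
    have "1 / sqrt y < 2 * n" using \<open>real n + 1 > 1 / sqrt y\<close> n1 by linarith
    then have "1 \<le> 2 * sqrt y * n" using s by (simp add: divide_less_eq mult_ac)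
    then show ?thesis using n1(1) by (simp add: divide_le_eq)
  qed
  have "(norm (of_int k * z + of_int (-h)))\<^sup>2 = (of_int k * Re z - of_int h)\<^sup>2 + (of_int k * y)\<^sup>2"
    by (simp add: cmod_power2 y_def)
  also have "(of_int k * Re z - of_int h)\<^sup>2 \<le> (2 * sqrt y)\<^sup>2"
    using hk(4) \<open>1 / real n \<le> 2 * sqrt y\<close> by (subst abs_le_square_iff[symmetric]) (use s in auto)
  also have "(2 * sqrt y)\<^sup>2 = 4 * y" using y by (simp add: power_mult_distrib)
  also have "(of_int k * y)\<^sup>2 \<le> y"
  proof -
    have "real_of_int k \<le> real n" using hk(3) by linarith
    then have "of_int k * y \<le> real n * y" using y by (intro mult_right_mono) auto
    also have "\<dots> \<le> 1 / sqrt y * y" using n1 y by (intro mult_right_mono) auto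
    also have "\<dots> = sqrt y" using y by (metis less_eq_real_def real_div_sqrt times_divide_eq_left mult_1)
    finally have "(of_int k * y)\<^sup>2 \<le> (sqrt y)\<^sup>2" using hk(2) y by (intro power_mono) auto
    then show ?thesis using y by simp
  qed
  finally have le: "(norm (of_int k * z + of_int (-h)))\<^sup>2 \<le> 5 * y" by simp
  have "(norm (of_int k * z + of_int (-h)))\<^sup>2 > 0"
    using SL2Z_denom_nz[OF g] z by (simp add: upper_half_def)
  then have "Im (act (-u, -w, k, -h) z) \<ge> 1 / 5"
    unfolding Im_act[OF g] using le by (simp add: y_def field_simps)
  then show ?thesis using that g by blast
qed

section \<open>The primitive of a newform and its values at the cusps\<close>

text \<open>Cauchy's estimate on the circle of radius \<open>r\<close>; the formal power series
  serves to identify \<open>c n\<close> with a Taylor coefficient of \<open>A\<close> at 0.\<close>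

lemma powser_coeff_bound:
  fixes c :: "nat \<Rightarrow> complex"
  assumes s: "\<And>w. w \<in> ball 0 1 \<Longrightarrow> (\<lambda>n. c n * w ^ n) sums A w"
    and r: "0 < r" "r < 1" and B: "\<And>w. norm w = r \<Longrightarrow> norm (A w) \<le> B"
  shows "norm (c n) \<le> B / r ^ n"
proof -
  have hol: "A holomorphic_on ball 0 1" using power_series_holomorphic[of 0 1 c A] s by simp
  have "conv_radius c \<ge> ereal 1"
  proof (rule conv_radius_geI_ex)
    fix x :: real assume "0 < x" "ereal x < ereal 1"
    then show "\<exists>z. norm z = x \<and> summable (\<lambda>n. c n * z ^ n)"
      using s[of "of_real x"] by (intro exI[of _ "of_real x"]) (auto simp: sums_iff)
  qed
  then have R: "fps_conv_radius (Abs_fps c) \<ge> 1"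
    by (simp add: fps_conv_radius_def one_ereal_def)
  have "eventually (\<lambda>w. w \<in> ball 0 1) (nhds (0::complex))" by (rule eventually_nhds_in_open) auto
  then have "eventually (\<lambda>w. eval_fps (Abs_fps c) w = A w) (nhds 0)"
    by eventually_elim (use s in \<open>auto simp: eval_fps_def sums_iff\<close>)
  then have "A has_fps_expansion Abs_fps c"
    using R by (auto simp: has_fps_expansion_def intro: less_le_trans[of 0 1])
  then have "c n = (deriv ^^ n) A 0 / fact n"
    using fps_nth_fps_expansion[of A "Abs_fps c" n] by simp
  moreover have "norm ((deriv ^^ n) A 0) \<le> fact n * B / r ^ n"
  proof (rule Cauchy_inequality)
    show "A holomorphic_on ball 0 r" by (rule holomorphic_on_subset[OF hol]) (use r in auto)
    show "continuous_on (cball 0 r) A"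
      by (rule holomorphic_on_imp_continuous_on, rule holomorphic_on_subset[OF hol]) (use r in auto)
  qed (use r B in auto)
  ultimately have "norm (c n) \<le> (fact n * B / r ^ n) / fact n"
    by (simp only: norm_divide norm_fact) (rule divide_right_mono, auto)
  then show ?thesis by simp
qed

text \<open>The quotient is \<open>\<phi>\<close> of the local parameter, and
  \<open>\<phi> 0 = c 1\<close>. Used to read off a Hecke eigenvalue.\<close>

lemma expansion_leading:
  assumes N: "N \<ge> 1" and c0: "c 0 = 0"
    and s: "q_series N c g"
  shows "((\<lambda>z. g z / qexp N z) \<longlongrightarrow> c 1) at_i_inf"
proof -
  obtain \<phi> where hol: "\<phi> holomorphic_on ball 0 1"
    and ps: "\<And>w. w \<in> ball 0 1 \<Longrightarrow> (\<lambda>n. c (Suc n) * w ^ n) sums \<phi> w"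
    and \<phi>: "\<And>z. z \<in> upper_half \<Longrightarrow> g z = qexp N z * \<phi> (qexp N z)"
    using expansion_factor[OF N c0 s] by blast
  have "(\<lambda>n. c (Suc n) * 0 ^ n) sums c (Suc 0)"
    using sums_finite[of "{0}" "\<lambda>n. c (Suc n) * 0 ^ n"] by simp
  then have "\<phi> 0 = c 1" using ps[of 0] sums_unique2 by fastforce
  moreover have "isCont \<phi> 0"
    using holomorphic_on_imp_continuous_on[OF hol] continuous_on_interior by fastforce
  ultimately have "((\<lambda>z. \<phi> (qexp N z)) \<longlongrightarrow> c 1) at_i_inf"
    using isCont_tendsto_compose[OF _ qexp_tendsto_0[OF N]] by metis
  then show ?thesis
    by (rule Lim_transform_eventually)
       (auto intro!: eventually_mono[OF eventually_at_i_inf_upper_half] simp: \<phi> qexp_def)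
qed

text \<open>An instance of \<open>(1 + x / n) ^ n \<le> exp x\<close> with \<open>x = c * u\<close>,
  where \<open>n\<close> is a positive integer not below \<open>B\<close>.\<close>

lemma powr_exp_bound:
  fixes B c :: real
  assumes c: "c > 0"
  obtains C where "C \<ge> 0" "\<And>u. u \<ge> 1 \<Longrightarrow> u powr B * exp (- (c * u)) \<le> C"
proof -
  define n where "n = nat \<lceil>max B 1\<rceil>"
  have n: "n > 0" "real n \<ge> B" unfolding n_def by linarith+
  show ?thesis
  proof (rule that[of "(n / c) ^ n"])
    fix u :: real assume u: "u \<ge> 1"
    have "(c * u / n) ^ n \<le> (1 + c * u / n) ^ n" by (intro power_mono) (use c u in auto)
    also have "\<dots> \<le> exp (c * u)"
      by (rule exp_ge_one_plus_x_over_n_power_n) (use c u n in \<open>auto intro: order_trans[of _ 0]\<close>)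
    finally have "u ^ n \<le> (n / c) ^ n * exp (c * u)"
      using c n by (simp add: power_divide power_mult_distrib field_simps)
    moreover have "u powr B \<le> u ^ n" using u n by (simp add: powr_mono flip: powr_realpow)
    ultimately have "u powr B \<le> (n / c) ^ n * exp (c * u)" by linarith
    then show "u powr B * exp (- (c * u)) \<le> (n / c) ^ n"
      by (simp add: exp_minus field_simps)
  qed (use c in auto)
qed

section \<open>Growth of a newform towards the real axis and of its coefficients\<close>

locale newform =
  fixes N :: nat and f :: "complex \<Rightarrow> complex" and a :: "nat \<Rightarrow> complex"
  assumes newform: "rational_newform2 N f a"
begin

lemmas N_ge_1 = rational_newform2D(1)[OF newform]
lemmas f_cusp = rational_newform2D(2)[OF newform]
lemmas a_0 = rational_newform2D(3)[OF newform]
lemmas a_1 = rational_newform2D(4)[OF newform]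
lemmas a_rat = rational_newform2D(5)[OF newform]
lemmas f_expansion = rational_newform2D(6)[OF newform]

lemma f_sums: "z \<in> upper_half \<Longrightarrow> (\<lambda>n. a n * qexp 1 z ^ n) sums f z"
  using f_expansion unfolding qexp_power by blast

text \<open>The product of \<open>norm (f z)\<close> and \<open>Im z\<close> does not change when
  \<open>z\<close> is moved by a matrix and \<open>f\<close> is replaced by its slash. After moving
  to \<open>Im w \<ge> 1 / 5\<close>, the exponential decay absorbs the factor
  \<open>Im w\<close>.\<close>

lemma f_bound:
  obtains K where "K \<ge> 0" "\<And>z. 0 < Im z \<Longrightarrow> Im z < 1 \<Longrightarrow> norm (f z) \<le> K / Im z"
proof -
  obtain K where K: "K \<ge> 0" "\<And>g z. g \<in> SL2Z \<Longrightarrow> Im z \<ge> 1 / 5 \<Longrightarrow>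
    norm (slash2 f g z) \<le> K * exp (- (2 * pi * Im z / N))"
    using cusp_form_slash_bound_uniform[OF N_ge_1 f_cusp, of "1/5"] by auto
  show ?thesis
  proof (rule that[of "K * N"])
    fix z assume z: "0 < Im z" "Im z < 1"
    then have zH: "z \<in> upper_half" by (simp add: upper_half_def)
    obtain p q c d where g: "(p,q,c,d) \<in> SL2Z" and im: "Im (act (p,q,c,d) z) \<ge> 1 / 5"
      using SL2Z_reduction[OF z] .
    define w where "w = act (p,q,c,d) z"
    have wH: "w \<in> upper_half" unfolding w_def by (rule act_upper_half[OF g zH])
    note g' = SL2Z_inverse[OF g]
    have z_eq: "z = act (d,-q,-c,p) w"
      using act_inverse[OF g' zH] by (simp add: w_def)
    define D where "D = norm (of_int (-c) * w + of_int p)"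
    have D: "D > 0" using SL2Z_denom_nz[OF g' wH] by (simp add: D_def)
    have Imz: "Im z = Im w / D\<^sup>2" unfolding D_def by (subst z_eq, rule Im_act[OF g'])
    have "norm (slash2 f (d,-q,-c,p) w) = norm (f z) / D\<^sup>2"
      by (simp add: D_def norm_divide norm_power z_eq[simplified])
    then have "norm (f z) = norm (slash2 f (d,-q,-c,p) w) * D\<^sup>2" using D by simp
    also have "\<dots> \<le> K * exp (- (2 * pi * Im w / N)) * D\<^sup>2"
      by (intro mult_right_mono K(2) g') (use im in \<open>auto simp: w_def\<close>)
    also have "D\<^sup>2 = Im w / Im z" using Imz z D by (simp add: field_simps)
    also have "K * exp (- (2 * pi * Im w / N)) * (Im w / Im z) = K * (exp (- (2 * pi * Im w / N)) * Im w) / Im z"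
      by simp
    also have "exp (- (2 * pi * Im w / N)) * Im w \<le> N"
    proof -
      have Iw: "Im w > 0" using wH by (simp add: upper_half_def)
      have "Im w / N \<le> 2 * pi * Im w / N"
        using Iw pi_gt3 by (intro divide_right_mono) auto
      also have "\<dots> \<le> exp (2 * pi * Im w / N)" using exp_ge_add_one_self[of "2 * pi * Im w / N"] by linarith
      finally show ?thesis using N_ge_1 by (simp add: exp_minus field_simps)
    qed
    finally show "norm (f z) \<le> K * N / Im z" using K(1) z
      by (simp add: mult_left_mono divide_right_mono)
  qed (use K in auto)
qed

text \<open>Hecke's argument: the Cauchy estimate is applied at a height inversely proportional to
  \<open>n\<close>, where \<open>r ^ n\<close> is constant and \<open>f_bound\<close> is of order
  \<open>n\<close>.\<close>

lemma a_bound: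
  obtains C where "C \<ge> 0" "\<And>n. norm (a n) \<le> C * real n"
proof -
  obtain K where K: "K \<ge> 0" "\<And>z. 0 < Im z \<Longrightarrow> Im z < 1 \<Longrightarrow> norm (f z) \<le> K / Im z"
    using f_bound by blast
  have one: "(1::nat) \<ge> 1" by simp
  obtain \<phi> where "\<phi> holomorphic_on ball 0 1"
    and ps: "\<And>w. w \<in> ball 0 1 \<Longrightarrow> (\<lambda>n. a (Suc n) * w ^ n) sums \<phi> w"
    and \<phi>: "\<And>z. z \<in> upper_half \<Longrightarrow> f z = qexp 1 z * \<phi> (qexp 1 z)"
    using expansion_factor[OF one a_0 f_expansion] by blast
  have s: "(\<lambda>n. a n * w ^ n) sums (w * \<phi> w)" if "w \<in> ball 0 1" for w
  proof -
    have "(\<lambda>n. w * (a (Suc n) * w ^ n)) sums (w * \<phi> w)" by (intro sums_mult ps that)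
    then have "(\<lambda>n. a (Suc n) * w ^ Suc n) sums (w * \<phi> w)" by (simp add: mult_ac)
    then show ?thesis by (subst (asm) sums_Suc_iff) (simp add: a_0)
  qed
  show ?thesis
  proof (rule that[of "2 * K * exp pi"])
    fix n show "norm (a n) \<le> 2 * K * exp pi * real n"
    proof (cases "n = 0")
      case True then show ?thesis by (simp add: a_0)
    next
      case False
      \<comment> \<open>The factor 2 keeps \<open>y < 1\<close>, as \<open>f_bound\<close> demands,
        also for \<open>n = 1\<close>.\<close>
      define y where "y = 1 / (2 * real n)"
      have y: "0 < y" "y < 1" using False by (auto simp: y_def field_simps)
      define r where "r = exp (- (2 * pi * y))"
      have "norm (a n) \<le> (K / y) / r ^ n"
      proof (rule powser_coeff_bound[OF s])
        show "0 < r" "r < 1" using y by (auto simp: r_def)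
        fix w :: complex assume w: "norm w = r"
        then have "w \<in> ball 0 1" "w \<noteq> 0" using y by (auto simp: r_def)
        then obtain z where z: "z \<in> upper_half" "w = qexp 1 z" using qexp_surj[OF one] by blast
        have "Im z = y" using w unfolding z(2) norm_qexp r_def by simp
        then have "norm (f z) \<le> K / y" using K(2)[of z] y by simp
        then show "norm (w * \<phi> w) \<le> K / y" using \<phi>[OF z(1)] z(2) by simp
      qed
      also have "r ^ n = exp (- pi)"
        using False by (simp add: r_def y_def flip: exp_of_nat_mult)
      also have "K / y / exp (- pi) = 2 * K * exp pi * n" using False by (simp add: y_def exp_minus field_simps)
      finally show ?thesis .
    qed
  qed (use K in auto)
qed

text \<open>Characterised by its derivative and its limit at the cusp in place of a series, since
  these are the two properties that later arguments draw on.\<close>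

definition F :: "complex \<Rightarrow> complex" where
  "F = (SOME G. (\<forall>z\<in>upper_half. (G has_field_derivative two_pi_i * f z) (at z)) \<and>
         (G \<longlongrightarrow> 0) at_i_inf)"

lemma F_deriv: "z \<in> upper_half \<Longrightarrow> (F has_field_derivative two_pi_i * f z) (at z)"
  and F_tendsto_0: "(F \<longlongrightarrow> 0) at_i_inf"
proof -
  have "\<exists>G. (\<forall>z\<in>upper_half. (G has_field_derivative two_pi_i * f z) (at z)) \<and> (G \<longlongrightarrow> 0) at_i_inf"
    using expansion_primitive[OF _ a_0 f_expansion] by (metis order_refl)
  from someI_ex[OF this] show "z \<in> upper_half \<Longrightarrow> (F has_field_derivative two_pi_i * f z) (at z)"
    "(F \<longlongrightarrow> 0) at_i_inf" unfolding F_def by blast+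
qed

lemma F_act_deriv:
  assumes g: "g \<in> SL2Z" and z: "z \<in> upper_half"
  shows "((\<lambda>z. F (act g z)) has_field_derivative two_pi_i * slash2 f g z) (at z)"
proof -
  obtain p q c d where e: "g = (p,q,c,d)" by (metis prod_cases4)
  have "((\<lambda>z. F (act g z)) has_field_derivative
     two_pi_i * f (act g z) * (1 / (of_int c * z + of_int d)\<^sup>2)) (at z)"
    by (rule DERIV_chain2[where f = F], rule F_deriv)
       (use g z e in \<open>auto intro: act_has_field_derivative act_upper_half simp del: act.simps\<close>)
  then show ?thesis by (simp add: e)
qed

lemma F_act_tendsto:
  assumes g: "g \<in> SL2Z"
  obtains l where "((\<lambda>z. F (act g z)) \<longlongrightarrow> l) at_i_inf"
proof -
  obtain c where c: "c 0 = 0"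
    "q_series N c (slash2 f g)"
    using f_cusp g unfolding cusp_forms2_def by blast
  obtain G where G: "\<And>z. z \<in> upper_half \<Longrightarrow> (G has_field_derivative two_pi_i * slash2 f g z) (at z)"
    "(G \<longlongrightarrow> 0) at_i_inf" using expansion_primitive[OF N_ge_1 c] by blast
  obtain l where l: "\<And>z. z \<in> upper_half \<Longrightarrow> F (act g z) = G z + l"
    using upper_half_const_diff[OF F_act_deriv[OF g] G(1)] by blast
  have "((\<lambda>z. G z + l) \<longlongrightarrow> 0 + l) at_i_inf" by (intro tendsto_intros G)
  then have "((\<lambda>z. F (act g z)) \<longlongrightarrow> 0 + l) at_i_inf"
    by (rule Lim_transform_eventually)
       (auto intro!: eventually_mono[OF eventually_at_i_inf_upper_half] simp: l)
  then show ?thesis by (rule that)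
qed

text \<open>The quotient in the hypothesis is the imaginary part of \<open>u t\<close> after
  \<open>p/c\<close> has been moved to infinity: \<open>u\<close> enters every horoball at that
  cusp. It is stated for arbitrary \<open>u\<close> because two different approaches to the same
  cusp have to share one limit.\<close>

lemma F_cusp_tendsto:
  assumes g: "(p,q,c,d) \<in> SL2Z"
  obtains l where "\<And>u::real \<Rightarrow> complex. (\<And>t. t > 0 \<Longrightarrow> u t \<in> upper_half) \<Longrightarrow>
     filterlim (\<lambda>t. Im (u t) / (norm (of_int p - of_int c * u t))\<^sup>2) at_top (at_right 0) \<Longrightarrow>
     ((\<lambda>t. F (u t)) \<longlongrightarrow> l) (at_right 0)"
proof -
  obtain l where l: "((\<lambda>z. F (act (p,q,c,d) z)) \<longlongrightarrow> l) at_i_inf" using F_act_tendsto[OF g] .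
  show ?thesis
  proof (rule that[of l])
    fix u :: "real \<Rightarrow> complex"
    assume u: "\<And>t. t > 0 \<Longrightarrow> u t \<in> upper_half"
      and lim: "filterlim (\<lambda>t. Im (u t) / (norm (of_int p - of_int c * u t))\<^sup>2) at_top (at_right 0)"
    have eq: "Im (act (d,-q,-c,p) (u t)) = Im (u t) / (norm (of_int p - of_int c * u t))\<^sup>2" for t
      using Im_act[OF SL2Z_inverse[OF g], of "u t"] by (simp add: algebra_simps)
    have "filterlim (\<lambda>t. act (d,-q,-c,p) (u t)) at_i_inf (at_right 0)"
      unfolding filterlim_filtercomap_iff o_def eq by (rule lim)
    then have "((\<lambda>t. F (act (p,q,c,d) (act (d,-q,-c,p) (u t)))) \<longlongrightarrow> l) (at_right 0)"
      by (rule filterlim_compose[OF l])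
    then show "((\<lambda>t. F (u t)) \<longlongrightarrow> l) (at_right 0)"
      by (rule Lim_transform_eventually)
         (auto intro!: eventually_mono[OF eventually_at_right_less] simp: act_inverse[OF g u] simp del: act.simps)
  qed
qed

definition I :: "real \<Rightarrow> complex" where
  "I x = Lim (at_right 0) (\<lambda>t. F (Complex x t))"

lemma Complex_upper_half [simp]: "Complex x t \<in> upper_half \<longleftrightarrow> t > 0"
  by (simp add: upper_half_def)

lemma SL2Z_first_column:
  assumes "coprime k (m::int)" obtains q d where "(k,q,m,d) \<in> SL2Z"
proof -
  obtain u w where "u * k + w * m = 1" using assms by (metis bezout_int coprime_imp_gcd_eq_1)
  then have "(k,-w,m,u) \<in> SL2Z" by (simp add: SL2Z_def algebra_simps)
  then show ?thesis by (rule that)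
qed

text \<open>The vertical line above \<open>k/m\<close> and the image of the imaginary axis under a
  matrix taking 0 to \<open>k/m\<close> both end in the cusp \<open>k/m\<close>. The first path
  defines \<open>I\<close>; the second allows a transformation law of \<open>F\<close> to be
  evaluated at the cusp.\<close>

lemma I_tendsto_coprime:
  assumes km: "coprime k (int m)" and m: "m \<ge> 1"
  shows "((\<lambda>t. F (Complex (k / m) t)) \<longlongrightarrow> I (k / m)) (at_right 0)"
    and "g = (p,k,c,int m) \<Longrightarrow> g \<in> SL2Z \<Longrightarrow> ((\<lambda>t. F (act g (Complex 0 t))) \<longlongrightarrow> I (k / m)) (at_right 0)"
proof -
  obtain q d where h: "(k,q,int m,d) \<in> SL2Z" using SL2Z_first_column[OF km] .
  obtain l where l: "\<And>u::real \<Rightarrow> complex. (\<And>t. t > 0 \<Longrightarrow> u t \<in> upper_half) \<Longrightarrow>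
     filterlim (\<lambda>t. Im (u t) / (norm (of_int k - of_int (int m) * u t))\<^sup>2) at_top (at_right 0) \<Longrightarrow>
     ((\<lambda>t. F (u t)) \<longlongrightarrow> l) (at_right 0)" using F_cusp_tendsto[OF h] by blast
  have inv: "filterlim (\<lambda>t::real. inverse t) at_top (at_right 0)" by (rule filterlim_inverse_at_top_right)
  have 1: "((\<lambda>t. F (Complex (k / m) t)) \<longlongrightarrow> l) (at_right 0)"
  proof (rule l)
    have "of_int k - of_nat m * Complex (k / m) t = - (\<i> * of_real (m * t))" for t :: real
      using m by (simp add: complex_eq_iff)
    then have "norm (of_int k - of_nat m * Complex (k / m) t) = m * \<bar>t\<bar>" for t :: real
      by (simp add: norm_mult)
    then have "Im (Complex (k / m) t) / (norm (of_int k - of_nat m * Complex (k / m) t))\<^sup>2 = inverse t * (1 / m\<^sup>2)" for t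
      using m by (simp add: power_mult_distrib) (simp add: power2_eq_square field_simps)
    moreover have "filterlim (\<lambda>t::real. inverse t * (1 / m\<^sup>2)) at_top (at_right 0)"
      by (rule filterlim_at_top_mult_tendsto_pos[OF tendsto_const _ inv]) (use m in auto)
    ultimately show "filterlim (\<lambda>t. Im (Complex (k / m) t) / (norm (of_int k - of_int (int m) * Complex (k / m) t))\<^sup>2) at_top (at_right 0)"
      by simp
  qed auto
  then have lI: "l = I (k / m)" unfolding I_def by (simp add: tendsto_Lim)
  show "((\<lambda>t. F (Complex (k / m) t)) \<longlongrightarrow> I (k / m)) (at_right 0)" using 1 lI by simp
  assume g: "g = (p,k,c,int m)" "g \<in> SL2Z"
  have "((\<lambda>t. F (act g (Complex 0 t))) \<longlongrightarrow> l) (at_right 0)"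
  proof (rule l)
    fix t :: real assume "t > 0"
    then show "act g (Complex 0 t) \<in> upper_half" using g act_upper_half Complex_upper_half by blast
  next
    let ?h = "\<lambda>t. Im (act g (Complex 0 t)) / (norm (of_int k - of_int (int m) * act g (Complex 0 t)))\<^sup>2"
    \<comment> \<open>Determinant 1 gives \<open>k - m * act g (i t) = - i t / D\<close> with
      \<open>D\<close> the denominator of the action, while \<open>Im (act g (i t))\<close> is
      \<open>t\<close> over the square of \<open>norm D\<close>; the powers of \<open>norm D\<close>
      cancel.\<close>
    have "eventually (\<lambda>t. inverse t = ?h t) (at_right 0)"
    proof (rule eventually_mono[OF eventually_at_right_less])
      fix t :: real assume t: "0 < t"
      let ?D = "of_int c * Complex 0 t + of_int (int m)"
      have D: "?D \<noteq> 0" using SL2Z_denom_nz g t Complex_upper_half by blast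
      have "p * int m - k * c = 1" using g by (simp add: SL2Z_def)
      then have "complex_of_int (p * int m - k * c) = 1" by (simp only: of_int_1)
      then have ad: "of_int p * of_int (int m) - of_int k * of_int c = (1::complex)" by simp
      have "of_int k - of_int (int m) * act g (Complex 0 t) = (of_int k * ?D - of_int (int m) * (of_int p * Complex 0 t + of_int k)) / ?D"
        using D by (simp add: g diff_divide_distrib)
      also have "of_int k * ?D - of_int (int m) * (of_int p * Complex 0 t + of_int k) =
         - ((of_int p * of_int (int m) - of_int k * of_int c) * Complex 0 t)" by (simp add: algebra_simps)
      also have "\<dots> = - Complex 0 t" unfolding ad by simp
      finally have "norm (of_int k - of_int (int m) * act g (Complex 0 t)) = norm (Complex 0 t) / norm ?D"
        by (simp only: norm_divide norm_minus_cancel)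
      also have "norm (Complex 0 t) = t" using t by (simp add: cmod_def)
      finally have "norm (of_int k - of_int (int m) * act g (Complex 0 t)) = t / norm ?D" .
      moreover have "Im (act g (Complex 0 t)) = t / (norm ?D)\<^sup>2" using Im_act[of p k c "int m"] g by simp
      moreover have "inverse t = (t / (norm ?D)\<^sup>2) / (t / norm ?D)\<^sup>2"
        using t D by (simp only: power_divide) (simp add: power2_eq_square inverse_eq_divide)
      ultimately show "inverse t = ?h t"
        by presburger
    qed
    from filterlim_cong[OF refl refl this] inv
    show "filterlim ?h at_top (at_right 0)"
      by simp
  qed
  then show "((\<lambda>t. F (act g (Complex 0 t))) \<longlongrightarrow> I (k / m)) (at_right 0)" using lI by simp
qed

end

lemma sum_roots_of_unity:
  assumes "m \<ge> 1"
  shows "(\<Sum>b<m. exp (two_pi_i * of_int j * of_nat b / of_nat m)) = (if int m dvd j then of_nat m else 0)"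
proof -
  define \<zeta> where "\<zeta> = exp (two_pi_i * of_int j / of_nat m)"
  have \<zeta>: "exp (two_pi_i * of_int j * of_nat b / of_nat m) = \<zeta> ^ b" for b
    by (simp add: \<zeta>_def mult_ac flip: exp_of_nat_mult)
  have "\<zeta> ^ m = exp (two_pi_i * of_int j)"
    using assms by (simp add: \<zeta>_def flip: exp_of_nat_mult)
  then have pow: "\<zeta> ^ m = 1" by (simp add: exp_eq_1 mult_ac)
  have one: "\<zeta> = 1 \<longleftrightarrow> int m dvd j"
  proof
    assume "\<zeta> = 1"
    then obtain n :: int where "2 * pi * j / m = of_int (2 * n) * pi"
      unfolding \<zeta>_def exp_eq_1 by (auto simp: Im_divide_of_nat)
    then have "real_of_int j = real_of_int n * m" using assms by (simp add: field_simps)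
    then have "real_of_int j = real_of_int (n * int m)" by simp
    then have "j = n * int m" by (simp only: of_int_eq_iff)
    then show "int m dvd j" by simp
  next
    assume "int m dvd j"
    then obtain n where "j = int m * n" by blast
    then show "\<zeta> = 1" using assms by (simp add: \<zeta>_def exp_eq_1 mult_ac)
  qed
  show ?thesis
  proof (cases "int m dvd j")
    case True
    then show ?thesis using one by (simp add: \<zeta>)
  next
    case False
    then show ?thesis using one pow geometric_sum[of \<zeta> m] by (simp add: \<zeta>)
  qed
qed

section \<open>Equivalence under \<open>Gamma0 N\<close> and closed paths on the modular
  curve\<close>

lemma Gamma0_mult: "g \<in> Gamma0 N \<Longrightarrow> h \<in> Gamma0 N \<Longrightarrow> mat2_mult g h \<in> Gamma0 N"
  using mat2_mult_SL2Z[of g h] by (cases g; cases h) (auto simp: Gamma0_def SL2Z_def)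

lemma Gamma0_inverse: "(p,q,c,d) \<in> Gamma0 N \<Longrightarrow> (d,-q,-c,p) \<in> Gamma0 N"
  by (simp add: Gamma0_def mult.commute)

lemma act_in_upper_half_iff:
  assumes "g \<in> SL2Z" shows "act g z \<in> upper_half \<longleftrightarrow> z \<in> upper_half"
proof -
  obtain p q c d where g: "g = (p,q,c,d)" by (metis prod_cases4)
  show ?thesis
  proof
    assume "act g z \<in> upper_half"
    then have "Im z / (norm (of_int c * z + of_int d))\<^sup>2 > 0"
      using Im_act[of p q c d z] assms g by (simp add: upper_half_def)
    then show "z \<in> upper_half" by (simp add: upper_half_def zero_less_divide_iff)
  qed (use g assms act_upper_half in blast)
qed

text \<open>This makes a path from \<open>z\<close> to \<open>act g z\<close> closed in the sense of
  \<open>cycle_mod\<close>. As \<open>cycle_mod\<close> tests every complex number \<open>w\<close>,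
  that \<open>w\<close> lies in the upper half plane has to be recovered from its image.\<close>

lemma Gamma0_equiv_act:
  assumes g: "g \<in> Gamma0 N" and z: "z \<in> upper_half"
  shows "Gamma0_equiv N w (act g z) \<longleftrightarrow> Gamma0_equiv N w z"
proof -
  have gS: "g \<in> SL2Z" using g Gamma0_subset_SL2Z by blast
  obtain p q c d where e: "g = (p,q,c,d)" by (metis prod_cases4)
  define h where "h = (d,-q,-c,p)"
  have h: "h \<in> Gamma0 N" unfolding h_def by (rule Gamma0_inverse) (use g e in simp)
  then have hS: "h \<in> SL2Z" using Gamma0_subset_SL2Z by blast
  have hg: "act h (act g z) = z"
    using act_inverse[of d "-q" "-c" p z] hS z by (simp add: h_def e)
  show ?thesis
  proof
    assume "Gamma0_equiv N w (act g z)"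
    then obtain k where k: "k \<in> Gamma0 N" "act g z = act k w" by (auto simp: Gamma0_equiv_def)
    then have kS: "k \<in> SL2Z" using Gamma0_subset_SL2Z by blast
    have "w \<in> upper_half" using k(2) act_in_upper_half_iff[OF kS] act_in_upper_half_iff[OF gS] z by metis
    then have "z = act (mat2_mult h k) w" using act_mult[OF hS kS] k(2) hg by metis
    then show "Gamma0_equiv N w z" using Gamma0_mult[OF h k(1)] by (auto simp: Gamma0_equiv_def)
  next
    assume "Gamma0_equiv N w z"
    then obtain k where k: "k \<in> Gamma0 N" "z = act k w" by (auto simp: Gamma0_equiv_def)
    then have kS: "k \<in> SL2Z" using Gamma0_subset_SL2Z by blast
    have "w \<in> upper_half" using k(2) act_in_upper_half_iff[OF kS] z by metis
    then have "act g z = act (mat2_mult g k) w" using act_mult[OF gS kS] k(2) by metis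
    then show "Gamma0_equiv N w (act g z)" using Gamma0_mult[OF g k(1)] by (auto simp: Gamma0_equiv_def)
  qed
qed

context newform
begin

text \<open>Since \<open>m\<close> is prime to \<open>N\<close>, some matrix in
  \<open>Gamma0 N\<close> takes 0 to \<open>k/m\<close>. Weight 2 makes
  \<open>F (act g z) - F z\<close> constant. Its limit at 0 is the difference in question, and its
  value at \<open>i\<close> is the integral along the segment from \<open>i\<close> to
  \<open>act g i\<close>, which closes up on the modular curve.\<close>

lemma I_diff_in_lattice:
  assumes km: "coprime k (int m)" and m: "m \<ge> 1" and mN: "coprime m N"
  shows "I (k / m) - I 0 \<in> period_lattice N f"
proof -
  have "coprime (int m) (k * int N)" using km mN by (simp add: coprime_commute)
  \<comment> \<open>Bezout with \<open>k * N\<close> in place of \<open>k\<close> makes the lower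
    left entry of \<open>g\<close> divisible by \<open>N\<close>.\<close>
  then obtain u w where uw: "u * int m + w * (k * int N) = 1" by (metis bezout_int coprime_imp_gcd_eq_1)
  define g where "g = (u, k, - int N * w, int m)"
  have g0: "g \<in> Gamma0 N" using uw by (auto simp: g_def Gamma0_def algebra_simps)
  then have g: "g \<in> SL2Z" using Gamma0_subset_SL2Z by blast
  have sl: "slash2 f g z = f z" if "z \<in> upper_half" for z
    using f_cusp g0 that by (auto simp: cusp_forms2_def)
  have d: "((\<lambda>z. F (act g z)) has_field_derivative two_pi_i * f z) (at z)" if "z \<in> upper_half" for z
    using F_act_deriv[OF g that] sl[OF that] by simp
  obtain C where C: "\<And>z. z \<in> upper_half \<Longrightarrow> F (act g z) = F z + C"
    using upper_half_const_diff[OF d F_deriv] by blast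
  have "((\<lambda>t. F (act g (Complex 0 t))) \<longlongrightarrow> I (k / m)) (at_right 0)"
    by (rule I_tendsto_coprime(2)[OF km m g_def g])
  moreover have "((\<lambda>t. F (act g (Complex 0 t))) \<longlongrightarrow> I 0 + C) (at_right 0)"
  proof (rule Lim_transform_eventually)
    show "((\<lambda>t. F (Complex 0 t) + C) \<longlongrightarrow> I 0 + C) (at_right 0)"
      using I_tendsto_coprime(1)[of 0 1] by (intro tendsto_intros) auto
  qed (auto intro!: eventually_mono[OF eventually_at_right_less] simp: C)
  ultimately have IC: "I (k / m) = I 0 + C"
    by (rule tendsto_unique[OF trivial_limit_at_right_real])
  let ?z = "Complex 0 1"
  let ?p = "linepath ?z (act g ?z)"
  have gz: "act g ?z \<in> upper_half" using g act_upper_half Complex_upper_half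
    by (metis prod_cases4 zero_less_one)
  have sub: "path_image ?p \<subseteq> upper_half"
    using closed_segment_subset[OF _ gz convex_upper_half] by simp
  have "((\<lambda>z. two_pi_i * f z) has_contour_integral F (pathfinish ?p) - F (pathstart ?p)) ?p"
    by (rule contour_integral_primitive[of upper_half])
       (use sub in \<open>auto intro: has_field_derivative_at_within[OF F_deriv]\<close>)
  then have ci: "contour_integral ?p (\<lambda>z. two_pi_i * f z) = C"
    using C[of ?z] by (simp add: contour_integral_unique)
  have equiv: "Gamma0_equiv N P (act g ?z) = Gamma0_equiv N P ?z" for P
    by (rule Gamma0_equiv_act[OF g0]) simp
  have "[(1, ?p)] \<in> X0_cycles N"
    using sub by (auto simp: X0_cycles_def cycle_mod_def equiv)
  then have "C \<in> period_lattice N f"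
    unfolding period_lattice_def by (rule rev_image_eqI) (simp add: ci)
  then show ?thesis by (simp add: IC)
qed

end

section \<open>Hecke relations\<close>

abbreviation translates :: "(complex \<Rightarrow> complex) \<Rightarrow> nat \<Rightarrow> complex \<Rightarrow> complex" where
  "translates g q z \<equiv> (\<Sum>b<q. g ((z + of_nat b) / of_nat q))"

lemma filterlim_at_i_inf_affine:
  assumes "c > 0"
  shows "filterlim (\<lambda>z. of_real c * z + of_real r) at_i_inf at_i_inf"
proof -
  have "filterlim (\<lambda>z. Im z * c) at_top at_i_inf"
    by (rule filterlim_at_top_mult_tendsto_pos[OF tendsto_const assms filterlim_filtercomap])
  then show ?thesis by (simp add: filterlim_filtercomap_iff o_def mult.commute)
qed

context newform
begin

text \<open>The operator U_q on expansions: averaging over \<open>b\<close> leaves exactly the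
  exponents divisible by \<open>q\<close>, by \<open>sum_roots_of_unity\<close>.\<close>

lemma sum_translates_expansion:
  assumes q: "q \<ge> 1" and z: "z \<in> upper_half"
  shows "(\<lambda>n. a (q * n) * qexp 1 z ^ n) sums (translates f q z / of_nat q)"
proof -
  let ?T = "\<lambda>n. \<Sum>b<q. a n * qexp 1 ((z + of_nat b) / of_nat q) ^ n"
  define u where "u n = (if q dvd n then a n * qexp 1 (z / of_nat q) ^ n else 0)" for n
  have "(z + of_nat b) / of_nat q \<in> upper_half" for b
    using z q by (simp add: upper_half_def Im_divide_of_nat)
  then have "(\<lambda>n. ?T n) sums translates f q z"
    by (intro sums_sum f_sums)
  then have 1: "(\<lambda>n. ?T n / of_nat q)
      sums (translates f q z / of_nat q)"
    by (rule sums_divide)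
  have "qexp 1 ((z + of_nat b) / of_nat q) ^ n =
      qexp 1 (z / of_nat q) ^ n * exp (two_pi_i * of_int (int n) * of_nat b / of_nat q)" for b n
    by (simp add: qexp_def add_divide_distrib ring_distribs flip: exp_of_nat_mult exp_add)
       (simp add: mult_ac)
  then have "?T n / of_nat q =
      a n * qexp 1 (z / of_nat q) ^ n * (\<Sum>b<q. exp (two_pi_i * of_int (int n) * of_nat b / of_nat q)) / of_nat q" for n
    by (simp add: sum_distrib_left mult_ac)
  then have "?T n / of_nat q = u n" for n
    unfolding sum_roots_of_unity[OF q] using q by (simp add: u_def)
  with 1 have "u sums (translates f q z / of_nat q)" by simp
  moreover have "strict_mono (\<lambda>n. q * n)" using q by (simp add: strict_mono_def)
  ultimately have "(\<lambda>n. u (q * n)) sums (translates f q z / of_nat q)"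
    by (subst sums_mono_reindex) (auto simp: u_def)
  moreover have "qexp 1 (z / of_nat q) ^ (q * n) = qexp 1 z ^ n" for n
    using q by (simp add: qexp_def mult_ac flip: exp_of_nat_mult)
  ultimately show ?thesis by (simp add: u_def)
qed

text \<open>The newform condition only provides some eigenvalue \<open>t\<close>. It is found by
  dividing by \<open>qexp 1 z\<close> and letting \<open>z\<close> tend to the cusp:
  \<open>f\<close> contributes \<open>a 1 = 1\<close>, the translates contribute \<open>a q\<close>,
  and \<open>f (q * z)\<close> contributes 0 because it vanishes there to order at least 2.\<close>

lemma hecke_prime:
  assumes q: "prime q" and qN: "\<not> q dvd N" and z: "z \<in> upper_half"
  shows "a q * f z = of_nat q * f (of_nat q * z) + translates f q z / of_nat q"
proof -
  have q0: "q \<ge> 1" "q > 1" "q \<noteq> 1" using prime_gt_1_nat[OF q] by auto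
  have cop: "coprime q N" using q qN by (simp add: prime_imp_coprime)
  obtain t where t: "\<And>z. z \<in> upper_half \<Longrightarrow> hecke2 N q f z = t * f z"
    using rational_newform2D(7)[OF newform q0(1)] by blast
  have "{d. d dvd q \<and> coprime (q div d) N} = {1, q}"
    using q cop q0 by (auto simp: prime_nat_iff)
  then have hecke: "hecke2 N q f z = of_nat q * f (of_nat q * z) + translates f q z / of_nat q" for z
    using q0 by (simp add: hecke2_def power2_eq_square field_simps)
  let ?S = "\<lambda>z. translates f q z / of_nat q"
  have lim_f: "((\<lambda>z. f z / qexp 1 z) \<longlongrightarrow> 1) at_i_inf"
    using expansion_leading[OF _ a_0 f_expansion] a_1 by simp
  have lim_S: "((\<lambda>z. ?S z / qexp 1 z) \<longlongrightarrow> a (q * 1)) at_i_inf"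
    by (rule expansion_leading[where c = "\<lambda>n. a (q * n)"])
       (unfold qexp_power, use sum_translates_expansion[OF q0(1)] a_0 in auto)
  have mulq: "filterlim (\<lambda>z. of_nat q * z) at_i_inf at_i_inf"
    using filterlim_at_i_inf_affine[of "real q" 0] q0 by simp
  have "((\<lambda>z. of_nat q * (f (of_nat q * z) / qexp 1 (of_nat q * z)) * qexp 1 z ^ (q - 1)) \<longlongrightarrow> of_nat q * 1 * 0 ^ (q - 1)) at_i_inf"
    by (intro tendsto_intros filterlim_compose[OF lim_f mulq] qexp_tendsto_0) simp
  moreover have "of_nat q * (f (of_nat q * z) / qexp 1 (of_nat q * z)) * qexp 1 z ^ (q - 1) = of_nat q * f (of_nat q * z) / qexp 1 z" for z
  proof -
    have "qexp 1 (of_nat q * z) = qexp 1 z ^ q"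
      by (simp add: qexp_def mult_ac flip: exp_of_nat_mult)
    also have "\<dots> = qexp 1 z ^ (q - 1) * qexp 1 z" using q0 by (simp flip: power_Suc2)
    finally show ?thesis by (simp add: qexp_def)
  qed
  ultimately have lim_V: "((\<lambda>z. of_nat q * f (of_nat q * z) / qexp 1 z) \<longlongrightarrow> 0) at_i_inf"
    using q0 by (simp add: power_0_left)
  have "((\<lambda>z. of_nat q * f (of_nat q * z) / qexp 1 z + ?S z / qexp 1 z) \<longlongrightarrow> 0 + a (q * 1)) at_i_inf"
    by (intro tendsto_add lim_V lim_S)
  moreover have "((\<lambda>z. t * (f z / qexp 1 z)) \<longlongrightarrow> t * 1) at_i_inf" by (intro tendsto_intros lim_f)
  then have "((\<lambda>z. of_nat q * f (of_nat q * z) / qexp 1 z + ?S z / qexp 1 z) \<longlongrightarrow> t * 1) at_i_inf"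
  proof (rule Lim_transform_eventually, intro eventually_mono[OF eventually_at_i_inf_upper_half])
    fix w assume "w \<in> upper_half"
    then have "t * (f w / qexp 1 w) = hecke2 N q f w / qexp 1 w" using t by simp
    then show "t * (f w / qexp 1 w) = of_nat q * f (of_nat q * w) / qexp 1 w + ?S w / qexp 1 w"
      unfolding hecke by (simp only: add_divide_distrib)
  qed
  ultimately have "0 + a (q * 1) = t * 1" by (rule tendsto_unique[OF at_i_inf_neq_bot])
  then show ?thesis using t[OF z] hecke[of z] by simp
qed

text \<open>The relation for \<open>f\<close> integrated: the weight factors \<open>q\<close> and
  \<open>1 / q\<close> in \<open>hecke_prime\<close> are just the inner derivatives of
  \<open>q * z\<close> and \<open>(z + b) / q\<close>, so none is left over.\<close>

lemma F_hecke:
  assumes q: "prime q" and qN: "\<not> q dvd N" and z: "z \<in> upper_half"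
  shows "a q * F z = F (of_nat q * z) + translates F q z"
proof (rule upper_half_primitive_unique[OF _ _ _ _ z])
  let ?G = "\<lambda>z. F (of_nat q * z) + translates F q z"
  have q0: "q > 0" using prime_gt_0_nat[OF q] .
  have aff: "of_nat q * w \<in> upper_half" "(w + of_nat b) / of_nat q \<in> upper_half" if "w \<in> upper_half" for b w
    using that q0 by (simp_all add: upper_half_def Im_divide_of_nat)
  show "((\<lambda>z. a q * F z) has_field_derivative a q * (two_pi_i * f w)) (at w)" if "w \<in> upper_half" for w
    by (rule DERIV_cmult[OF F_deriv[OF that]])
  show "(?G has_field_derivative a q * (two_pi_i * f w)) (at w)"
    if w: "w \<in> upper_half" for w
  proof -
    have "((\<lambda>z. F (of_nat q * z)) has_field_derivative two_pi_i * f (of_nat q * w) * of_nat q) (at w)"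
      by (rule DERIV_chain2[where f = F], rule F_deriv) (use aff w in \<open>auto intro!: derivative_eq_intros\<close>)
    moreover have "((\<lambda>z. F ((z + of_nat b) / of_nat q)) has_field_derivative two_pi_i * f ((w + of_nat b) / of_nat q) * (1 / of_nat q)) (at w)" for b
      by (rule DERIV_chain2[where f = F], rule F_deriv) (use aff w q0 in \<open>auto intro!: derivative_eq_intros\<close>)
    ultimately have "(?G has_field_derivative
      two_pi_i * f (of_nat q * w) * of_nat q + (\<Sum>b<q. two_pi_i * f ((w + of_nat b) / of_nat q) * (1 / of_nat q))) (at w)"
      by (intro DERIV_add DERIV_sum)
    also have "two_pi_i * f (of_nat q * w) * of_nat q + (\<Sum>b<q. two_pi_i * f ((w + of_nat b) / of_nat q) * (1 / of_nat q))
       = two_pi_i * (of_nat q * f (of_nat q * w) + translates f q w / of_nat q)"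
      by (simp add: algebra_simps sum_distrib_left sum_divide_distrib)
    also have "\<dots> = a q * (two_pi_i * f w)" unfolding hecke_prime[OF q qN w, symmetric] by simp
    finally show ?thesis .
  qed
  show "((\<lambda>z. a q * F z) \<longlongrightarrow> 0) at_i_inf" using tendsto_mult_right_zero[OF F_tendsto_0] by blast
  have "filterlim (\<lambda>z. (z + of_nat b) / of_nat q) at_i_inf at_i_inf" for b
    using filterlim_at_i_inf_affine[of "1 / real q" "b / q"] q0 by (simp add: add_divide_distrib)
  moreover have "filterlim (\<lambda>z. of_nat q * z) at_i_inf at_i_inf"
    using filterlim_at_i_inf_affine[of "real q" 0] q0 by simp
  ultimately have "(?G \<longlongrightarrow> 0 + (\<Sum>b<q. 0)) at_i_inf"
    by (intro tendsto_add tendsto_sum filterlim_compose[OF F_tendsto_0])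
  then show "(?G \<longlongrightarrow> 0) at_i_inf" by simp
qed

section \<open>Symmetries of the primitive under translation and reflection\<close>

lemma F_plus_1:
  assumes z: "z \<in> upper_half" shows "F (z + 1) = F z"
proof (rule upper_half_primitive_unique[OF _ F_deriv _ F_tendsto_0 z])
  fix w assume w: "w \<in> upper_half"
  then have w1: "w + 1 \<in> upper_half" by (simp add: upper_half_def)
  have "qexp 1 (w + 1) = qexp 1 w" by (simp add: qexp_def ring_distribs exp_add)
  then have "f (w + 1) = f w" using f_sums[OF w] f_sums[OF w1] sums_unique2 by metis
  then show "((\<lambda>z. F (z + 1)) has_field_derivative two_pi_i * f w) (at w)"
    using DERIV_shift[of F _ w 1] F_deriv[OF w1] by simp
next
  show "((\<lambda>z. F (z + 1)) \<longlongrightarrow> 0) at_i_inf"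
    using filterlim_compose[OF F_tendsto_0 filterlim_at_i_inf_affine[of 1 1]] by simp
qed auto

text \<open>The coefficients are rational, hence real, and the reflection of \<open>z\<close> in the
  imaginary axis conjugates \<open>qexp 1 z\<close>.\<close>

lemma cnj_f:
  assumes z: "z \<in> upper_half" shows "f (- cnj z) = cnj (f z)"
proof -
  have z': "- cnj z \<in> upper_half" using z by (simp add: upper_half_def)
  have "cnj (a n) = a n" for n
  proof -
    obtain r where "a n = of_rat r" using a_rat[of n] Rats_cases by blast
    then show ?thesis by (cases r) (simp add: of_rat_rat)
  qed
  moreover have "qexp 1 (- cnj z) = cnj (qexp 1 z)" by (simp add: qexp_def exp_cnj)
  moreover have "(\<lambda>n. cnj (a n * qexp 1 z ^ n)) sums cnj (f z)" by (rule iffD2[OF sums_cnj f_sums[OF z]])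
  ultimately have "(\<lambda>n. a n * qexp 1 (- cnj z) ^ n) sums cnj (f z)" by simp
  then show ?thesis using f_sums[OF z'] sums_unique2 by blast
qed

lemma cnj_F:
  assumes z: "z \<in> upper_half" shows "F (- cnj z) = cnj (F z)"
proof -
  have "cnj (F (- cnj z)) = F z"
  proof (rule upper_half_primitive_unique[OF _ F_deriv _ F_tendsto_0 z])
    fix w assume w: "w \<in> upper_half"
    then have w': "- cnj w \<in> upper_half" by (simp add: upper_half_def)
    have "((\<lambda>z. F (- z)) has_field_derivative - (two_pi_i * f (- cnj w))) (at (cnj w))"
      using DERIV_chain2[OF F_deriv[OF w'] DERIV_minus[OF DERIV_ident]] by simp
    then have "((\<lambda>z. cnj (F (- cnj z))) has_field_derivative cnj (- (two_pi_i * f (- cnj w)))) (at w)"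
      using has_field_derivative_cnj_cnj by (fastforce simp: o_def)
    then show "((\<lambda>z. cnj (F (- cnj z))) has_field_derivative two_pi_i * f w) (at w)"
      by (simp add: cnj_f[OF w])
  next
    have "filterlim (\<lambda>z. - cnj z) at_i_inf at_i_inf"
      by (simp add: filterlim_filtercomap_iff o_def filterlim_filtercomap)
    from filterlim_compose[OF F_tendsto_0 this]
    show "((\<lambda>z. cnj (F (- cnj z))) \<longlongrightarrow> 0) at_i_inf"
      using tendsto_cnj by fastforce
  qed auto
  then show ?thesis by (metis complex_cnj_cnj)
qed

section \<open>Passage to rational boundary points\<close>

lemma Rats_fraction:
  assumes "x \<in> \<rat>"
  obtains k and m :: nat where "m \<ge> 1" "coprime k (int m)" "x = of_int k / real m"
proof -
  obtain r where r: "x = of_rat r" using assms Rats_cases by blast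
  obtain k m' where km: "quotient_of r = (k, m')" by fastforce
  show ?thesis
    by (rule that[of "nat m'" k])
       (use km quotient_of_denom_pos[OF km] quotient_of_coprime[OF km] quotient_of_div[OF km] r
         in \<open>auto simp: of_rat_divide\<close>)
qed

lemma I_tendsto:
  assumes "x \<in> \<rat>" shows "((\<lambda>t. F (Complex x t)) \<longlongrightarrow> I x) (at_right 0)"
  using assms I_tendsto_coprime(1) by (elim Rats_fraction) simp

lemma I_plus_1:
  assumes x: "x \<in> \<rat>" shows "I (x + 1) = I x"
proof -
  have ev: "eventually (\<lambda>t. F (Complex (x + 1) t) = F (Complex x t)) (at_right 0)"
  proof (rule eventually_mono[OF eventually_at_right_less])
    fix t :: real assume "0 < t"
    moreover have "Complex (x + 1) t = Complex x t + 1" by (simp add: complex_eq_iff)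
    ultimately show "F (Complex (x + 1) t) = F (Complex x t)" using F_plus_1 by simp
  qed
  have "((\<lambda>t. F (Complex x t)) \<longlongrightarrow> I (x + 1)) (at_right 0)"
    by (rule Lim_transform_eventually[OF I_tendsto ev]) (use x in simp)
  then show ?thesis by (rule tendsto_unique[OF trivial_limit_at_right_real _ I_tendsto[OF x]])
qed

lemma I_minus:
  assumes "x \<in> \<rat>" shows "I (- x) = cnj (I x)"
proof -
  have "((\<lambda>t. cnj (F (Complex x t))) \<longlongrightarrow> cnj (I x)) (at_right 0)"
    by (intro tendsto_cnj I_tendsto assms)
  moreover have "- cnj (Complex x t) = Complex (- x) t" for t by (simp add: complex_eq_iff)
  then have "eventually (\<lambda>t. cnj (F (Complex x t)) = F (Complex (- x) t)) (at_right 0)"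
    using cnj_F[of "Complex x _"] by (auto intro!: eventually_mono[OF eventually_at_right_less])
  ultimately have "((\<lambda>t. F (Complex (- x) t)) \<longlongrightarrow> cnj (I x)) (at_right 0)"
    by (rule Lim_transform_eventually)
  then show ?thesis using tendsto_unique[OF trivial_limit_at_right_real I_tendsto[of "- x"]] assms by simp
qed

text \<open>When \<open>z\<close> runs down a vertical line, so do all arguments in
  \<open>F_hecke\<close>, with the height rescaled by \<open>q\<close> or \<open>1 / q\<close>; the
  relation therefore passes to the limit.\<close>

lemma I_hecke:
  assumes q: "prime q" and qN: "\<not> q dvd N" and x: "x \<in> \<rat>"
  shows "a q * I x = I (real q * x) + (\<Sum>b<q. I ((x + real b) / real q))"
proof -
  have q0: "q > 0" using prime_gt_0_nat[OF q] .
  have scale: "filterlim (\<lambda>t. c * t) (at_right 0) (at_right (0::real))" if "c > 0" for c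
    unfolding filterlim_at using that
    by (auto intro!: tendsto_eq_intros eventually_mono[OF eventually_at_right_less])
  have 1: "((\<lambda>t. a q * F (Complex x t)) \<longlongrightarrow> a q * I x) (at_right 0)"
    by (intro tendsto_intros I_tendsto x)
  have "((\<lambda>t::real. F (Complex (q * x) (q * t))) \<longlongrightarrow> I (q * x)) (at_right 0)"
    by (rule filterlim_compose[OF I_tendsto scale]) (use x q0 in auto)
  moreover have "((\<lambda>t. F (Complex ((x + b) / q) (1 / q * t))) \<longlongrightarrow> I ((x + b) / q)) (at_right 0)" for b :: nat
    by (rule filterlim_compose[OF I_tendsto scale]) (use x q0 in auto)
  ultimately have "((\<lambda>t::real. F (Complex (q * x) (q * t)) + (\<Sum>b<q. F (Complex ((x + b) / q) (1 / q * t)))) \<longlongrightarrow>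
      I (q * x) + (\<Sum>b<q. I ((x + b) / q))) (at_right 0)"
    by (intro tendsto_add tendsto_sum)
  moreover have "eventually (\<lambda>t::real. F (Complex (q * x) (q * t)) + (\<Sum>b<q. F (Complex ((x + b) / q) (1 / q * t))) = a q * F (Complex x t)) (at_right 0)"
  proof (rule eventually_mono[OF eventually_at_right_less])
    fix t :: real assume "0 < t"
    moreover have "of_nat q * Complex x t = Complex (q * x) (q * t)" by (simp add: complex_eq_iff)
    moreover have "(Complex x t + of_nat b) / of_nat q = Complex ((x + b) / q) (1 / q * t)" for b
      by (simp add: complex_eq_iff Re_divide_of_nat Im_divide_of_nat)
    ultimately show "F (Complex (q * x) (q * t)) + (\<Sum>b<q. F (Complex ((x + b) / q) (1 / q * t))) = a q * F (Complex x t)"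
      using F_hecke[OF q qN, of "Complex x t"] by simp
  qed
  ultimately have "((\<lambda>t. a q * F (Complex x t)) \<longlongrightarrow> I (q * x) + (\<Sum>b<q. I ((x + b) / q))) (at_right 0)"
    by (rule Lim_transform_eventually)
  from tendsto_unique[OF trivial_limit_at_right_real 1 this] show ?thesis .
qed

end

section \<open>Mellin transforms and Dirichlet series\<close>

lemma integrable_inverse_1_plus_square_lborel:
  "integrable lborel (\<lambda>x::real. inverse (1 + x\<^sup>2))"
  using integrable_inverse_1_plus_square by (simp add: set_integrable_def)

lemma borel_measurable_powr_mult:
  fixes h :: "real \<Rightarrow> complex"
  assumes "continuous_on {0<..} h"
  shows "(\<lambda>t. indicator {0<..} t *\<^sub>R (h t * of_real t powr z)) \<in> borel_measurable borel"
  by (rule borel_measurable_continuous_on_indicator) (auto intro!: continuous_intros assms)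

lemma norm_powr_real: "t > 0 \<Longrightarrow> norm (of_real t powr z) = t powr Re z"
  by (simp add: norm_powr_real_powr)

text \<open>The majorant is the same for all \<open>s\<close> in the strip. Up to 1 the decay
  exponent \<open>B + 1\<close> leaves \<open>t powr (B + Re s) \<le> 1\<close>; beyond 1 the
  exponent \<open>- B - 1\<close> leaves at most \<open>t powr (- 2)\<close>. Both are below
  \<open>2 / (1 + t^2)\<close>.\<close>

lemma mellin_integrand_bound:
  fixes h :: "real \<Rightarrow> complex"
  assumes decay: "\<And>A. \<exists>C. \<forall>t>0. norm (h t) \<le> C * t powr A"
  obtains C where "C \<ge> 0" "\<And>s t. t > 0 \<Longrightarrow> \<bar>Re s\<bar> \<le> B \<Longrightarrow>
    norm (h t * of_real t powr (s - 1)) \<le> C * inverse (1 + t\<^sup>2)"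
proof -
  obtain C1 where C1: "\<And>t. t > 0 \<Longrightarrow> norm (h t) \<le> C1 * t powr (B + 1)" using decay by blast
  obtain C2 where C2: "\<And>t. t > 0 \<Longrightarrow> norm (h t) \<le> C2 * t powr (- B - 1)" using decay by blast
  have nn: "C1 \<ge> 0" "C2 \<ge> 0" using order_trans[OF norm_ge_zero C1[of 1]] order_trans[OF norm_ge_zero C2[of 1]] by auto
  have pos: "1 + t\<^sup>2 > 0" for t :: real by (simp add: add_pos_nonneg)
  then have nn0: "0 \<le> C1 * inverse (1 + t\<^sup>2)" "0 \<le> C2 * inverse (1 + t\<^sup>2)" for t :: real
    using nn by (simp_all add: less_imp_le)
  show ?thesis
  proof (rule that[of "2 * (C1 + C2)"])
    fix s and t :: real assume t: "t > 0" and s: "\<bar>Re s\<bar> \<le> B"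
    have n: "norm (h t * of_real t powr (s - 1)) = norm (h t) * t powr (Re s - 1)"
      using t by (simp add: norm_mult norm_powr_real)
    show "norm (h t * of_real t powr (s - 1)) \<le> 2 * (C1 + C2) * inverse (1 + t\<^sup>2)"
    proof (cases "t \<le> 1")
      case True
      have "norm (h t) * t powr (Re s - 1) \<le> C1 * t powr (B + 1) * t powr (Re s - 1)"
        using C1[OF t] by (intro mult_right_mono) auto
      also have "\<dots> = C1 * t powr (B + Re s)" by (simp add: mult.assoc flip: powr_add)
      also have "\<dots> \<le> C1 * 1" using nn t True s
        by (intro mult_left_mono) (auto intro: powr_le1)
      also have "\<dots> \<le> C1 * (2 * inverse (1 + t\<^sup>2))"
        using nn True t power_mono[of t 1 2] pos[of t] by (intro mult_left_mono) (auto simp: field_simps)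
      also have "\<dots> \<le> 2 * (C1 + C2) * inverse (1 + t\<^sup>2)" using nn0[of t] by (simp add: algebra_simps)
      finally show ?thesis unfolding n .
    next
      case False
      have "norm (h t) * t powr (Re s - 1) \<le> C2 * t powr (- B - 1) * t powr (Re s - 1)"
        using C2[OF t] by (intro mult_right_mono) auto
      also have "\<dots> = C2 * t powr (Re s - B - 2)" by (simp add: mult.assoc algebra_simps flip: powr_add)
      also have "\<dots> \<le> C2 * t powr (- 2)" using nn t False s
        by (intro mult_left_mono powr_mono) auto
      also have "t powr (- 2) = inverse (t\<^sup>2)" using t by (simp add: powr_minus)
      also have "C2 * \<dots> \<le> C2 * (2 * inverse (1 + t\<^sup>2))"
        using nn False t power_mono[of 1 t 2] pos[of t] by (intro mult_left_mono) (auto simp: field_simps)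
      also have "\<dots> \<le> 2 * (C1 + C2) * inverse (1 + t\<^sup>2)" using nn0[of t] by (simp add: algebra_simps)
      finally show ?thesis unfolding n .
    qed
  qed (use nn in auto)
qed

text \<open>Compact intervals filling the positive axis; the summand 1 avoids a division by zero at
  \<open>n = 0\<close>.\<close>

definition exhaust :: "nat \<Rightarrow> real set" where "exhaust n = {1 / (real n + 1)..real n + 1}"

lemma exhaust_subset: "exhaust n \<subseteq> {0<..}"
  by (auto simp: exhaust_def intro: less_le_trans[rotated])

lemma eventually_in_exhaust:
  assumes "t > 0" shows "eventually (\<lambda>n. t \<in> exhaust n) sequentially"
proof -
  have "eventually (\<lambda>n. real n \<ge> max t (1 / t)) sequentially"
    by (rule eventually_nat_real[OF eventually_ge_at_top])
  then show ?thesis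
  proof eventually_elim
    case (elim n)
    then have "1 / t \<le> real n + 1" by simp
    then show ?case using assms elim by (simp add: exhaust_def field_simps)
  qed
qed

abbreviation mellin :: "(real \<Rightarrow> complex) \<Rightarrow> complex \<Rightarrow> complex" where
  "mellin h s \<equiv> (LINT t:{0<..}|lborel. h t * of_real t powr (s - 1))"

text \<open>Rapid decay at both ends is what makes the transform entire. The truncated integrals are
  holomorphic by differentiation under the integral sign, and the tails are at most
  \<open>C * \<epsilon> n\<close> uniformly on unit discs, where \<open>\<epsilon>\<close> comes
  from the majorant alone.\<close>

lemma mellin_holomorphic:
  fixes h :: "real \<Rightarrow> complex"
  assumes cont: "continuous_on {0<..} h"
    and decay: "\<And>A. \<exists>C. \<forall>t>0. norm (h t) \<le> C * t powr A"
  shows "set_integrable lborel {0<..} (\<lambda>t. h t * of_real t powr (s - 1))"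
    and "(\<lambda>n. integral (exhaust n) (\<lambda>t. h t * of_real t powr (s - 1)))
           \<longlonglongrightarrow> mellin h s"
    and "(\<lambda>s. LINT t:{0<..}|lborel. h t * of_real t powr (s - 1)) holomorphic_on UNIV"
proof -
  define g where "g s t = h t * of_real t powr (s - 1)" for s t
  define D where "D t = inverse (1 + t\<^sup>2)" for t :: real
  have D: "integrable lborel D" unfolding D_def by (rule integrable_inverse_1_plus_square_lborel)
  have D0: "D t \<ge> 0" for t by (simp add: D_def)
  define \<epsilon> where "\<epsilon> n = (LINT t:{0<..} - exhaust n|lborel. D t)" for n
  have meas: "(\<lambda>t. indicator {0<..} t *\<^sub>R g s t) \<in> borel_measurable lborel" for s
    using borel_measurable_powr_mult[OF cont] by (simp add: g_def)
  have int: "set_integrable lborel {0<..} (g s)" for s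
  proof -
    obtain C where "C \<ge> 0" and C: "\<And>s' t. t > 0 \<Longrightarrow> \<bar>Re s'\<bar> \<le> \<bar>Re s\<bar> \<Longrightarrow> norm (g s' t) \<le> C * D t"
      using mellin_integrand_bound[OF decay, of "\<bar>Re s\<bar>"] unfolding g_def D_def by blast
    have "integrable lborel (\<lambda>t. C * D t)" using D by simp
    then show ?thesis unfolding set_integrable_def
    proof (rule Bochner_Integration.integrable_bound[OF _ meas], intro AE_I2)
      fix t :: real
      show "norm (indicator {0<..} t *\<^sub>R g s t) \<le> norm (C * D t)"
      proof (cases "t > 0")
        case True
        then show ?thesis using C[of t s] by simp
      qed simp
    qed
  qed
  have sets: "exhaust n \<in> sets lborel" "{0<..} - exhaust n \<in> sets lborel" for n
    by (auto simp: exhaust_def)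
  have int_n: "set_integrable lborel (exhaust n) (g s)" for n s
    by (rule set_integrable_subset[OF int]) (use sets exhaust_subset in auto)
  have Dint: "set_integrable lborel ({0<..} - exhaust n) D" for n
    unfolding set_integrable_def using integrable_mult_indicator[OF sets(2) D] .
  have diff: "norm (integral (exhaust n) (g s) - (LINT t:{0<..}|lborel. g s t)) \<le> C * \<epsilon> n"
    if C: "\<And>t. t > 0 \<Longrightarrow> norm (g s t) \<le> C * D t" for n s C
  proof -
    have "(LINT t:{0<..}|lborel. g s t) = (LINT t:exhaust n \<union> ({0<..} - exhaust n)|lborel. g s t)"
      using exhaust_subset[of n] by (simp add: Un_absorb1)
    also have "\<dots> = (LINT t:exhaust n|lborel. g s t) + (LINT t:{0<..} - exhaust n|lborel. g s t)"
      by (rule set_integral_Un) (auto intro: int_n set_integrable_subset[OF int] sets)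
    also have "(LINT t:exhaust n|lborel. g s t) = integral (exhaust n) (g s)"
      by (rule set_borel_integral_eq_integral(2)[OF int_n])
    finally have "norm (integral (exhaust n) (g s) - (LINT t:{0<..}|lborel. g s t)) = norm (LINT t:{0<..} - exhaust n|lborel. g s t)"
      by (simp add: norm_minus_commute)
    also have "\<dots> \<le> (LINT t:{0<..} - exhaust n|lborel. C * D t)"
      unfolding set_lebesgue_integral_def
    proof (rule Bochner_Integration.integral_norm_bound_integral)
      show "integrable lborel (\<lambda>t. indicator ({0<..} - exhaust n) t *\<^sub>R g s t)"
        using set_integrable_subset[OF int sets(2)[of n]] unfolding set_integrable_def by blast
      show "integrable lborel (\<lambda>t. indicator ({0<..} - exhaust n) t *\<^sub>R (C * D t))"
        using integrable_mult_right[OF Dint[of n, unfolded set_integrable_def], of C] by (simp add: mult_ac)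
    qed (use C in \<open>auto simp: indicator_def\<close>)
    also have "\<dots> = C * \<epsilon> n" by (simp add: \<epsilon>_def)
    finally show ?thesis .
  qed
  have eps: "\<epsilon> \<longlonglongrightarrow> 0"
  proof -
    have "(\<lambda>n. LINT t|lborel. indicator ({0<..} - exhaust n) t *\<^sub>R D t) \<longlonglongrightarrow> integral\<^sup>L lborel (\<lambda>t::real. 0::real)"
    proof (rule integral_dominated_convergence[where w = D and f = "\<lambda>_. 0"
        and s = "\<lambda>n t. indicator ({0<..} - exhaust n) t *\<^sub>R D t" and M = lborel])
      show "AE t in lborel. (\<lambda>n. indicator ({0<..} - exhaust n) t *\<^sub>R D t) \<longlonglongrightarrow> 0"
      proof (intro AE_I2)
        fix t :: real
        show "(\<lambda>n. indicator ({0<..} - exhaust n) t *\<^sub>R D t) \<longlonglongrightarrow> 0"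
        proof (cases "t > 0")
          case True
          show ?thesis by (rule tendsto_eventually)
            (use eventually_in_exhaust[OF True] in eventually_elim, simp)
        qed simp
      qed
    qed (use D D0 sets in \<open>auto simp: indicator_def borel_measurable_integrable\<close>)
    then show ?thesis unfolding \<epsilon>_def[abs_def] set_lebesgue_integral_def by simp
  qed
  show "set_integrable lborel {0<..} (\<lambda>t. h t * of_real t powr (s - 1))" using int[of s] by (simp add: g_def[abs_def])
  have unif: "uniform_limit (cball x 1) (\<lambda>n s. integral (exhaust n) (g s)) (\<lambda>s. LINT t:{0<..}|lborel. g s t) sequentially" for x
  proof -
    obtain C where C: "C \<ge> 0" "\<And>s t. t > 0 \<Longrightarrow> \<bar>Re s\<bar> \<le> norm x + 1 \<Longrightarrow> norm (g s t) \<le> C * D t"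
      using mellin_integrand_bound[OF decay, of "norm x + 1"] unfolding g_def D_def by blast
    have Re: "\<bar>Re s\<bar> \<le> norm x + 1" if "s \<in> cball x 1" for s
      using that abs_Re_le_cmod[of s] norm_triangle_ineq2[of s x] by (simp add: dist_norm norm_minus_commute)
    have "(\<lambda>n. C * \<epsilon> n) \<longlonglongrightarrow> 0" using tendsto_mult_right_zero[OF eps] .
    show ?thesis
    proof (rule uniform_limitI)
      fix e :: real assume "e > 0"
      then have "eventually (\<lambda>n. C * \<epsilon> n < e) sequentially"
        using \<open>(\<lambda>n. C * \<epsilon> n) \<longlonglongrightarrow> 0\<close> by (rule order_tendstoD(2)[rotated])
      then show "\<forall>\<^sub>F n in sequentially. \<forall>s\<in>cball x 1. dist (integral (exhaust n) (g s)) (LINT t:{0<..}|lborel. g s t) < e"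
      proof eventually_elim
        case (elim n)
        show ?case
        proof
          fix s assume "s \<in> cball x 1"
          then show "dist (integral (exhaust n) (g s)) (LINT t:{0<..}|lborel. g s t) < e"
            using diff[of s C n] C(2)[OF _ Re, of _ s] elim by (simp add: dist_norm)
        qed
      qed
    qed
  qed
  show "(\<lambda>n. integral (exhaust n) (\<lambda>t. h t * of_real t powr (s - 1)))
           \<longlonglongrightarrow> mellin h s"
    using tendsto_uniform_limitI[OF unif[of s], of s] by (simp add: g_def[abs_def])
  have "(\<lambda>s. integral (exhaust n) (g s)) holomorphic_on UNIV" for n
  proof -
    let ?a = "1 / (real n + 1)" and ?b = "real n + 1"
    have pos: "t > 0" if "t \<in> {?a..?b}" for t using that exhaust_subset[of n] by (auto simp: exhaust_def)
    have "(\<lambda>s. integral (cbox ?a ?b) (g s)) holomorphic_on UNIV"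
    proof (rule leibniz_rule_holomorphic)
      show "((\<lambda>s. g s t) has_field_derivative h t * (of_real t powr (s - 1) * Ln (of_real t))) (at s within UNIV)"
        if "t \<in> cbox ?a ?b" for s t
      proof -
        have "((\<lambda>s. complex_of_real t powr (s - 1)) has_field_derivative
            (Ln (of_real t) * of_real t powr (s - 1)) * 1) (at s)"
          by (rule DERIV_chain2[OF has_field_derivative_powr_right])
             (use pos[of t] that in \<open>auto intro!: derivative_eq_intros\<close>)
        from DERIV_cmult[OF this, of "h t"] show ?thesis by (simp add: g_def mult_ac)
      qed
      have c: "continuous_on {?a..?b} h" by (rule continuous_on_subset[OF cont]) (use pos in auto)
      show "g s integrable_on cbox ?a ?b" for s
      proof -
        have "continuous_on {0<..} (\<lambda>t. of_real t powr (s - 1) :: complex)"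
          by (auto intro!: continuous_intros)
        then have "continuous_on {?a..?b} (\<lambda>t. of_real t powr (s - 1) :: complex)"
          by (rule continuous_on_subset) (use pos in auto)
        then show ?thesis
          unfolding g_def by (intro integrable_continuous) (auto intro!: continuous_on_mult c)
      qed
      have c2: "continuous_on (UNIV \<times> {0<..}) (\<lambda>x::complex \<times> real. h (snd x))"
        by (rule continuous_on_compose2[OF cont]) (auto intro!: continuous_intros)
      have c3: "continuous_on (UNIV \<times> {0<..}) (\<lambda>x::complex \<times> real. of_real (snd x) powr (fst x - 1) * Ln (of_real (snd x)))"
        by (intro continuous_intros) (auto simp: complex_nonpos_Reals_iff)
      show "continuous_on (UNIV \<times> cbox ?a ?b) (\<lambda>(s, t). h t * (of_real t powr (s - 1) * Ln (of_real t)))"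
        unfolding case_prod_unfold
        by (rule continuous_on_subset[OF continuous_on_mult[OF c2 c3]]) (use pos in auto)
    qed auto
    then show ?thesis by (simp add: exhaust_def)
  qed
  then have "(\<lambda>s. LINT t:{0<..}|lborel. g s t) holomorphic_on UNIV"
    by (rule holomorphic_uniform_sequence[OF open_UNIV]) (use unif in \<open>auto intro!: exI[of _ 1]\<close>)
  then show "(\<lambda>s. LINT t:{0<..}|lborel. h t * of_real t powr (s - 1)) holomorphic_on UNIV"
    by (simp add: g_def[abs_def])
qed

lemma gamma_integral_scaled:
  assumes r: "r > 0" and s: "Re s > 0"
  shows "has_bochner_integral lborel (\<lambda>t. indicator {0<..} t *\<^sub>R (of_real (exp (- r * t)) * of_real t powr (s - 1)))
     (Gamma s / of_real r powr s)"
proof -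
  define k where "k t = indicator {0<..} t *\<^sub>R (complex_of_real t powr (s - 1) / of_real (exp t))" for t :: real
  have meas: "k \<in> borel_measurable borel"
    unfolding k_def by (rule borel_measurable_continuous_on_indicator) (auto intro!: continuous_intros)
  have "integrable lebesgue k"
    using absolutely_integrable_Gamma_integral'[OF s] unfolding set_integrable_def k_def .
  then have "integrable lborel k" using meas by (simp add: integrable_completion)
  then have set: "set_integrable lborel {0<..} (\<lambda>t. complex_of_real t powr (s - 1) / of_real (exp t))"
    by (simp add: set_integrable_def k_def[abs_def])
  have "(LINT t:{0<..}|lborel. complex_of_real t powr (s - 1) / of_real (exp t)) = Gamma s"
    using set_borel_integral_eq_integral(2)[OF set] integral_unique[OF Gamma_integral_complex'[OF s]] by simp
  then have "has_bochner_integral lborel k (Gamma s)"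
    using set by (simp add: has_bochner_integral_iff set_integrable_def set_lebesgue_integral_def k_def[abs_def])
  then have "has_bochner_integral lborel (\<lambda>t. k (0 + r * t)) (Gamma s /\<^sub>R \<bar>r\<bar>)"
    using lborel_has_bochner_integral_real_affine_iff[of r k "Gamma s" 0] r by simp
  then have "has_bochner_integral lborel (\<lambda>t. k (r * t) / of_real r powr (s - 1)) ((Gamma s /\<^sub>R \<bar>r\<bar>) / of_real r powr (s - 1))"
    by (intro has_bochner_integral_divide) simp_all
  moreover have "k (r * t) / of_real r powr (s - 1) = indicator {0<..} t *\<^sub>R (of_real (exp (- r * t)) * of_real t powr (s - 1))" for t
  proof (cases "t > 0")
    case True
    then have "complex_of_real (r * t) powr (s - 1) = of_real r powr (s - 1) * of_real t powr (s - 1)"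
      using r by (simp add: powr_times_real)
    moreover have "complex_of_real r powr (s - 1) \<noteq> 0" using r by simp
    ultimately show ?thesis using True r by (simp add: k_def exp_minus field_simps)
  next
    case False
    then show ?thesis using r by (simp add: k_def zero_less_mult_iff)
  qed
  moreover have "(Gamma s /\<^sub>R \<bar>r\<bar>) / of_real r powr (s - 1) = Gamma s / of_real r powr s"
    using r by (simp add: powr_diff scaleR_conv_of_real field_simps)
  ultimately show ?thesis by simp
qed

text \<open>Termwise integration, justified by summability of \<open>n powr (1 - Re s)\<close>,
  which is where \<open>Re s > 2\<close> enters. Writing \<open>rGamma\<close> for the reciprocal of
  the Gamma function keeps the right-hand side free of poles, so that it can serve as the
  continuation.\<close>

lemma mellin_dirichlet_series:
  fixes c :: "nat \<Rightarrow> complex" and h :: "real \<Rightarrow> complex"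
  assumes c: "\<And>n. norm (c n) \<le> C * real n"
    and h: "\<And>t. t > 0 \<Longrightarrow> (\<lambda>n. c (Suc n) * of_real (exp (- (2 * pi * real (Suc n)) * t))) sums h t"
    and s: "Re s > 2"
  shows "(\<lambda>n. c (Suc n) / of_nat (Suc n) powr s) sums
     ((2 * of_real pi) powr s * rGamma s * mellin h s)"
proof -
  define l where "l n = 2 * pi * real (Suc n)" for n
  have l: "l n > 0" for n by (simp add: l_def)
  define u where "u n t = indicator {0<..} t *\<^sub>R (c (Suc n) * of_real (exp (- l n * t)) * of_real t powr (s - 1))" for n t
  have u: "has_bochner_integral lborel (u n) (c (Suc n) * (Gamma s / of_real (l n) powr s))" for n
  proof -
    have "has_bochner_integral lborel (\<lambda>t. c (Suc n) * (indicator {0<..} t *\<^sub>R (of_real (exp (- l n * t)) * of_real t powr (s - 1))))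
       (c (Suc n) * (Gamma s / of_real (l n) powr s))"
      by (intro has_bochner_integral_mult_right gamma_integral_scaled l) (use s in auto)
    then show ?thesis by (simp add: u_def[abs_def] mult_ac scaleR_conv_of_real)
  qed
  have nu: "(LINT t|lborel. norm (u n t)) = norm (c (Suc n)) * (Gamma (Re s) / l n powr Re s)" for n
  proof -
    have "has_bochner_integral lborel (\<lambda>t. indicator {0<..} t *\<^sub>R (of_real (exp (- l n * t)) * of_real t powr (of_real (Re s) - 1)))
       (Gamma (of_real (Re s)) / of_real (l n) powr of_real (Re s) :: complex)"
      by (rule gamma_integral_scaled[OF l]) (use s in simp)
    moreover have "indicator {0<..} t *\<^sub>R (of_real (exp (- l n * t)) * of_real t powr (of_real (Re s) - 1)) =
        complex_of_real (indicator {0<..} t * (exp (- l n * t) * t powr (Re s - 1)))" for t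
      by (auto simp: indicator_def powr_of_real[symmetric])
    moreover have "Gamma (of_real (Re s)) / of_real (l n) powr of_real (Re s) = complex_of_real (Gamma (Re s) / l n powr Re s)"
      using l[of n] by (simp add: Gamma_complex_of_real powr_of_real)
    ultimately have "(LINT t|lborel. complex_of_real (indicator {0<..} t * (exp (- l n * t) * t powr (Re s - 1)))) =
        complex_of_real (Gamma (Re s) / l n powr Re s)"
      by (simp only: has_bochner_integral_iff)
    then have "(LINT t|lborel. indicator {0<..} t * (exp (- l n * t) * t powr (Re s - 1))) = Gamma (Re s) / l n powr Re s"
      unfolding integral_complex_of_real of_real_eq_iff .
    moreover have "norm (u n t) = norm (c (Suc n)) * (indicator {0<..} t * (exp (- l n * t) * t powr (Re s - 1)))" for t
      by (auto simp: u_def indicator_def norm_mult norm_powr_real)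
    ultimately show ?thesis by simp
  qed
  have sum_t: "summable (\<lambda>n. norm (u n t))" for t
  proof (cases "t > 0")
    case True
    \<comment> \<open>Convergence at \<open>t / 2\<close> evaluates the power series at the larger
      modulus \<open>exp (- pi * t)\<close>, whence absolute convergence at
      \<open>exp (- (2 * pi * t))\<close>.\<close>
    have A: "(\<lambda>n. c (Suc n) * of_real (exp (- l n * (t / 2)))) sums h (t / 2)"
      using h[of "t / 2"] True by (simp add: l_def)
    have B: "c (Suc n) * of_real (exp (- l n * (t / 2))) = of_real (exp (- pi * t)) * (c (Suc n) * of_real (exp (- pi * t)) ^ n)" for n
      by (simp add: l_def algebra_simps flip: exp_of_nat_mult exp_add of_real_mult of_real_power)
    have "summable (\<lambda>n. of_real (exp (- pi * t)) * (c (Suc n) * of_real (exp (- pi * t)) ^ n))"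
      using sums_summable[OF A] unfolding B .
    then have "summable (\<lambda>n. c (Suc n) * of_real (exp (- pi * t)) ^ n)"
      by (subst (asm) summable_cmult_iff) simp
    then have "summable (\<lambda>n. norm (c (Suc n) * of_real (exp (- (2 * pi * t))) ^ n))"
      by (rule powser_insidea) (use True in simp)
    then have "summable (\<lambda>n. norm (c (Suc n) * of_real (exp (- (2 * pi * t))) ^ n) * (exp (- (2 * pi * t)) * t powr (Re s - 1)))"
      by (rule summable_mult2)
    moreover have "norm (u n t) = norm (c (Suc n) * of_real (exp (- (2 * pi * t))) ^ n) * (exp (- (2 * pi * t)) * t powr (Re s - 1))" for n
    proof -
      have "exp (- l n * t) = exp (- (2 * pi * t)) ^ n * exp (- (2 * pi * t))"
        by (simp add: l_def algebra_simps flip: exp_of_nat_mult exp_add)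
      then show ?thesis using True by (simp add: u_def norm_mult norm_power norm_powr_real)
    qed
    ultimately show ?thesis by simp
  qed (simp add: u_def)
  have sum_int: "summable (\<lambda>n. LINT t|lborel. norm (u n t))"
  proof (rule summable_comparison_test')
    have "summable (\<lambda>n. real n powr (1 - Re s))" using s by (simp add: summable_real_powr_iff)
    then have "summable (\<lambda>n. real (Suc n) powr (1 - Re s))" by (subst summable_Suc_iff)
    then show "summable (\<lambda>n. (C * Gamma (Re s)) * real (Suc n) powr (1 - Re s))" by (rule summable_mult)
    fix n :: nat
    have G: "Gamma (Re s) \<ge> 0" using s by (simp add: Gamma_real_pos less_imp_le)
    have "norm (c (Suc n)) * (Gamma (Re s) / l n powr Re s) \<le> (C * real (Suc n)) * (Gamma (Re s) / real (Suc n) powr Re s)"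
    proof (intro mult_mono divide_left_mono)
      show "real (Suc n) powr Re s \<le> l n powr Re s"
      proof (rule powr_mono2)
        have "1 * real (Suc n) \<le> (2 * pi) * real (Suc n)"
          by (rule mult_right_mono) (use pi_gt3 in auto)
        then show "real (Suc n) \<le> l n" by (simp add: l_def)
      qed (use s in auto)
    qed (use c[of "Suc n"] G l[of n] order_trans[OF norm_ge_zero c[of "Suc n"]] in auto)
    also have "\<dots> = (C * Gamma (Re s)) * real (Suc n) powr (1 - Re s)"
      by (simp add: powr_diff)
    finally show "norm (LINT t|lborel. norm (u n t)) \<le> (C * Gamma (Re s)) * real (Suc n) powr (1 - Re s)"
      unfolding nu using G by (simp add: abs_mult)
  qed
  have "(\<lambda>n. integral\<^sup>L lborel (u n)) sums (LINT t|lborel. (\<Sum>n. u n t))"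
    by (rule sums_integral) (use u sum_t sum_int in \<open>auto simp: has_bochner_integral_iff\<close>)
  moreover have "(\<Sum>n. u n t) = indicator {0<..} t *\<^sub>R (h t * of_real t powr (s - 1))" for t
  proof (cases "t > 0")
    case True
    have "(\<lambda>n. c (Suc n) * of_real (exp (- l n * t)) * of_real t powr (s - 1)) sums (h t * of_real t powr (s - 1))"
      using h[OF True] unfolding l_def by (rule sums_mult2)
    then show ?thesis using True by (simp add: u_def sums_iff)
  qed (simp add: u_def)
  moreover have "integral\<^sup>L lborel (u n) = c (Suc n) * (Gamma s / of_real (l n) powr s)" for n
    using u by (simp add: has_bochner_integral_iff)
  ultimately have "(\<lambda>n. c (Suc n) * (Gamma s / of_real (l n) powr s)) sums mellin h s"
    by (simp add: set_lebesgue_integral_def)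
  then have "(\<lambda>n. (2 * of_real pi) powr s * rGamma s * (c (Suc n) * (Gamma s / of_real (l n) powr s))) sums
    ((2 * of_real pi) powr s * rGamma s * mellin h s)"
    by (rule sums_mult)
  moreover have "(2 * of_real pi) powr s * rGamma s * (c (Suc n) * (Gamma s / of_real (l n) powr s)) = c (Suc n) / of_nat (Suc n) powr s" for n
  proof -
    have "Gamma s \<noteq> 0" using s by (auto simp: Gamma_eq_zero_iff elim!: nonpos_Ints_cases)
    then have "rGamma s * Gamma s = 1" by (simp add: rGamma_inverse_Gamma)
    moreover have "complex_of_real (l n) powr s = (2 * of_real pi) powr s * of_nat (Suc n) powr s"
    proof -
      have "complex_of_real (l n) = of_real (2 * pi) * of_real (real (Suc n))" by (simp add: l_def)
      also have "\<dots> powr s = of_real (2 * pi) powr s * of_real (real (Suc n)) powr s"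
        by (rule powr_times_real) auto
      finally show ?thesis by simp
    qed
    moreover have "(2 * complex_of_real pi) powr s \<noteq> 0" "complex_of_nat (Suc n) powr s \<noteq> 0" by (auto simp del: of_nat_Suc)
    ultimately show ?thesis by (simp add: field_simps del: of_nat_Suc)
  qed
  ultimately show ?thesis by (simp del: of_nat_Suc)
qed

text \<open>At 1 the power of \<open>t\<close> disappears and the integrand is the derivative of
  \<open>H\<close> divided by \<open>- 2 \<pi>\<close>, so the fundamental theorem on each
  \<open>exhaust n\<close> evaluates the integral.\<close>

lemma mellin_value_at_1:
  fixes h H :: "real \<Rightarrow> complex"
  assumes cont: "continuous_on {0<..} h"
    and decay: "\<And>A. \<exists>C. \<forall>t>0. norm (h t) \<le> C * t powr A"
    and H: "\<And>t. t > 0 \<Longrightarrow> (H has_vector_derivative - (2 * of_real pi) * h t) (at t)"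
    and lim: "(H \<longlongrightarrow> H0) (at_right 0)" "(H \<longlongrightarrow> 0) at_top"
  shows "2 * of_real pi * mellin h 1 = H0"
proof -
  have int: "integral (exhaust n) (\<lambda>t. h t * of_real t powr (1 - 1)) = (H (1 / (real n + 1)) - H (real n + 1)) / (2 * of_real pi)" for n
  proof -
    have pos: "t > 0" if "t \<in> exhaust n" for t using that exhaust_subset by auto
    have "((\<lambda>t. - (2 * of_real pi) * h t) has_integral (H (real n + 1) - H (1 / (real n + 1)))) (exhaust n)"
      unfolding exhaust_def
    proof (rule fundamental_theorem_of_calculus)
      show "1 / (real n + 1) \<le> real n + 1" by (rule order_trans[of _ 1]) (simp_all add: divide_le_eq)
      show "(H has_vector_derivative - (2 * of_real pi) * h t) (at t within {1 / (real n + 1)..real n + 1})"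
        if "t \<in> {1 / (real n + 1)..real n + 1}" for t
        using H[of t] pos[of t] that by (auto simp: exhaust_def intro: has_vector_derivative_at_within)
    qed
    then have "((\<lambda>t. (- (2 * of_real pi) * h t) / (- (2 * of_real pi))) has_integral (H (real n + 1) - H (1 / (real n + 1))) / (- (2 * of_real pi))) (exhaust n)"
      by (rule has_integral_divide)
    then have "((\<lambda>t. h t * of_real t powr (1 - 1)) has_integral (H (real n + 1) - H (1 / (real n + 1))) / (- (2 * of_real pi))) (exhaust n)"
      by (rule has_integral_eq[rotated]) (use pos in fastforce)
    then show ?thesis by (simp add: integral_unique minus_divide_left)
  qed
  have top: "filterlim (\<lambda>n. real n + 1) at_top sequentially"
    using filterlim_tendsto_add_at_top[OF tendsto_const filterlim_real_sequentially, of 1]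
    by (simp add: add.commute)
  then have "filterlim (\<lambda>n. inverse (real n + 1)) (at_right 0) sequentially"
    by (rule filterlim_compose[OF filterlim_inverse_at_right_top])
  then have "(\<lambda>n. H (1 / (real n + 1))) \<longlonglongrightarrow> H0"
    using filterlim_compose[OF lim(1)] by (simp add: inverse_eq_divide)
  moreover have "(\<lambda>n. H (real n + 1)) \<longlonglongrightarrow> 0" by (rule filterlim_compose[OF lim(2) top])
  ultimately have A: "(\<lambda>n. (H (1 / (real n + 1)) - H (real n + 1)) / (2 * of_real pi)) \<longlonglongrightarrow> (H0 - 0) / (2 * of_real pi)"
    by (intro tendsto_intros) auto
  have "(\<lambda>n. (H (1 / (real n + 1)) - H (real n + 1)) / (2 * of_real pi)) \<longlonglongrightarrow> mellin h 1"
    using mellin_holomorphic(2)[OF cont decay, of 1] unfolding int .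
  from LIMSEQ_unique[OF this A]
  have "mellin h 1 = H0 / (2 * of_real pi)" by (simp only: diff_zero)
  then show ?thesis by (simp only:) simp
qed

text \<open>The series fixes the function on \<open>Re s > 2\<close> and the identity theorem does
  the rest; this settles the uniqueness required by the description in
  \<open>L_twist\<close>.\<close>

lemma L_twist_eqI:
  assumes "L holomorphic_on UNIV"
    and "\<And>s. Re s > 2 \<Longrightarrow> (\<lambda>n. of_int (ch (int (Suc n))) * a (Suc n) / of_nat (Suc n) powr s) sums L s"
  shows "L_twist a ch = L"
  unfolding L_twist_def
proof (rule the_equality)
  fix L' assume L': "L' holomorphic_on UNIV \<and> (\<forall>s. Re s > 2 \<longrightarrow>
    (\<lambda>n. of_int (ch (int (Suc n))) * a (Suc n) / of_nat (Suc n) powr s) sums L' s)"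
  show "L' = L"
  proof
    fix s
    have "L' s - L s = 0"
    proof (rule analytic_continuation_open[of "{s. Re s > 2}" UNIV "\<lambda>s. L' s - L s" "\<lambda>_. 0"])
      show "{s. Re s > 2} \<noteq> {}" by (auto intro: exI[of _ 3])
      show "(\<lambda>s. L' s - L s) holomorphic_on UNIV" using L' assms(1) by (auto intro!: holomorphic_intros)
      show "L' z - L z = 0" if "z \<in> {s. Re s > 2}" for z
        using that L' assms(2)[of z] sums_unique2 by fastforce
    qed (auto simp: open_halfspace_Re_gt)
    then show "L' s = L s" by simp
  qed
qed (use assms in auto)

section \<open>Twisted L-values\<close>

context newform
begin

text \<open>Moving \<open>k/m\<close> to infinity sends \<open>k/m + i t\<close> to a point of
  height exactly \<open>1 / (m^2 * t)\<close>. The decay there gives the exponential, and the weight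
  factor \<open>D^2 = 1 / (m * t)^2\<close> gives the square of \<open>1 / t\<close>.\<close>

lemma f_bound_at_cusp:
  assumes km: "coprime k (int m)" and m: "m \<ge> 1"
  obtains K c where "K \<ge> 0" "c > 0" "\<And>t. 0 < t \<Longrightarrow> t \<le> 1 \<Longrightarrow>
    norm (f (Complex (k / m) t)) \<le> K * ((1 / t) powr 2 * exp (- (c * (1 / t))))"
proof -
  obtain q d where g: "(k,q,int m,d) \<in> SL2Z" using SL2Z_first_column[OF km] .
  have y0: "1 / (real m)\<^sup>2 > 0" using m by simp
  obtain K where K: "K \<ge> 0" "\<And>z. Im z \<ge> 1 / (real m)\<^sup>2 \<Longrightarrow>
      norm (slash2 f (k,q,int m,d) z) \<le> K * exp (- (2 * pi * Im z / N))"
    using cusp_form_slash_bound[OF N_ge_1 f_cusp g y0] by blast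
  show ?thesis
  proof (rule that[of "K / (real m)\<^sup>2" "2 * pi / (N * (real m)\<^sup>2)"])
    fix t :: real assume t: "0 < t" "t \<le> 1"
    define u where "u = Complex (k / m) t"
    define w where "w = act (d,-q,-int m,k) u"
    have uH: "u \<in> upper_half" using t by (simp add: u_def)
    have wH: "w \<in> upper_half" unfolding w_def by (rule act_upper_half[OF SL2Z_inverse[OF g] uH])
    have u_eq: "act (k,q,int m,d) w = u" unfolding w_def by (rule act_inverse[OF g uH])
    have "of_int (- int m) * u + of_int k = - (\<i> * of_real (m * t))"
      using m by (simp add: u_def complex_eq_iff)
    then have "norm (of_int (- int m) * u + of_int k) = m * t"
      using t by (simp only: norm_minus_cancel norm_mult norm_ii norm_of_real) simp
    then have Imw: "Im w = 1 / ((real m)\<^sup>2 * t)"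
      using Im_act[OF SL2Z_inverse[OF g], of u] t m by (simp add: w_def u_def power2_eq_square field_simps)
    define D where "D = norm (of_int (int m) * w + of_int d)"
    have D: "D > 0" using SL2Z_denom_nz[OF g wH] by (simp add: D_def)
    have "t = Im w / D\<^sup>2" using Im_act[OF g, of w] unfolding u_eq D_def by (simp add: u_def)
    then have D2: "D\<^sup>2 = Im w / t" using D t by (simp add: field_simps)
    have "norm (slash2 f (k,q,int m,d) w) = norm (f u) / D\<^sup>2"
      using u_eq by (simp add: D_def norm_divide norm_power)
    then have "norm (f u) = norm (slash2 f (k,q,int m,d) w) * D\<^sup>2" using D by simp
    also have "\<dots> \<le> K * exp (- (2 * pi * Im w / N)) * D\<^sup>2"
    proof (intro mult_right_mono K(2))
      show "1 / (real m)\<^sup>2 \<le> Im w" unfolding Imw using t m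
        by (intro divide_left_mono) (auto simp: mult_le_cancel_left1)
    qed simp
    also have "\<dots> = K / (real m)\<^sup>2 * ((1 / t) powr 2 * exp (- (2 * pi / (N * (real m)\<^sup>2) * (1 / t))))"
      unfolding D2 Imw using t by (simp add: power2_eq_square field_simps)
    finally show "norm (f (Complex (k / m) t)) \<le> K / (real m)\<^sup>2 * ((1 / t) powr 2 * exp (- (2 * pi / (N * (real m)\<^sup>2) * (1 / t))))"
      by (simp add: u_def)
  qed (use K N_ge_1 m in auto)
qed

text \<open>Vanishing at the cusp \<open>x\<close> settles small \<open>t\<close> and vanishing at
  infinity settles large \<open>t\<close>, each time for an arbitrary exponent; this is the decay
  hypothesis of the Mellin lemmas.\<close>

lemma f_decay:
  assumes x: "x \<in> \<rat>"
  shows "\<exists>C. \<forall>t>0. norm (f (Complex x t)) \<le> C * t powr A"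
proof -
  obtain k and m :: nat where m: "m \<ge> 1" "coprime k (int m)" "x = of_int k / real m"
    using Rats_fraction[OF x] .
  obtain K c where K: "K \<ge> 0" "c > 0" "\<And>t. 0 < t \<Longrightarrow> t \<le> 1 \<Longrightarrow>
    norm (f (Complex (k / m) t)) \<le> K * ((1 / t) powr 2 * exp (- (c * (1 / t))))"
    using f_bound_at_cusp[OF m(2,1)] by blast
  obtain C1 where C1: "C1 \<ge> 0" "\<And>u. u \<ge> 1 \<Longrightarrow> u powr (2 + A) * exp (- (c * u)) \<le> C1"
    using powr_exp_bound[OF K(2)] by blast
  have 2: "2 * pi > 0" by simp
  obtain C2 where C2: "C2 \<ge> 0" "\<And>u. u \<ge> 1 \<Longrightarrow> u powr (- A) * exp (- (2 * pi * u)) \<le> C2"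
    using powr_exp_bound[OF 2] by blast
  obtain K2 where K2: "K2 \<ge> 0" "\<And>z. Im z \<ge> 1 \<Longrightarrow> norm (f z) \<le> K2 * exp (- (2 * pi * Im z / real 1))"
    using expansion_bound[OF _ a_0 f_expansion, of 1] by (metis order_refl zero_less_one)
  have "norm (f (Complex x t)) \<le> (K * C1 + K2 * C2) * t powr A" if t: "t > 0" for t
  proof (cases "t \<le> 1")
    case True
    have "norm (f (Complex x t)) \<le> K * ((1 / t) powr 2 * exp (- (c * (1 / t))))"
      using K(3)[OF t True] m(3) by simp
    also have "(1 / t) powr 2 = (1 / t) powr (2 + A) * t powr A"
      using t by (simp add: powr_add powr_divide)
    also have "K * ((1 / t) powr (2 + A) * t powr A * exp (- (c * (1 / t)))) = K * ((1 / t) powr (2 + A) * exp (- (c * (1 / t)))) * t powr A"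
      by simp
    also have "\<dots> \<le> K * C1 * t powr A"
      by (intro mult_right_mono mult_left_mono C1 K) (use t True in auto)
    also have "\<dots> \<le> (K * C1 + K2 * C2) * t powr A" by (intro mult_right_mono) (use K2 C2 in auto)
    finally show ?thesis .
  next
    case False
    have "norm (f (Complex x t)) \<le> K2 * exp (- (2 * pi * t))"
      using K2(2)[of "Complex x t"] False by simp
    also have "exp (- (2 * pi * t)) = t powr (- A) * exp (- (2 * pi * t)) * t powr A"
      using t by (simp add: powr_minus)
    also have "K2 * (t powr (- A) * exp (- (2 * pi * t)) * t powr A) \<le> K2 * (C2 * t powr A)"
      by (intro mult_right_mono mult_left_mono C2 K2) (use t False in auto)
    also have "\<dots> \<le> (K * C1 + K2 * C2) * t powr A" using K C1 by (simp add: distrib_right)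
    finally show ?thesis .
  qed
  then show ?thesis by blast
qed

text \<open>Additive characters turn the twist of \<open>f\<close> into a combination of the
  functions \<open>f (x k + i t)\<close>. The Mellin transform of this combination continues the
  L-series, and at 1, where the prefactor is \<open>2 \<pi>\<close>, it integrates \<open>f\<close>
  back to boundary values of \<open>F\<close>.\<close>

lemma L_twist_eq_sum_I:
  fixes x :: "'b \<Rightarrow> real" and w :: "'b \<Rightarrow> complex"
  assumes S: "finite S" and x: "\<And>k. k \<in> S \<Longrightarrow> x k \<in> \<rat>"
    and ch: "\<And>n. of_int (ch (int n)) = (\<Sum>k\<in>S. w k * exp (two_pi_i * of_nat n * of_real (x k)))"
  shows "L_twist a ch 1 = (\<Sum>k\<in>S. w k * I (x k))"
proof -
  let ?\<Sigma> = "\<lambda>n. \<Sum>k\<in>S. w k * exp (two_pi_i * of_nat n * of_real (x k))"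
  define c where "c n = of_int (ch (int n)) * a n" for n
  define h where "h t = (\<Sum>k\<in>S. w k * f (Complex (x k) t))" for t
  define H where "H t = (\<Sum>k\<in>S. w k * F (Complex (x k) t))" for t
  obtain C where C: "C \<ge> 0" "\<And>n. norm (a n) \<le> C * real n" using a_bound by blast
  have c_bound: "norm (c n) \<le> ((\<Sum>k\<in>S. norm (w k)) * C) * real n" for n
  proof -
    have "norm (c n) = norm (?\<Sigma> n) * norm (a n)"
      by (simp only: c_def norm_mult ch)
    also have "\<dots> \<le> (\<Sum>k\<in>S. norm (w k)) * (C * real n)"
    proof (rule mult_mono)
      have "norm (?\<Sigma> n) \<le>
          (\<Sum>k\<in>S. norm (w k * exp (two_pi_i * of_nat n * of_real (x k))))" by (rule norm_sum)
      then show "norm (?\<Sigma> n) \<le> (\<Sum>k\<in>S. norm (w k))"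
        by (simp add: norm_mult)
    qed (use C in \<open>auto intro: sum_nonneg\<close>)
    finally show ?thesis by (simp add: mult_ac)
  qed
  have h_sums: "(\<lambda>n. c (Suc n) * of_real (exp (- (2 * pi * real (Suc n)) * t))) sums h t" if t: "t > 0" for t
  proof -
    have "(\<lambda>n. \<Sum>k\<in>S. w k * (a n * qexp 1 (Complex (x k) t) ^ n)) sums h t"
      unfolding h_def by (intro sums_sum sums_mult f_sums) (use t in simp)
    moreover have "(\<Sum>k\<in>S. w k * (a n * qexp 1 (Complex (x k) t) ^ n)) = c n * of_real (exp (- (2 * pi * real n) * t))" for n
    proof -
      have "qexp 1 (Complex (x k) t) ^ n = exp (two_pi_i * of_nat n * of_real (x k)) * of_real (exp (- (2 * pi * real n) * t))" for k
      proof -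
        have "qexp 1 (Complex (x k) t) ^ n = exp (of_nat n * (two_pi_i * Complex (x k) t))"
          by (simp add: qexp_def exp_of_nat_mult)
        also have "of_nat n * (two_pi_i * Complex (x k) t) =
           two_pi_i * of_nat n * of_real (x k) + of_real (- (2 * pi * real n) * t)"
          by (simp add: complex_eq_iff)
        finally show ?thesis by (simp only: exp_add exp_of_real)
      qed
      then have "(\<Sum>k\<in>S. w k * (a n * qexp 1 (Complex (x k) t) ^ n)) =
         ?\<Sigma> n * a n * of_real (exp (- (2 * pi * real n) * t))"
        by (simp add: sum_distrib_left sum_distrib_right mult_ac)
      then show ?thesis unfolding c_def ch .
    qed
    ultimately have "(\<lambda>n. c n * of_real (exp (- (2 * pi * real n) * t))) sums h t" by simp
    then show ?thesis by (subst sums_Suc_iff) (simp add: c_def a_0)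
  qed
  have hol: "f holomorphic_on upper_half" using f_cusp by (simp add: cusp_forms2_def)
  have cont: "continuous_on {0<..} h"
  proof -
    have "continuous_on {0<..} (\<lambda>t. f (Complex (x k) t))" for k
      by (rule continuous_on_compose2[OF holomorphic_on_imp_continuous_on[OF hol]])
         (auto simp: Complex_eq intro!: continuous_intros simp: upper_half_def)
    then show ?thesis unfolding h_def by (intro continuous_intros)
  qed
  have decay: "\<exists>C. \<forall>t>0. norm (h t) \<le> C * t powr A" for A
  proof -
    have "\<forall>k\<in>S. \<exists>C. \<forall>t>0. norm (f (Complex (x k) t)) \<le> C * t powr A" using f_decay x by blast
    then obtain B where B: "\<And>k t. k \<in> S \<Longrightarrow> t > 0 \<Longrightarrow> norm (f (Complex (x k) t)) \<le> B k * t powr A" by metis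
    have "norm (h t) \<le> (\<Sum>k\<in>S. norm (w k) * B k) * t powr A" if t: "t > 0" for t
    proof -
      have "norm (h t) \<le> (\<Sum>k\<in>S. norm (w k) * norm (f (Complex (x k) t)))"
        unfolding h_def by (rule order_trans[OF norm_sum]) (simp add: norm_mult)
      also have "\<dots> \<le> (\<Sum>k\<in>S. norm (w k) * (B k * t powr A))"
        by (intro sum_mono mult_left_mono B t) auto
      finally show ?thesis by (simp add: sum_distrib_right mult.assoc)
    qed
    then show ?thesis by blast
  qed
  have H_deriv: "(H has_vector_derivative - (2 * of_real pi) * h t) (at t)" if t: "t > 0" for t
  proof -
    have "((\<lambda>t. F (Complex y t)) has_vector_derivative - (2 * of_real pi) * f (Complex y t)) (at t)" for y
    proof -
      have "(Complex y has_vector_derivative \<i>) (at t)"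
        unfolding has_vector_derivative_def Complex_eq[abs_def]
        by (auto intro!: derivative_eq_intros simp: scaleR_conv_of_real mult.commute)
      then have "((F \<circ> Complex y) has_vector_derivative \<i> * (two_pi_i * f (Complex y t))) (at t)"
        by (rule field_vector_diff_chain_at) (use F_deriv t in simp)
      then show ?thesis by (simp add: o_def mult_ac)
    qed
    then have "(H has_vector_derivative (\<Sum>k\<in>S. w k * (- (2 * of_real pi) * f (Complex (x k) t)))) (at t)"
      unfolding H_def[abs_def] by (intro has_vector_derivative_sum has_vector_derivative_mult_right)
    then show ?thesis by (simp add: h_def sum_distrib_left sum_negf mult_ac)
  qed
  have H_0: "(H \<longlongrightarrow> (\<Sum>k\<in>S. w k * I (x k))) (at_right 0)"
    unfolding H_def[abs_def] by (intro tendsto_sum tendsto_mult tendsto_const I_tendsto x)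
  have "filterlim (\<lambda>t. Complex y t) at_i_inf at_top" for y
    by (simp add: filterlim_filtercomap_iff o_def filterlim_ident)
  then have "((\<lambda>t. \<Sum>k\<in>S. w k * F (Complex (x k) t)) \<longlongrightarrow> (\<Sum>k\<in>S. w k * 0)) at_top"
    by (intro tendsto_sum tendsto_mult tendsto_const filterlim_compose[OF F_tendsto_0])
  then have H_inf: "(H \<longlongrightarrow> 0) at_top" by (simp add: H_def[abs_def])
  define L where "L s = (2 * of_real pi) powr s * rGamma s * mellin h s" for s
  have "L_twist a ch = L"
  proof (rule L_twist_eqI)
    show "L holomorphic_on UNIV" unfolding L_def[abs_def]
      by (intro holomorphic_intros mellin_holomorphic(3)[OF cont decay])
    show "(\<lambda>n. of_int (ch (int (Suc n))) * a (Suc n) / of_nat (Suc n) powr s) sums L s" if "Re s > 2" for s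
      using mellin_dirichlet_series[OF c_bound h_sums that] unfolding L_def c_def .
  qed
  moreover have "L 1 = (\<Sum>k\<in>S. w k * I (x k))"
    using mellin_value_at_1[OF cont decay H_deriv H_0 H_inf] by (simp add: L_def rGamma_inverse_Gamma)
  ultimately show ?thesis by simp
qed

end

section \<open>Quadratic characters and Gauss sums\<close>

lemma Legendre_values: "Legendre n p \<in> {-1, 0, 1}"
  by (simp add: Legendre_def)

lemma Legendre_eq_0_iff: "Legendre n p = 0 \<longleftrightarrow> p dvd n"
  by (simp add: Legendre_def cong_0_iff)

lemma Legendre_cong: "[m = n] (mod p) \<Longrightarrow> Legendre m p = Legendre n p"
  unfolding Legendre_def QuadRes_def cong_def by simp

lemma odd_prime_gt_2: "prime p \<Longrightarrow> odd p \<Longrightarrow> p > (2::nat)"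
  using prime_ge_2_nat[of p] by (cases "p = 2") auto

text \<open>Euler's criterion gives the congruence modulo \<open>p\<close>; the two sides differ by
  at most 2, which is less than an odd prime.\<close>

lemma Legendre_mult:
  assumes p: "prime p" "odd p"
  shows "Legendre (m * n) (int p) = Legendre m (int p) * Legendre n (int p)"
proof -
  note euler = euler_criterion[OF p(1) odd_prime_gt_2[OF p]]
  have "[Legendre (m * n) (int p) = (m * n) ^ ((p - 1) div 2)] (mod int p)" by (rule euler)
  moreover have "[Legendre m (int p) * Legendre n (int p) = m ^ ((p - 1) div 2) * n ^ ((p - 1) div 2)] (mod int p)"
    by (intro cong_mult euler)
  ultimately have "[Legendre (m * n) (int p) = Legendre m (int p) * Legendre n (int p)] (mod int p)"
    by (simp add: power_mult_distrib) (metis cong_sym cong_trans)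
  then have "int p dvd Legendre (m * n) (int p) - Legendre m (int p) * Legendre n (int p)"
    by (simp add: cong_iff_dvd_diff)
  moreover have "\<bar>Legendre (m * n) (int p) - Legendre m (int p) * Legendre n (int p)\<bar> < int p"
    using Legendre_values[of "m * n" "int p"] Legendre_values[of m "int p"] Legendre_values[of n "int p"]
      odd_prime_gt_2[OF p] by auto
  ultimately show ?thesis using dvd_imp_le_int[of "Legendre (m * n) (int p) - Legendre m (int p) * Legendre n (int p)" "int p"]
    by fastforce
qed

lemma Legendre_1: "prime p \<Longrightarrow> Legendre 1 (int p) = 1"
  using Legendre_eq_0_iff[of 1 "int p"] prime_gt_1_nat[of p]
  by (auto simp: Legendre_def QuadRes_def cong_0_iff intro: exI[of _ 1])

text \<open>Squaring modulo \<open>p\<close> identifies 1 and \<open>p - 1\<close>, so it is not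
  injective on residues and cannot reach all of them.\<close>

lemma exists_nonresidue:
  assumes p: "prime p" "odd p"
  obtains c where "Legendre c (int p) = -1"
proof -
  let ?f = "\<lambda>n. n\<^sup>2 mod p"
  have p2: "p > 2" using odd_prime_gt_2[OF p] .
  have sub: "?f ` {..<p} \<subseteq> {..<p}" using p2 by auto
  have "?f 1 = ?f (p - 1)"
  proof -
    have "int (p - 1) = int p - 1" using p2 by simp
    then have "(int (p - 1))\<^sup>2 = 1 + int p * (int p - 2)" by (simp add: power2_eq_square algebra_simps)
    then have "[(int (p - 1))\<^sup>2 = 1] (mod int p)" by (simp add: cong_iff_dvd_diff)
    then have "[(p - 1)\<^sup>2 = 1] (mod p)" by (metis cong_int_iff of_nat_1 of_nat_power)
    then show ?thesis by (simp add: cong_def)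
  qed
  moreover have "1 \<in> {..<p}" "p - 1 \<in> {..<p}" "1 \<noteq> p - 1" using p2 by auto
  ultimately have "\<not> inj_on ?f {..<p}" using inj_onD[of ?f "{..<p}" 1 "p - 1"] by blast
  then have "?f ` {..<p} \<noteq> {..<p}" using eq_card_imp_inj_on[of "{..<p}" ?f] by auto
  then obtain c where c: "c < p" "c \<notin> ?f ` {..<p}" using sub by auto
  have "?f 0 = 0" using p2 by simp
  then have "0 \<in> ?f ` {..<p}" using p2 by (intro image_eqI[of _ _ 0]) auto
  then have "c \<noteq> 0" using c(2) by auto
  then have "\<not> int p dvd int c" using c by (simp add: nat_dvd_not_less)
  moreover have "\<not> QuadRes (int p) (int c)"
  proof
    assume "QuadRes (int p) (int c)"
    then obtain y where y: "[y\<^sup>2 = int c] (mod int p)" by (auto simp: QuadRes_def)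
    define x where "x = nat (y mod int p)"
    have x: "x < p" "int x = y mod int p" using p2 by (auto simp: x_def nat_less_iff)
    have "[(int x)\<^sup>2 = int c] (mod int p)" using y by (simp add: x cong_def power_mod)
    then have "[x\<^sup>2 = c] (mod p)" by (metis cong_int_iff of_nat_power)
    then have "?f x = c" using c by (simp add: cong_def)
    then show False using c x by auto
  qed
  ultimately have "Legendre (int c) (int p) = -1" by (simp add: Legendre_def cong_0_iff)
  then show ?thesis by (rule that)
qed

text \<open>The Jacobi symbol, indexed by a set of primes in place of their product: the divisors
  \<open>d\<close> of \<open>m\<close> become the subsets \<open>Q\<close> of
  \<open>P\<close>.\<close>

definition jac :: "nat set \<Rightarrow> int \<Rightarrow> int" where
  "jac Q n = (\<Prod>q\<in>Q. Legendre n (int q))"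

definition odd_primes :: "nat set \<Rightarrow> bool" where
  "odd_primes Q \<longleftrightarrow> finite Q \<and> (\<forall>q\<in>Q. prime q \<and> odd q)"

lemma odd_primes_subset: "odd_primes P \<Longrightarrow> Q \<subseteq> P \<Longrightarrow> odd_primes Q"
  by (auto simp: odd_primes_def intro: finite_subset)

lemma prod_primes_pos: "odd_primes Q \<Longrightarrow> \<Prod>Q > 0"
  by (auto simp: odd_primes_def prime_gt_0_nat intro!: prod_pos)

lemma prime_dvd_prod_primes:
  assumes "odd_primes Q" "prime p" shows "p dvd \<Prod>Q \<longleftrightarrow> p \<in> Q"
proof
  assume "p dvd \<Prod>Q"
  then obtain q where "q \<in> Q" "p dvd q" using assms by (auto simp: odd_primes_def prime_dvd_prod_iff)
  then have "p = q" using assms by (intro primes_dvd_imp_eq) (auto simp: odd_primes_def)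
  then show "p \<in> Q" using \<open>q \<in> Q\<close> by simp
next
  assume "p \<in> Q"
  then show "p dvd \<Prod>Q" using assms dvd_prodI[of Q p "\<lambda>x. x"] by (simp add: odd_primes_def)
qed

lemma coprime_prod_primes:
  assumes "odd_primes Q" shows "coprime n (\<Prod>Q) \<longleftrightarrow> (\<forall>q\<in>Q. \<not> q dvd n)"
proof
  assume c: "coprime n (\<Prod>Q)"
  show "\<forall>q\<in>Q. \<not> q dvd n"
  proof (intro ballI notI)
    fix q assume q: "q \<in> Q" "q dvd n"
    then have "prime q" "q dvd \<Prod>Q" using assms prime_dvd_prod_primes by (auto simp: odd_primes_def)
    then show False using c q coprime_common_divisor_nat[of n "\<Prod>Q" q] prime_gt_1_nat by fastforce
  qed
next
  assume "\<forall>q\<in>Q. \<not> q dvd n"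
  then show "coprime n (\<Prod>Q)" using assms
    by (intro prod_coprime_right) (auto simp: odd_primes_def coprime_commute prime_imp_coprime)
qed

lemma prime_factors_prod_primes:
  assumes Q: "odd_primes Q" shows "prime_factors (\<Prod>Q) = Q"
proof -
  have "p \<in> prime_factors (\<Prod>Q) \<longleftrightarrow> p \<in> Q" for p
  proof -
    have "p \<in> prime_factors (\<Prod>Q) \<longleftrightarrow> prime p \<and> p dvd \<Prod>Q"
      using prod_primes_pos[OF Q] by (simp only: in_prime_factors_iff) blast
    also have "\<dots> \<longleftrightarrow> p \<in> Q"
      using prime_dvd_prod_primes[OF Q, of p] Q unfolding odd_primes_def by blast
    finally show ?thesis .
  qed
  then show ?thesis by blast
qed

lemma quad_char_prod_primes: "odd_primes Q \<Longrightarrow> quad_char (\<Prod>Q) = jac Q"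
  by (simp add: fun_eq_iff quad_char_def jac_def prime_factors_prod_primes)

lemma jac_mult: "odd_primes Q \<Longrightarrow> jac Q (m * n) = jac Q m * jac Q n"
  unfolding jac_def by (subst prod.distrib[symmetric], rule prod.cong) (auto simp: odd_primes_def Legendre_mult)

lemma jac_1: "odd_primes Q \<Longrightarrow> jac Q 1 = 1"
  unfolding jac_def by (rule prod.neutral) (auto simp: odd_primes_def Legendre_1)

lemma jac_cong:
  assumes "odd_primes Q" "[m = n] (mod int (\<Prod>Q))" shows "jac Q m = jac Q n"
  unfolding jac_def
proof (rule prod.cong)
  fix q assume "q \<in> Q"
  then have "int q dvd int (\<Prod>Q)" using assms prime_dvd_prod_primes by (auto simp: odd_primes_def)
  then show "Legendre m (int q) = Legendre n (int q)"
    using assms(2) by (intro Legendre_cong) (rule cong_dvd_modulus)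
qed simp

lemma jac_cong_multiple:
  assumes "odd_primes P" "Q \<subseteq> P" "[k = l] (mod (\<Prod>P))"
  shows "jac Q (int k) = jac Q (int l)"
proof -
  have "\<Prod>Q dvd \<Prod>P" using assms(1,2) by (intro prod_dvd_prod_subset) (auto simp: odd_primes_def)
  then have "[k = l] (mod (\<Prod>Q))" using assms(3) by (rule cong_dvd_modulus_nat[rotated])
  then show ?thesis
    by (intro jac_cong[OF odd_primes_subset[OF assms(1,2)]]) (simp only: cong_int_iff)
qed

lemma jac_eq_0_iff:
  assumes "odd_primes Q" shows "jac Q (int n) = 0 \<longleftrightarrow> \<not> coprime n (\<Prod>Q)"
  using assms by (auto simp: jac_def odd_primes_def Legendre_eq_0_iff coprime_prod_primes[OF assms])

lemma jac_sq:
  assumes Q: "odd_primes Q" and n: "\<And>q. q \<in> Q \<Longrightarrow> \<not> int q dvd n" shows "jac Q n * jac Q n = 1"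
proof -
  have "jac Q n * jac Q n = (\<Prod>q\<in>Q. Legendre n (int q) * Legendre n (int q))"
    by (simp add: jac_def prod.distrib)
  also have "\<dots> = 1"
  proof (rule prod.neutral, rule ballI)
    fix q assume "q \<in> Q"
    then have "Legendre n (int q) \<noteq> 0" using n by (simp add: Legendre_eq_0_iff)
    then show "Legendre n (int q) * Legendre n (int q) = 1" using Legendre_values[of n "int q"] by auto
  qed
  finally show ?thesis .
qed

lemma jac_neg1: assumes "odd_primes Q" shows "jac Q (-1) = 1 \<or> jac Q (-1) = -1"
proof -
  have "jac Q (-1) * jac Q (-1) = 1"
    by (rule jac_sq[OF assms]) (use assms in \<open>auto simp: odd_primes_def dest: prime_gt_1_nat\<close>)
  then show ?thesis by (simp add: square_eq_1_iff)
qed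

lemma jac_values: "odd_primes Q \<Longrightarrow> jac Q n \<in> {-1, 0, 1}"
proof -
  assume Q: "odd_primes Q"
  have "\<bar>jac Q n\<bar> \<le> 1" unfolding jac_def abs_prod
    by (rule prod_le_1) (auto simp: Legendre_def)
  then show ?thesis by auto
qed

text \<open>A non-residue modulo \<open>q\<close> is combined with 1 modulo the remaining primes.
  Multiplication by \<open>c\<close> then reverses every character whose conductor is divisible by
  \<open>q\<close>; this drives both the vanishing of Gauss sums and the orthogonality
  relation.\<close>

lemma jac_flip:
  assumes P: "odd_primes P" and q: "q \<in> P"
  obtains c :: nat where "coprime c (\<Prod>P)" "[c = 1] (mod (\<Prod>(P - {q})))"
    "\<And>Q. Q \<subseteq> P \<Longrightarrow> q \<in> Q \<Longrightarrow> jac Q (int c) = -1"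
proof -
  have pq: "prime q" "odd q" and fin: "finite P" using P q by (auto simp: odd_primes_def)
  have P': "odd_primes (P - {q})" using P by (rule odd_primes_subset) auto
  obtain b where b: "Legendre b (int q) = -1" using exists_nonresidue[OF pq] .
  define b' where "b' = nat (b mod int q)"
  have "int b' = b mod int q" using pq prime_gt_0_nat by (simp add: b'_def)
  then have b': "Legendre (int b') (int q) = -1"
    using b Legendre_cong[of "int b'" b "int q"] by (simp add: cong_def)
  have "coprime q (\<Prod>(P - {q}))"
    using P' pq prime_dvd_prod_primes[OF P' pq(1)] by (intro prime_imp_coprime) auto
  then obtain c where c: "[c = b'] (mod q)" "[c = 1] (mod (\<Prod>(P - {q})))"
    using binary_chinese_remainder_nat by blast
  have Lq: "Legendre (int c) (int q) = -1"
    using b' Legendre_cong[of "int c" "int b'" "int q"] c(1) by (simp add: cong_int_iff)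
  have j: "jac Q (int c) = -1" if Q: "Q \<subseteq> P" "q \<in> Q" for Q
  proof -
    have Q': "odd_primes (Q - {q})" and sub: "Q - {q} \<subseteq> P - {q}"
      using P Q(1) by (auto intro: odd_primes_subset)
    have "\<Prod>(Q - {q}) dvd \<Prod>(P - {q})"
      using sub fin by (intro prod_dvd_prod_subset) auto
    then have "[c = 1] (mod (\<Prod>(Q - {q})))" using c(2) by (rule cong_dvd_modulus_nat[rotated])
    then have "jac (Q - {q}) (int c) = 1"
      using jac_cong[OF Q', of "int c" 1] jac_1[OF Q'] by (metis cong_int_iff of_nat_1)
    moreover have "finite Q" using Q(1) fin by (rule finite_subset)
    ultimately show ?thesis
      using prod.remove[OF _ Q(2), of "\<lambda>p. Legendre (int c) (int p)"] Lq by (simp add: jac_def)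
  qed
  then have "coprime c (\<Prod>P)" using jac_eq_0_iff[OF P, of c] q by fastforce
  then show ?thesis using j c(2) that by blast
qed

section \<open>Gauss sums of quadratic characters\<close>

lemma sum_mod_mult:
  fixes g :: "nat \<Rightarrow> 'a::comm_monoid_add"
  assumes M: "M > 0" and c: "coprime c M" and g: "\<And>k. g (k mod M) = g k"
  shows "(\<Sum>k<M. g (c * k)) = (\<Sum>k<M. g k)"
proof -
  let ?h = "\<lambda>k. (c * k) mod M"
  have "inj_on ?h {..<M}"
  proof (rule inj_onI)
    fix x y assume xy: "x \<in> {..<M}" "y \<in> {..<M}" "?h x = ?h y"
    then have "[x = y] (mod M)" using c cong_mult_lcancel_nat[of c M x y] by (simp add: cong_def)
    then show "x = y" using xy by (simp add: cong_def)
  qed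
  moreover have "?h ` {..<M} \<subseteq> {..<M}" using M by auto
  ultimately have "bij_betw ?h {..<M} {..<M}"
    by (simp add: bij_betw_def endo_inj_surj)
  from sum.reindex_bij_betw[OF this, of g] show ?thesis by (simp add: g)
qed

definition ee :: "real \<Rightarrow> complex" where "ee x = exp (two_pi_i * of_real x)"

lemma ee_add: "ee (x + y) = ee x * ee y"
  by (simp add: ee_def ring_distribs exp_add)

lemma ee_of_nat [simp]: "ee (of_nat n) = 1" "ee (real n) = 1"
  using exp_eq_1[of "two_pi_i * of_real (real n)"] by (auto simp: ee_def intro: exI[of _ "int n"])

lemma ee_mod: "M > 0 \<Longrightarrow> ee (real (k mod M * n) / real M) = ee (real (k * n) / real M)"
proof -
  assume M: "M > 0"
  have "real (k * n) = real (k mod M * n) + real (k div M * n) * real M"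
  proof -
    have "k * n = (k mod M) * n + (k div M * n) * M" by (metis add_mult_distrib mod_mult_div_eq mult.assoc mult.commute)
    then show ?thesis by (metis of_nat_add of_nat_mult)
  qed
  then have "real (k * n) / real M = real (k mod M * n) / real M + real (k div M * n)"
    using M by (simp add: field_simps)
  then show ?thesis by (simp only: ee_add ee_of_nat mult_1_right)
qed

definition gauss_sum :: "nat set \<Rightarrow> nat \<Rightarrow> complex" where
  "gauss_sum Q n = (\<Sum>k<\<Prod>Q. of_int (jac Q (int k)) * ee (real (k * n) / real (\<Prod>Q)))"

lemma gauss_sum_mult:
  assumes Q: "odd_primes Q" and c: "coprime c (\<Prod>Q)"
  shows "gauss_sum Q n = of_int (jac Q (int c)) * gauss_sum Q (c * n)"
proof -
  let ?M = "\<Prod>Q"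
  have M: "?M > 0" using prod_primes_pos[OF Q] .
  let ?g = "\<lambda>k. of_int (jac Q (int k)) * ee (real (k * n) / real ?M)"
  have per: "?g (k mod ?M) = ?g k" for k
    using ee_mod[OF M, of k n] jac_cong[OF Q, of "int (k mod ?M)" "int k"] by (simp add: cong_def zmod_int)
  have "gauss_sum Q n = (\<Sum>k<?M. ?g (c * k))"
    unfolding gauss_sum_def using sum_mod_mult[where g = ?g, OF M c per] by simp
  also have "\<dots> = of_int (jac Q (int c)) * gauss_sum Q (c * n)"
    by (simp add: gauss_sum_def sum_distrib_left jac_mult[OF Q] mult_ac)
  finally show ?thesis .
qed

lemma gauss_sum_cong:
  assumes Q: "odd_primes Q" and n: "[n = n'] (mod (\<Prod>Q))"
  shows "gauss_sum Q n = gauss_sum Q n'"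
proof -
  have "ee (real (k * n) / real (\<Prod>Q)) = ee (real (k * n') / real (\<Prod>Q))" for k
    using ee_mod[OF prod_primes_pos[OF Q], of n k] ee_mod[OF prod_primes_pos[OF Q], of n' k] n
    by (simp add: cong_def mult.commute)
  then show ?thesis by (simp add: gauss_sum_def)
qed

text \<open>For \<open>n\<close> prime to the modulus this is a reindexing. Otherwise some
  \<open>q\<close> in \<open>Q\<close> divides \<open>n\<close>, and the \<open>c\<close> of
  \<open>jac_flip\<close> satisfies \<open>c * n \<equiv> n\<close> but \<open>jac Q c = -1\<close>,
  so the Gauss sum equals its own negative. This is primitivity of the character in elementary
  form.\<close>

lemma gauss_sum_eq:
  assumes Q: "odd_primes Q"
  shows "gauss_sum Q n = of_int (jac Q (int n)) * gauss_sum Q 1"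
proof (cases "coprime n (\<Prod>Q)")
  case True
  have "jac Q (int n) * jac Q (int n) = 1"
    by (rule jac_sq[OF Q]) (use True coprime_prod_primes[OF Q] in auto)
  moreover have "of_int (jac Q (int n)) * gauss_sum Q 1 = of_int (jac Q (int n) * jac Q (int n)) * gauss_sum Q n"
    using gauss_sum_mult[OF Q True, of 1] by simp
  ultimately show ?thesis by simp
next
  case False
  then obtain q where q: "q \<in> Q" "q dvd n" using coprime_prod_primes[OF Q] by blast
  obtain c where c: "coprime c (\<Prod>Q)" "[c = 1] (mod (\<Prod>(Q - {q})))"
    and "\<And>Q'. Q' \<subseteq> Q \<Longrightarrow> q \<in> Q' \<Longrightarrow> jac Q' (int c) = -1"
    using jac_flip[OF Q q(1)] by blast
  then have jc: "jac Q (int c) = -1" using q(1) by blast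
  have "int q * int (\<Prod>(Q - {q})) dvd int n * (int c - 1)"
    using q(2) c(2) by (intro mult_dvd_mono) (simp, metis cong_iff_dvd_diff cong_int_iff of_nat_1)
  moreover have "q * \<Prod>(Q - {q}) = \<Prod>Q"
    using prod.remove[of Q q "\<lambda>x. x"] Q q by (simp add: odd_primes_def)
  then have "int (\<Prod>Q) = int q * int (\<Prod>(Q - {q}))" by (metis of_nat_mult)
  moreover have "int n * (int c - 1) = int (c * n) - int n" by (simp add: algebra_simps)
  ultimately have "int (\<Prod>Q) dvd int (c * n) - int n" by (simp only:)
  then have "[c * n = n] (mod (\<Prod>Q))" by (metis cong_iff_dvd_diff cong_int_iff)
  then have "gauss_sum Q n = - gauss_sum Q n"
    using gauss_sum_mult[OF Q c(1), of n] gauss_sum_cong[OF Q] jc by fastforce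
  then have "gauss_sum Q n = 0" by simp
  then show ?thesis using False jac_eq_0_iff[OF Q, of n] by simp
qed

text \<open>One factor is expanded and the other absorbed by \<open>gauss_sum_eq\<close>; summing
  the additive characters over \<open>n\<close> then leaves only the class of -1, represented by
  \<open>?M - 1\<close>, which is also right for \<open>?M = 1\<close>.\<close>

lemma gauss_sum_square:
  assumes Q: "odd_primes Q"
  shows "(gauss_sum Q 1)\<^sup>2 = of_int (jac Q (-1)) * of_nat (\<Prod>Q)"
proof -
  let ?M = "\<Prod>Q"
  have M: "?M > 0" using prod_primes_pos[OF Q] .
  have "(gauss_sum Q 1)\<^sup>2 = (\<Sum>n<?M. of_int (jac Q (int n)) * ee (real n / real ?M)) * gauss_sum Q 1"
    by (simp add: power2_eq_square gauss_sum_def)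
  also have "\<dots> = (\<Sum>n<?M. gauss_sum Q n * ee (real n / real ?M))"
    unfolding sum_distrib_right by (subst gauss_sum_eq[OF Q]) (simp add: mult_ac)
  also have "\<dots> = (\<Sum>n<?M. \<Sum>k<?M. of_int (jac Q (int k)) * ee (real ((k + 1) * n) / real ?M))"
  proof -
    have "ee (real ((k + 1) * n) / real ?M) = ee (real (k * n) / real ?M) * ee (real n / real ?M)" for k n
      by (simp add: algebra_simps add_divide_distrib flip: ee_add)
    then show ?thesis by (simp only: gauss_sum_def sum_distrib_right mult.assoc)
  qed
  also have "\<dots> = (\<Sum>k<?M. of_int (jac Q (int k)) * (\<Sum>n<?M. ee (real ((k + 1) * n) / real ?M)))"
    by (subst sum.swap) (simp add: sum_distrib_left)
  also have "\<dots> = (\<Sum>k<?M. of_int (jac Q (int k)) * (if k = ?M - 1 then of_nat ?M else 0))"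
  proof (intro sum.cong refl arg_cong2[of _ _ _ _ "(*)"])
    fix k assume k: "k \<in> {..<?M}"
    have "(\<Sum>n<?M. ee (real ((k + 1) * n) / real ?M)) = (\<Sum>n<?M. exp (two_pi_i * of_int (int (k + 1)) * of_nat n / of_nat ?M))"
      by (simp add: ee_def algebra_simps)
    also have "\<dots> = (if int ?M dvd int (k + 1) then of_nat ?M else 0)"
      by (rule sum_roots_of_unity) (use M in linarith)
    also have "int ?M dvd int (k + 1) \<longleftrightarrow> k = ?M - 1"
    proof -
      have "?M dvd k + 1 \<longleftrightarrow> k + 1 = ?M" using k dvd_imp_le[of ?M "k + 1"] by fastforce
      then show ?thesis using M by (simp only: int_dvd_int_iff) linarith
    qed
    finally show "(\<Sum>n<?M. ee (real ((k + 1) * n) / real ?M)) = (if k = ?M - 1 then of_nat ?M else 0)" .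
  qed
  also have "\<dots> = of_int (jac Q (int (?M - 1))) * of_nat ?M"
    using M by (simp add: if_distrib[of "\<lambda>x. _ * x"] sum.delta cong: if_cong)
  also have "jac Q (int (?M - 1)) = jac Q (-1)"
    by (rule jac_cong[OF Q]) (use M in \<open>simp add: cong_iff_dvd_diff of_nat_diff del: of_nat_prod\<close>)
  finally show ?thesis .
qed

section \<open>Twisted sums of period values\<close>

lemma sum_block_decomposition:
  fixes G :: "nat \<Rightarrow> 'a::comm_monoid_add"
  shows "(\<Sum>j<q * M. G j) = (\<Sum>k<M. \<Sum>b<q. G (k + b * M))"
proof -
  have "(\<Sum>j<q * M. G j) = (\<Sum>b<q. sum G {b * M..<b * M + M})" by (rule sum.nat_group[symmetric])
  also have "\<dots> = (\<Sum>b<q. \<Sum>k<M. G (k + b * M))"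
  proof (rule sum.cong)
    show "sum G {b * M..<b * M + M} = (\<Sum>k<M. G (k + b * M))" for b
      using sum.shift_bounds_nat_ivl[of G 0 "b * M" M] by (simp only: lessThan_atLeast0 add_0 add.commute)
  qed simp
  also have "\<dots> = (\<Sum>k<M. \<Sum>b<q. G (k + b * M))" by (rule sum.swap)
  finally show ?thesis .
qed

lemma sum_over_multiples:
  fixes G :: "nat \<Rightarrow> 'a::comm_monoid_add"
  assumes "q > 0"
  shows "(\<Sum>j<q * M. if q dvd j then G j else 0) = (\<Sum>l<M. G (q * l))"
proof -
  have "(\<Sum>j<q * M. if q dvd j then G j else 0) = sum G {j \<in> {..<q * M}. q dvd j}"
    by (rule sum.inter_filter[symmetric]) simp
  also have "{j \<in> {..<q * M}. q dvd j} = (\<lambda>l. q * l) ` {..<M}" using assms by (auto elim!: dvdE)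
  also have "sum G \<dots> = (\<Sum>l<M. G (q * l))"
    using assms by (subst sum.reindex) (auto simp: inj_on_def)
  finally show ?thesis .
qed

context newform
begin

lemma I_plus_nat: "x \<in> \<rat> \<Longrightarrow> I (x + real n) = I x"
proof (induction n)
  case (Suc n)
  then show ?case using I_plus_1[of "x + real n"] by (simp add: add.commute add.left_commute)
qed simp

lemma I_mod: "M > 0 \<Longrightarrow> I (real (k mod M) / real M) = I (real k / real M)"
proof -
  assume M: "M > 0"
  have "real k = real (k mod M) + real (k div M) * real M"
    by (metis mod_mult_div_eq mult.commute of_nat_add of_nat_mult)
  then have "real k / real M = real (k mod M) / real M + real (k div M)"
    using M by (simp add: field_simps)
  then show ?thesis using I_plus_nat[of "real (k mod M) / real M" "k div M"] by simp
qed

text \<open>\<open>Q\<close> carries the character and \<open>P\<close> the modulus. For a proper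
  subset the character is imprimitive modulo \<open>\<Prod>P\<close>, and the coprimality test
  removes the \<open>k\<close> at which \<open>jac Q\<close> itself need not vanish.\<close>

definition tsum :: "nat set \<Rightarrow> nat set \<Rightarrow> complex" where
  "tsum P Q = (\<Sum>k<\<Prod>P. if coprime k (\<Prod>P) then of_int (jac Q (int k)) * I (real k / real (\<Prod>P)) else 0)"

lemma tsum_periodic:
  assumes P: "odd_primes P" and Q: "Q \<subseteq> P"
  shows "(if coprime (k mod \<Prod>P) (\<Prod>P) then of_int (jac Q (int (k mod \<Prod>P))) * I (real (k mod \<Prod>P) / real (\<Prod>P)) else 0) =
    (if coprime k (\<Prod>P) then of_int (jac Q (int k)) * I (real k / real (\<Prod>P)) else (0::complex))"
proof -
  have M: "\<Prod>P > 0" by (rule prod_primes_pos[OF P])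
  have "jac Q (int (k mod \<Prod>P)) = jac Q (int k)" by (rule jac_cong_multiple[OF P Q]) simp
  then show ?thesis using M by (simp only: I_mod[OF M] coprime_mod_left_iff[of "\<Prod>P" k] simp_thms)
qed

lemma L_twist_gauss_sum:
  assumes P: "odd_primes P"
  shows "L_twist a (quad_char (\<Prod>P)) 1 * gauss_sum P 1 = tsum P P"
proof -
  have g0: "gauss_sum P 1 \<noteq> 0"
  proof
    assume "gauss_sum P 1 = 0"
    then have "of_int (jac P (-1)) * complex_of_nat (\<Prod>P) = 0" using gauss_sum_square[OF P] by simp
    then show False using prod_primes_pos[OF P] jac_neg1[OF P] by (auto simp del: of_nat_prod)
  qed
  have "L_twist a (quad_char (\<Prod>P)) 1 = (\<Sum>k<\<Prod>P. of_int (jac P (int k)) / gauss_sum P 1 * I (real k / real (\<Prod>P)))"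
  proof (rule L_twist_eq_sum_I)
    fix n
    have "of_int (jac P (int n)) = gauss_sum P n / gauss_sum P 1" using gauss_sum_eq[OF P, of n] g0 by simp
    also have "\<dots> = (\<Sum>k<\<Prod>P. of_int (jac P (int k)) / gauss_sum P 1 * ee (real (k * n) / real (\<Prod>P)))"
      by (simp add: gauss_sum_def[of P n] sum_divide_distrib)
    also have "\<dots> = (\<Sum>k<\<Prod>P. of_int (jac P (int k)) / gauss_sum P 1 * exp (two_pi_i * of_nat n * of_real (real k / real (\<Prod>P))))"
      by (simp add: ee_def mult_ac)
    finally show "of_int (quad_char (\<Prod>P) (int n)) = \<dots>" by (simp only: quad_char_prod_primes[OF P])
  qed (auto simp del: of_nat_prod)
  also have "\<dots> = tsum P P / gauss_sum P 1"
    unfolding tsum_def sum_divide_distrib by (rule sum.cong) (use jac_eq_0_iff[OF P] in auto)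
  finally show ?thesis using g0 by simp
qed

text \<open>The residues modulo \<open>q * M\<close> are written \<open>k + b * M\<close>, and the
  Hecke relation at \<open>k/M\<close> sums over \<open>b\<close>. It yields \<open>a q\<close> and,
  through the term \<open>I (q * k / M)\<close>, one \<open>- jac Q q\<close>; the second one comes
  from discarding the \<open>j\<close> divisible by \<open>q\<close>. Reindexing by \<open>q\<close>
  costs a factor \<open>jac Q q\<close>, which is its own inverse.\<close>

lemma tsum_insert:
  assumes P: "odd_primes P" and q: "prime q" "odd q" "q \<notin> P" "\<not> q dvd N" and Q: "Q \<subseteq> P"
  shows "tsum (insert q P) Q = (a q - 2 * of_int (jac Q (int q))) * tsum P Q"
proof -
  define M where "M = \<Prod>P"
  have M: "M > 0" unfolding M_def by (rule prod_primes_pos[OF P])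
  have q0: "q > 0" using q(1) by (rule prime_gt_0_nat)
  have fin: "finite P" using P by (simp add: odd_primes_def)
  have Q': "odd_primes Q" by (rule odd_primes_subset[OF P Q])
  have prod_q: "\<Prod>(insert q P) = q * M" using fin q(3) by (simp add: M_def)
  have qM: "coprime q M" unfolding M_def
    using prime_dvd_prod_primes[OF P q(1)] q by (intro prime_imp_coprime) auto
  have jq: "jac Q (int q) * jac Q (int q) = 1"
  proof (rule jac_sq[OF Q'])
    fix p assume "p \<in> Q"
    then have "prime p" "p \<noteq> q" using P Q q(3) by (auto simp: odd_primes_def)
    then have "\<not> p dvd q" using primes_dvd_imp_eq[of p q] q(1) by blast
    then show "\<not> int p dvd int q" by simp
  qed
  let ?g = "\<lambda>k. if coprime k M then of_int (jac Q (int k)) * I (real k / real M) else 0"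
  have per: "?g (k mod M) = ?g k" for k using tsum_periodic[OF P Q, of k] unfolding M_def .
  have T: "tsum P Q = (\<Sum>k<M. ?g k)" unfolding tsum_def M_def ..
  have Tq: "(\<Sum>k<M. ?g (q * k)) = tsum P Q" unfolding T by (rule sum_mod_mult[where g = ?g, OF M qM per])
  let ?G = "\<lambda>j. if coprime j M then of_int (jac Q (int j)) * I (real j / real (q * M)) else 0"
  have jac_per: "jac Q (int (k + b * M)) = jac Q (int k)" for k b
    unfolding M_def by (rule jac_cong_multiple[OF P Q]) (simp add: cong_def)
  have "(\<Sum>j<q * M. ?G j) = (\<Sum>k<M. \<Sum>b<q. ?G (k + b * M))" by (rule sum_block_decomposition)
  also have "\<dots> = (\<Sum>k<M. if coprime k M then of_int (jac Q (int k)) * (a q * I (real k / real M) - I (real (q * k) / real M)) else 0)"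
  proof (rule sum.cong)
    fix k
    have "(\<Sum>b<q. ?G (k + b * M)) = (\<Sum>b<q. if coprime k M then of_int (jac Q (int k)) * I ((real k / real M + real b) / real q) else 0)"
    proof (rule sum.cong)
      fix b
      have "coprime (k + b * M) M \<longleftrightarrow> coprime k M"
        using coprime_mod_left_iff[of M "k + b * M"] coprime_mod_left_iff[of M k] M by simp
      moreover have "real (k + b * M) / real (q * M) = (real k / real M + real b) / real q"
        using M q0 by (simp add: field_simps)
      ultimately show "?G (k + b * M) = (if coprime k M then of_int (jac Q (int k)) * I ((real k / real M + real b) / real q) else 0)"
        by (simp only: jac_per)
    qed simp
    also have "\<dots> = (if coprime k M then of_int (jac Q (int k)) * (\<Sum>b<q. I ((real k / real M + real b) / real q)) else 0)"
      by (simp add: sum_distrib_left)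
    also have "(\<Sum>b<q. I ((real k / real M + real b) / real q)) = a q * I (real k / real M) - I (real (q * k) / real M)"
      using I_hecke[OF q(1,4), of "real k / real M"] by simp
    finally show "(\<Sum>b<q. ?G (k + b * M)) = (if coprime k M then of_int (jac Q (int k)) * (a q * I (real k / real M) - I (real (q * k) / real M)) else 0)" .
  qed simp
  also have "\<dots> = (\<Sum>k<M. a q * ?g k - of_int (jac Q (int q)) * ?g (q * k))"
  proof (rule sum.cong)
    fix k
    have "coprime (q * k) M \<longleftrightarrow> coprime k M" using qM by simp
    moreover have "of_int (jac Q (int k)) = of_int (jac Q (int q)) * (of_int (jac Q (int (q * k))) :: complex)"
    proof -
      have "jac Q (int q) * jac Q (int (q * k)) = (jac Q (int q) * jac Q (int q)) * jac Q (int k)"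
        by (simp only: of_nat_mult jac_mult[OF Q'] mult.assoc)
      then show ?thesis using jq by (metis mult_1 of_int_mult)
    qed
    ultimately show "(if coprime k M then of_int (jac Q (int k)) * (a q * I (real k / real M) - I (real (q * k) / real M)) else 0) =
        a q * ?g k - of_int (jac Q (int q)) * ?g (q * k)"
      by (simp add: algebra_simps)
  qed simp
  also have "\<dots> = a q * tsum P Q - of_int (jac Q (int q)) * tsum P Q"
    by (simp only: sum_subtractf sum_distrib_left[symmetric] Tq T[symmetric])
  finally have all: "(\<Sum>j<q * M. ?G j) = a q * tsum P Q - of_int (jac Q (int q)) * tsum P Q" .
  have "(\<Sum>j<q * M. if q dvd j then ?G j else 0) = (\<Sum>l<M. ?G (q * l))" by (rule sum_over_multiples[OF q0])
  also have "\<dots> = (\<Sum>l<M. of_int (jac Q (int q)) * ?g l)"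
  proof (rule sum.cong)
    fix l
    have "coprime (q * l) M \<longleftrightarrow> coprime l M" using qM by simp
    moreover have "real (q * l) / real (q * M) = real l / real M" using q0 by simp
    ultimately show "?G (q * l) = of_int (jac Q (int q)) * ?g l"
      by (simp only: of_nat_mult jac_mult[OF Q']) simp
  qed simp
  also have "\<dots> = of_int (jac Q (int q)) * tsum P Q" by (simp only: sum_distrib_left[symmetric] T)
  finally have mult: "(\<Sum>j<q * M. if q dvd j then ?G j else 0) = of_int (jac Q (int q)) * tsum P Q" .
  have "tsum (insert q P) Q = (\<Sum>j<q * M. ?G j - (if q dvd j then ?G j else 0))"
    unfolding tsum_def prod_q
  proof (rule sum.cong)
    fix j
    have "coprime j (q * M) \<longleftrightarrow> coprime j M \<and> \<not> q dvd j"
    proof -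
      have "coprime j q \<longleftrightarrow> \<not> q dvd j"
      proof
        assume "coprime j q"
        then show "\<not> q dvd j" using prime_gt_1_nat[OF q(1)] coprime_absorb_right[of q j] by auto
      next
        assume "\<not> q dvd j"
        then have "coprime q j" using q(1) by (intro prime_imp_coprime)
        then show "coprime j q" by (simp only: coprime_commute)
      qed
      then show ?thesis by auto
    qed
    then show "(if coprime j (q * M) then of_int (jac Q (int j)) * I (real j / real (q * M)) else 0) = ?G j - (if q dvd j then ?G j else 0)"
      by auto
  qed simp
  also have "\<dots> = (a q - 2 * of_int (jac Q (int q))) * tsum P Q"
    by (simp only: sum_subtractf all mult) (simp add: algebra_simps)
  finally show ?thesis .
qed

lemma tsum_eq_prod:
  assumes P: "odd_primes P" "coprime (\<Prod>P) N" and Q: "Q \<subseteq> P"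
  shows "tsum P Q = (\<Prod>q\<in>P - Q. a q - 2 * of_int (jac Q (int q))) * tsum Q Q"
proof -
  have fin: "finite P" using P by (simp add: odd_primes_def)
  have PN: "\<not> q dvd N" if "q \<in> P" for q
    using P that coprime_prod_primes[OF P(1), of N] by (simp add: coprime_commute)
  have "tsum (Q \<union> R) Q = (\<Prod>q\<in>R. a q - 2 * of_int (jac Q (int q))) * tsum Q Q" if "finite R" "R \<subseteq> P - Q" for R
    using that
  proof (induction R)
    case (insert q R)
    have "tsum (insert q (Q \<union> R)) Q = (a q - 2 * of_int (jac Q (int q))) * tsum (Q \<union> R) Q"
    proof (rule tsum_insert)
      show "odd_primes (Q \<union> R)" by (rule odd_primes_subset[OF P(1)]) (use Q insert in auto)
      show "\<not> q dvd N" using PN insert by auto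
    qed (use insert P in \<open>auto simp: odd_primes_def\<close>)
    then show ?case using insert by (simp add: mult_ac)
  qed simp
  from this[of "P - Q"] show ?thesis using Q fin by (simp add: Un_absorb1)
qed

text \<open>Reindexing by negation, carried out as multiplication by \<open>M - 1\<close>. Hence the
  sum is real for an even and purely imaginary for an odd character, which matches the period by
  which the L-value is divided.\<close>

lemma cnj_tsum:
  assumes P: "odd_primes P"
  shows "cnj (tsum P P) = of_int (jac P (-1)) * tsum P P"
proof -
  define M where "M = \<Prod>P"
  have M: "M > 0" unfolding M_def by (rule prod_primes_pos[OF P])
  let ?g = "\<lambda>k. if coprime k M then of_int (jac P (int k)) * I (real k / real M) else 0"
  have per: "?g (k mod M) = ?g k" for k using tsum_periodic[OF P order_refl, of k] unfolding M_def .
  have c: "coprime (M - 1) M" using M by (rule coprime_diff_one_left_nat)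
  have T: "tsum P P = (\<Sum>k<M. ?g k)" unfolding tsum_def M_def ..
  also have "\<dots> = (\<Sum>k<M. ?g ((M - 1) * k))"
    by (rule sum_mod_mult[where g = ?g, OF M c per, symmetric])
  also have "\<dots> = (\<Sum>k<M. of_int (jac P (-1)) * cnj (?g k))"
  proof (rule sum.cong)
    fix k
    have "coprime ((M - 1) * k) M \<longleftrightarrow> coprime k M" using c by simp
    moreover have "jac P (int ((M - 1) * k)) = jac P (-1) * jac P (int k)"
    proof -
      have "jac P (int (M - 1)) = jac P (-1)"
        by (rule jac_cong[OF P]) (use M in \<open>simp add: cong_iff_dvd_diff of_nat_diff M_def[symmetric]\<close>)
      then show ?thesis by (simp only: of_nat_mult jac_mult[OF P])
    qed
    moreover have "I (real ((M - 1) * k) / real M) = cnj (I (real k / real M))"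
    proof -
      have "real ((M - 1) * k) / real M = - (real k / real M) + real k"
        using M by (simp add: of_nat_diff field_simps)
      then show ?thesis using I_plus_nat[of "- (real k / real M)" k] I_minus[of "real k / real M"] by simp
    qed
    ultimately show "?g ((M - 1) * k) = of_int (jac P (-1)) * cnj (?g k)" by simp
  qed simp
  also have "\<dots> = of_int (jac P (-1)) * cnj (tsum P P)"
    unfolding T cnj_sum sum_distrib_left ..
  finally have "tsum P P = of_int (jac P (-1)) * cnj (tsum P P)" .
  then show ?thesis using jac_neg1[OF P] by (metis complex_cnj_cnj complex_cnj_mult complex_cnj_of_int)
qed

end

section \<open>Period lattice arithmetic\<close>

text \<open>Any \<open>q\<close> in \<open>Q\<close> yields by \<open>jac_flip\<close> a unit
  \<open>c\<close> with \<open>jac Q c = -1\<close>, and multiplication by it negates the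
  sum.\<close>

lemma sum_jac_units:
  assumes P: "odd_primes P" and Q: "Q \<subseteq> P" "Q \<noteq> {}"
  shows "(\<Sum>k<\<Prod>P. if coprime k (\<Prod>P) then jac Q (int k) else 0) = 0"
proof -
  define M where "M = \<Prod>P"
  have M: "M > 0" unfolding M_def by (rule prod_primes_pos[OF P])
  have Q': "odd_primes Q" by (rule odd_primes_subset[OF P Q(1)])
  obtain q where q: "q \<in> Q" using Q(2) by blast
  obtain c where c: "coprime c M" and "[c = 1] (mod (\<Prod>(P - {q})))"
    and flip: "\<And>Q'. Q' \<subseteq> P \<Longrightarrow> q \<in> Q' \<Longrightarrow> jac Q' (int c) = -1"
    unfolding M_def using jac_flip[OF P, of q] q Q(1) by blast
  have jc: "jac Q (int c) = -1" using flip Q(1) q by blast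
  let ?g = "\<lambda>k. if coprime k M then jac Q (int k) else 0"
  have per: "?g (k mod M) = ?g k" for k
  proof -
    have "jac Q (int (k mod M)) = jac Q (int k)"
      unfolding M_def by (rule jac_cong_multiple[OF P Q(1)]) simp
    then show ?thesis using M by (simp add: coprime_mod_left_iff)
  qed
  have "(\<Sum>k<M. ?g k) = (\<Sum>k<M. ?g (c * k))"
    by (rule sum_mod_mult[where g = ?g, OF M c per, symmetric])
  also have "\<dots> = (\<Sum>k<M. - ?g k)"
  proof (rule sum.cong)
    fix k
    have "coprime (c * k) M \<longleftrightarrow> coprime k M" using c by simp
    then show "?g (c * k) = - ?g k" by (simp add: jac_mult[OF Q'] jc)
  qed simp
  also have "\<dots> = - (\<Sum>k<M. ?g k)" by (rule sum_negf)
  finally show ?thesis by (simp add: M_def)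
qed

lemma card_units:
  assumes P: "odd_primes P"
  shows "(\<Sum>k<\<Prod>P. if coprime k (\<Prod>P) then 1 else 0) = (\<Prod>q\<in>P. int q - 1)"
proof -
  define M where "M = \<Prod>P"
  have M: "M > 0" unfolding M_def by (rule prod_primes_pos[OF P])
  have "(\<Sum>k<M. if coprime k M then 1 else 0) = int (card {k \<in> {..<M}. coprime k M})"
    by (subst sum.inter_filter[symmetric]) auto
  also have "card {k \<in> {..<M}. coprime k M} = totient M"
  \<comment> \<open>\<open>totatives\<close> runs over \<open>0 < k \<le> M\<close> but the sum over
    \<open>k < M\<close>; the two sets differ only for \<open>M = 1\<close>, where 0 takes the place
    of 1.\<close>
  proof (cases "M = 1")
    case True
    then have "{k \<in> {..<M}. coprime k M} = {0}" by auto
    then show ?thesis using True by simp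
  next
    case False
    then have "{k \<in> {..<M}. coprime k M} = totatives M"
      using M by (auto simp: totatives_def intro: totatives_less le_neq_implies_less Nat.gr0I)
    then show ?thesis by (simp add: totient_def)
  qed
  also have "totient M = (\<Prod>q\<in>P. totient q)" unfolding M_def
    by (rule totient_prod_coprime) (use P in \<open>auto simp: pairwise_def odd_primes_def primes_coprime\<close>)
  also have "\<dots> = (\<Prod>q\<in>P. q - 1)"
    by (rule prod.cong) (use P in \<open>auto simp: odd_primes_def totient_prime\<close>)
  also have "int \<dots> = (\<Prod>q\<in>P. int q - 1)"
    unfolding of_nat_prod
    by (rule prod.cong) (use P in \<open>auto simp: odd_primes_def of_nat_diff prime_gt_0_nat Suc_le_eq\<close>)
  finally show ?thesis by (simp add: M_def)
qed

locale nonrect_newform = newform +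
  fixes Op Om :: real and A :: "nat \<Rightarrow> int"
  assumes nonrect: "nonrectangular (period_lattice N f) Op Om"
    and a_int: "\<And>q. prime q \<Longrightarrow> \<not> q dvd N \<Longrightarrow> a q = of_int (A q)"
    and A_le: "\<And>q. prime q \<Longrightarrow> \<not> q dvd N \<Longrightarrow> A q \<le> int q"
begin

text \<open>On the lattice spanned by \<open>Op\<close> and \<open>(Op + i Om)/2\<close> this functional is integral, and it
  treats the real and the imaginary periods, hence the even and the odd characters, alike.\<close>

definition psi :: "complex \<Rightarrow> real" where "psi z = Re z / Op + Im z / Om"

lemma Op_pos: "Op > 0" and Om_pos: "Om > 0"
  using nonrect by (auto simp: nonrectangular_def)

lemma psi_lattice: "z \<in> period_lattice N f \<Longrightarrow> psi z \<in> \<int>"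
proof -
  assume "z \<in> period_lattice N f"
  then obtain j k :: int where z: "z = of_int j * of_real Op + of_int k * ((of_real Op + \<i> * of_real Om) / 2)"
    using nonrect by (auto simp: nonrectangular_def)
  have "psi z = of_int (j + k)" unfolding z psi_def using Op_pos Om_pos by (simp add: field_simps)
  then show ?thesis by simp
qed

lemma psi_add: "psi (z + w) = psi z + psi w"
  and psi_diff: "psi (z - w) = psi z - psi w"
  and psi_mult: "psi (of_int n * z) = of_int n * psi z"
  by (simp_all add: psi_def add_divide_distrib diff_divide_distrib algebra_simps)

lemma psi_0 [simp]: "psi 0 = 0" by (simp add: psi_def)

lemma psi_sum: "psi (sum g S) = (\<Sum>k\<in>S. psi (g k))"
  by (induction S rule: infinite_finite_induct) (auto simp: psi_add)

definition L1 :: real where "L1 = psi (I 0)"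

text \<open>The x_d of the overview with \<open>d = \<Prod>Q\<close>. By \<open>cnj_tsum\<close>
  only one of the two summands of \<open>psi\<close> contributes.\<close>

definition xval :: "nat set \<Rightarrow> real" where "xval Q = psi (tsum Q Q)"

lemma not_dvd_N: "odd_primes P \<Longrightarrow> coprime (\<Prod>P) N \<Longrightarrow> q \<in> P \<Longrightarrow> \<not> q dvd N"
  using coprime_prod_primes[of P N] by (simp add: coprime_commute)

lemma psi_I:
  assumes P: "odd_primes P" "coprime (\<Prod>P) N"
  obtains n :: "nat \<Rightarrow> int"
  where "\<And>k. coprime k (\<Prod>P) \<Longrightarrow> psi (I (real k / real (\<Prod>P))) = L1 + of_int (n k)"
proof (rule that)
  fix k assume k: "coprime k (\<Prod>P)"
  have "\<Prod>P \<ge> 1" using prod_primes_pos[OF P(1)] by linarith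
  then have "I (of_int (int k) / real (\<Prod>P)) - I 0 \<in> period_lattice N f"
    by (rule I_diff_in_lattice[rotated]) (use k P in \<open>simp_all only: coprime_int_iff\<close>)
  then have "psi (I (of_int (int k) / real (\<Prod>P)) - I 0) \<in> \<int>" by (rule psi_lattice)
  then have "psi (I (real k / real (\<Prod>P))) - L1 \<in> \<int>" by (simp only: psi_diff L1_def of_int_of_nat_eq)
  then show "psi (I (real k / real (\<Prod>P))) = L1 + of_int \<lfloor>psi (I (real k / real (\<Prod>P))) - L1\<rfloor>"
    by (elim Ints_cases) (metis add.commute diff_add_cancel floor_of_int)
qed

lemma psi_tsum:
  "psi (tsum P Q) = (\<Sum>k<\<Prod>P. if coprime k (\<Prod>P) then of_int (jac Q (int k)) * psi (I (real k / real (\<Prod>P))) else 0)"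
  unfolding tsum_def psi_sum by (rule sum.cong) (auto simp: psi_mult)

lemma psi_tsum_eq:
  assumes P: "odd_primes P" "coprime (\<Prod>P) N" and Q: "Q \<subseteq> P"
  shows "psi (tsum P Q) = of_int (\<Prod>q\<in>P - Q. A q - 2 * jac Q (int q)) * xval Q"
proof -
  have "(\<Prod>q\<in>P - Q. a q - 2 * of_int (jac Q (int q))) = of_int (\<Prod>q\<in>P - Q. A q - 2 * jac Q (int q))"
    unfolding of_int_prod
    by (rule prod.cong) (use P not_dvd_N[OF P] in \<open>auto simp: a_int odd_primes_def\<close>)
  then show ?thesis using tsum_eq_prod[OF P Q] by (simp only: psi_mult xval_def)
qed

lemma xval_empty: "xval {} = L1"
  by (simp add: xval_def psi_tsum jac_def L1_def)

text \<open>The sum over all \<open>Q\<close> gives \<open>psi (I (k/m))\<close> the weight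
  \<open>w k\<close>, a multiple of \<open>2 ^ card P\<close>. Each value is \<open>L1\<close> plus
  an integer. The integers make up the last term, while \<open>L1\<close>, which may have a
  denominator, is multiplied by the total weight; orthogonality reduces that weight to the number of
  units.\<close>

lemma xval_sum_subsets:
  assumes P: "odd_primes P" "coprime (\<Prod>P) N"
  obtains z :: int where "(\<Sum>Q\<in>Pow P. of_int (\<Prod>q\<in>P - Q. A q - 2 * jac Q (int q)) * xval Q) =
    of_int (\<Prod>q\<in>P. int q - 1) * L1 + 2 ^ card P * of_int z"
proof -
  define M where "M = \<Prod>P"
  have fin: "finite P" using P by (simp add: odd_primes_def)
  define y where "y k = psi (I (real k / real M))" for k
  obtain n where n: "\<And>k. coprime k M \<Longrightarrow> y k = L1 + of_int (n k)"
    using psi_I[OF P] unfolding y_def M_def by blast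
  define w where "w k = (\<Prod>q\<in>P. Legendre (int k) (int q) + 1)" for k
  have w_sum: "w k = (\<Sum>Q\<in>Pow P. jac Q (int k))" for k
    unfolding w_def jac_def by (subst prod_add[OF fin]) simp
  have w_dvd: "2 ^ card P dvd w k" if "coprime k M" for k
  proof -
    have "(\<Prod>q\<in>P. 2 :: int) dvd w k" unfolding w_def
    proof (rule prod_dvd_prod)
      fix q assume "q \<in> P"
      then have "Legendre (int k) (int q) \<noteq> 0"
        using that coprime_prod_primes[OF P(1)] by (simp add: Legendre_eq_0_iff M_def)
      then show "2 dvd Legendre (int k) (int q) + 1" using Legendre_values[of "int k" "int q"] by auto
    qed
    then show ?thesis by simp
  qed
  define e where "e k = w k div 2 ^ card P" for k
  have e: "w k = 2 ^ card P * e k" if "coprime k M" for k using w_dvd[OF that] by (simp add: e_def)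
  have "(\<Sum>Q\<in>Pow P. of_int (\<Prod>q\<in>P - Q. A q - 2 * jac Q (int q)) * xval Q) = (\<Sum>Q\<in>Pow P. psi (tsum P Q))"
    by (rule sum.cong) (simp_all only: psi_tsum_eq[OF P] Pow_iff)
  also have "\<dots> = (\<Sum>k<M. \<Sum>Q\<in>Pow P. if coprime k M then of_int (jac Q (int k)) * y k else 0)"
    unfolding psi_tsum M_def y_def by (rule sum.swap)
  also have "\<dots> = (\<Sum>k<M. if coprime k M then of_int (w k) * y k else 0)"
    by (rule sum.cong) (simp_all add: w_sum sum_distrib_right)
  also have "\<dots> = (\<Sum>k<M. of_int (if coprime k M then w k else 0) * L1 + 2 ^ card P * of_int (if coprime k M then e k * n k else 0))"
    by (rule sum.cong) (auto simp: n e algebra_simps)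
  also have "\<dots> = of_int (\<Sum>k<M. if coprime k M then w k else 0) * L1 + 2 ^ card P * of_int (\<Sum>k<M. if coprime k M then e k * n k else 0)"
    by (simp only: sum.distrib sum_distrib_left[symmetric] sum_distrib_right[symmetric] of_int_sum)
  also have "(\<Sum>k<M. if coprime k M then w k else 0) = (\<Sum>k<M. \<Sum>Q\<in>Pow P. if coprime k M then jac Q (int k) else 0)"
    by (rule sum.cong) (simp_all add: w_sum)
  also have "\<dots> = (\<Sum>Q\<in>Pow P. \<Sum>k<M. if coprime k M then jac Q (int k) else 0)" by (rule sum.swap)
  also have "\<dots> = (\<Sum>Q\<in>Pow P. if Q = {} then (\<Sum>k<M. if coprime k M then 1 else 0) else 0)"
    by (rule sum.cong) (use sum_jac_units[OF P(1)] in \<open>auto simp: M_def jac_def cong: if_cong\<close>)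
  also have "\<dots> = (\<Prod>q\<in>P. int q - 1)" using card_units[OF P(1)] fin by (simp add: M_def)
  finally show ?thesis by (rule that)
qed

text \<open>Modulo 2 the character is 1 on units, so \<open>tsum P P\<close> is compared with
  \<open>tsum P {}\<close>. The latter contributes the Hecke factors \<open>A q - 2\<close>; the
  number of units appears because the weights \<open>jac P k - 1\<close> of the difference sum to
  its negative.\<close>

lemma xval_mod_2:
  assumes P: "odd_primes P" "coprime (\<Prod>P) N" and ne: "P \<noteq> {}"
  obtains z :: int where "xval P = of_int ((\<Prod>q\<in>P. A q - 2) - (\<Prod>q\<in>P. int q - 1)) * L1 + 2 * of_int z"
proof -
  define M where "M = \<Prod>P"
  define y where "y k = psi (I (real k / real M))" for k
  obtain n where n: "\<And>k. coprime k M \<Longrightarrow> y k = L1 + of_int (n k)"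
    using psi_I[OF P] unfolding y_def M_def by blast
  define e where "e k = (jac P (int k) - 1) div 2" for k
  have e: "jac P (int k) = 1 + 2 * e k" if "coprime k M" for k
  proof -
    have "jac P (int k) \<noteq> 0" using that jac_eq_0_iff[OF P(1)] by (simp add: M_def)
    then have "jac P (int k) = 1 \<or> jac P (int k) = -1" using jac_values[OF P(1), of "int k"] by auto
    then show ?thesis by (auto simp: e_def)
  qed
  have "xval P - psi (tsum P {}) = (\<Sum>k<M. if coprime k M then of_int (jac P (int k) - 1) * y k else 0)"
    unfolding xval_def psi_tsum M_def[symmetric] y_def[symmetric] sum_subtractf[symmetric]
    by (rule sum.cong) (auto simp: jac_def algebra_simps)
  also have "\<dots> = (\<Sum>k<M. of_int ((if coprime k M then jac P (int k) else 0) - (if coprime k M then 1 else 0)) * L1 +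
      2 * of_int (if coprime k M then e k * n k else 0))"
    by (rule sum.cong) (auto simp: n e algebra_simps)
  also have "\<dots> = of_int ((\<Sum>k<M. if coprime k M then jac P (int k) else 0) - (\<Sum>k<M. if coprime k M then 1 else 0)) * L1
      + 2 * of_int (\<Sum>k<M. if coprime k M then e k * n k else 0)"
    by (simp only: sum.distrib sum_distrib_left[symmetric] sum_distrib_right[symmetric] of_int_sum[symmetric] sum_subtractf)
  also have "(\<Sum>k<M. if coprime k M then jac P (int k) else 0) = 0"
    unfolding M_def by (rule sum_jac_units[OF P(1) order_refl ne])
  also have "(\<Sum>k<M. if coprime k M then 1 else 0) = (\<Prod>q\<in>P. int q - 1)"
    unfolding M_def by (rule card_units[OF P(1)])
  finally have "xval P = psi (tsum P {}) - of_int (\<Prod>q\<in>P. int q - 1) * L1 + 2 * of_int (\<Sum>k<M. if coprime k M then e k * n k else 0)"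
    by (simp add: algebra_simps)
  also have "psi (tsum P {}) = of_int (\<Prod>q\<in>P. A q - 2) * L1"
    using psi_tsum_eq[OF P, of "{}"] by (simp add: jac_def xval_empty)
  finally show ?thesis unfolding left_diff_distrib[symmetric] of_int_diff[symmetric] by (rule that)
qed

text \<open>Each \<open>I (b/q)\<close> differs from \<open>I 0\<close> by a period, so the Hecke
  relation at 0 makes \<open>(A q - 1 - q) * L1\<close> an integer; the bound
  \<open>A q \<le> q\<close> keeps the factor nonzero.\<close>

lemma L1_rational:
  assumes q: "prime q" "\<not> q dvd N"
  shows "L1 \<in> \<rat>"
proof -
  have q0: "q > 0" using q(1) by (rule prime_gt_0_nat)
  have "psi (I (real b / real q)) - L1 \<in> \<int>" if "b \<in> {..<q}" for b
  proof (cases "b = 0")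
    case False
    have "coprime q b" using q(1) False that by (intro prime_imp_coprime) (auto dest: dvd_imp_le)
    moreover have "coprime q N" using q by (intro prime_imp_coprime)
    ultimately have "I (of_int (int b) / real q) - I 0 \<in> period_lattice N f"
      by (intro I_diff_in_lattice) (use q0 in \<open>auto simp: coprime_commute\<close>)
    then show ?thesis using psi_lattice by (fastforce simp: psi_diff L1_def)
  qed (simp add: L1_def)
  then have "(\<Sum>b<q. psi (I (real b / real q)) - L1) \<in> \<int>" by (rule Ints_sum)
  then obtain z where z: "(\<Sum>b<q. psi (I (real b / real q)) - L1) = of_int z" by (elim Ints_cases)
  have "of_int (A q) * I 0 = I 0 + (\<Sum>b<q. I (real b / real q))"
    using I_hecke[OF q, of 0] a_int[OF q] by simp
  then have "psi (of_int (A q) * I 0) = psi (I 0 + (\<Sum>b<q. I (real b / real q)))" by simp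
  then have "of_int (A q) * L1 = L1 + (of_int z + real q * L1)"
    using z by (simp add: psi_mult psi_add psi_sum L1_def sum_subtractf)
  then have "L1 * of_int (A q - 1 - int q) = of_int z" by (simp add: algebra_simps)
  moreover have "A q - 1 - int q \<noteq> 0" using A_le[OF q] by linarith
  ultimately have "L1 = of_int z / of_int (A q - 1 - int q)" by (simp add: field_simps)
  then show ?thesis by (metis Rats_divide Rats_of_int)
qed

text \<open>The Gauss sum and the factor \<open>i\<close> of the odd characters are absorbed in \<open>u\<close>, whose fourth
  power is the inverse of an odd square.\<close>

lemma L_ratio_eq_xval:
  assumes P: "odd_primes P"
  obtains u :: complex where "u ^ 4 * of_nat ((\<Prod>P)\<^sup>2) = 1" "L_ratio a Op Om (\<Prod>P) = u * of_real (xval P)"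
proof -
  define g where "g = gauss_sum P 1"
  have M: "\<Prod>P > 0" by (rule prod_primes_pos[OF P])
  have g2: "g\<^sup>2 = of_int (jac P (-1)) * of_nat (\<Prod>P)" unfolding g_def by (rule gauss_sum_square[OF P])
  have "g ^ 4 = (g\<^sup>2)\<^sup>2" by simp
  also have "\<dots> = of_nat ((\<Prod>P)\<^sup>2)" unfolding g2 using jac_neg1[OF P] by (auto simp: power_mult_distrib)
  finally have g4: "g ^ 4 = of_nat ((\<Prod>P)\<^sup>2)" .
  then have g0: "g \<noteq> 0" using M by (auto simp del: of_nat_prod)
  have L: "L_twist a (jac P) 1 = tsum P P / g"
    using L_twist_gauss_sum[OF P] g0 by (simp add: g_def field_simps quad_char_prod_primes[OF P])
  show ?thesis
  proof (cases "jac P (-1) = 1")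
    case True
    then have "cnj (tsum P P) = tsum P P" using cnj_tsum[OF P] by simp
    then have "tsum P P = of_real (Re (tsum P P))" by (simp add: complex_eq_iff)
    moreover from this have "Im (tsum P P) = 0" by (metis Im_complex_of_real)
    ultimately have "tsum P P = of_real (Op * xval P)" using Op_pos by (simp add: xval_def psi_def)
    then have "L_ratio a Op Om (\<Prod>P) = (1 / g) * of_real (xval P)"
      using Op_pos True by (simp add: L_ratio_def L quad_char_prod_primes[OF P] del: of_nat_prod)
    moreover have "(1 / g) ^ 4 * of_nat ((\<Prod>P)\<^sup>2) = 1" unfolding g4[symmetric] using g0 by (simp add: power_divide)
    ultimately show ?thesis using that by blast
  next
    case False
    then have j: "jac P (-1) = -1" using jac_neg1[OF P] by blast
    then have "cnj (tsum P P) = - tsum P P" using cnj_tsum[OF P] by simp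
    then have "Re (tsum P P) = 0" by (auto simp: complex_eq_iff)
    then have "tsum P P = \<i> * of_real (Om * xval P)" using Om_pos by (simp add: xval_def psi_def complex_eq_iff)
    then have "L_ratio a Op Om (\<Prod>P) = (\<i> / g) * of_real (xval P)"
      using Om_pos j by (simp add: L_ratio_def L quad_char_prod_primes[OF P] del: of_nat_prod)
    moreover have "(\<i> / g) ^ 4 * of_nat ((\<Prod>P)\<^sup>2) = 1" unfolding g4[symmetric] using g0 by (simp add: power_divide)
    ultimately show ?thesis using that by blast
  qed
qed

end

section \<open>Two-adic valuations\<close>

locale two_adic =
  fixes v :: "complex \<Rightarrow> ereal"
  assumes val: "two_adic_valuation v"
begin

lemma v_2: "v 2 = 1"
  and v_eq_infinity_iff: "algebraic x \<Longrightarrow> v x = \<infinity> \<longleftrightarrow> x = 0"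
  and v_not_minf: "algebraic x \<Longrightarrow> v x \<noteq> - \<infinity>"
  and v_mult: "algebraic x \<Longrightarrow> algebraic y \<Longrightarrow> v (x * y) = v x + v y"
  and v_add: "algebraic x \<Longrightarrow> algebraic y \<Longrightarrow> v (x + y) \<ge> min (v x) (v y)"
  using val unfolding two_adic_valuation_def by blast+

definition w :: "real \<Rightarrow> ereal" where "w r = v (of_real r)"

lemma algebraic_Rats: "r \<in> \<rat> \<Longrightarrow> algebraic (complex_of_real r)"
  by (simp add: rat_imp_algebraic)

lemma w_mult: "r \<in> \<rat> \<Longrightarrow> s \<in> \<rat> \<Longrightarrow> w (r * s) = w r + w s"
  using v_mult[of "of_real r" "of_real s"] by (simp add: w_def rat_imp_algebraic)

lemma w_add: "r \<in> \<rat> \<Longrightarrow> s \<in> \<rat> \<Longrightarrow> w (r + s) \<ge> min (w r) (w s)"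
  using v_add[of "of_real r" "of_real s"] by (simp add: w_def rat_imp_algebraic)

lemma w_add_ge: "r \<in> \<rat> \<Longrightarrow> s \<in> \<rat> \<Longrightarrow> w r \<ge> c \<Longrightarrow> w s \<ge> c \<Longrightarrow> w (r + s) \<ge> c"
  using w_add[of r s] by (meson min.boundedI order_trans)

lemma w_0: "w 0 = \<infinity>"
  using v_eq_infinity_iff[of 0] by (simp add: w_def)

lemma w_finite: "r \<in> \<rat> \<Longrightarrow> r \<noteq> 0 \<Longrightarrow> \<bar>w r\<bar> \<noteq> \<infinity>"
  using v_eq_infinity_iff[of "of_real r"] v_not_minf[of "of_real r"] by (auto simp: w_def rat_imp_algebraic)

lemma w_1: "w 1 = 0"
proof -
  have "w 1 = w 1 + w 1" using w_mult[of 1 1] by simp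
  then show ?thesis using w_finite[of 1] by (cases "w 1") auto
qed

lemma w_minus: "r \<in> \<rat> \<Longrightarrow> w (- r) = w r"
proof -
  assume r: "r \<in> \<rat>"
  have "w (-1) + w (-1) = 0" using w_mult[of "-1" "-1"] w_1 by simp
  then have "w (-1) = 0" using w_finite[of "-1"] by (cases "w (-1)") auto
  then show ?thesis using w_mult[of "-1" r] r by simp
qed

lemma w_diff_ge: "r \<in> \<rat> \<Longrightarrow> s \<in> \<rat> \<Longrightarrow> w r \<ge> c \<Longrightarrow> w s \<ge> c \<Longrightarrow> w (r - s) \<ge> c"
  using w_add_ge[of r "- s" c] by (simp add: w_minus)

lemma w_2: "w 2 = 1" by (simp add: w_def v_2)

lemma w_nat: "w (real n) \<ge> 0"
proof (induction n)
  case (Suc n)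
  then show ?case using w_add_ge[of "real n" 1 0] w_1 by (simp add: add.commute)
qed (simp add: w_0)

lemma w_int: "w (of_int n) \<ge> 0"
  using w_nat[of "nat n"] w_nat[of "nat (- n)"] w_minus[of "of_int n"]
  by (cases "n \<ge> 0") auto

lemma w_pow2: "w (2 ^ n) = ereal (real n)"
proof (induction n)
  case (Suc n)
  have "w (2 ^ Suc n) = w 2 + w (2 ^ n)" using w_mult[of 2 "2 ^ n"] by simp
  then show ?case using Suc by (simp add: w_2 one_ereal_def)
qed (simp add: w_1 zero_ereal_def)

lemma w_dvd:
  assumes "2 ^ n dvd k" shows "w (of_int k) \<ge> ereal (real n)"
proof -
  obtain l where "k = 2 ^ n * l" using assms by blast
  then have "w (of_int k) = ereal (real n) + w (of_int l)"
    using w_mult[of "2 ^ n" "of_int l"] by (simp add: w_pow2)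
  then show ?thesis using w_int[of l] add_left_mono[of 0 "w (of_int l)" "ereal (real n)"] by simp
qed

text \<open>In \<open>1 = k + (1 - k)\<close> the second summand has positive valuation; were the
  first positive too, \<open>w 1\<close> would be.\<close>

lemma w_odd: "odd k \<Longrightarrow> w (of_int k) = 0"
proof -
  assume "odd k"
  then have "even (1 - k)" by simp
  then have e: "w (of_int (1 - k)) \<ge> 1" using w_dvd[of 1 "1 - k"] by (simp add: one_ereal_def)
  show ?thesis
  proof (rule ccontr)
    assume "w (of_int k) \<noteq> 0"
    then have "w (of_int k) > 0" using w_int[of k] by simp
    moreover have "w (of_int (1 - k)) > 0" using e by (rule less_le_trans[rotated]) simp
    ultimately have "min (w (of_int k)) (w (of_int (1 - k))) > 0" by simp
    then have "w (of_int k + of_int (1 - k)) > 0" by (rule less_le_trans[OF _ w_add]) auto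
    then show False using w_1 by simp
  qed
qed

lemma w_odd_multiple: "odd k \<Longrightarrow> w (of_int (2 ^ n * k)) = ereal (real n)"
  using w_mult[of "2 ^ n" "of_int k"] w_odd[of k] by (simp add: w_pow2)

lemma w_add_eq:
  assumes r: "r \<in> \<rat>" "s \<in> \<rat>" and lt: "w r < w s" shows "w (r + s) = w r"
proof (rule antisym)
  have "w r \<ge> min (w (r + s)) (w (- s))" using w_add[of "r + s" "- s"] r by simp
  then show "w (r + s) \<le> w r" using lt r by (simp add: w_minus min_def split: if_splits)
  show "w r \<le> w (r + s)" using w_add_ge[of r s "w r"] r lt by simp
qed

lemma w_int_integral: "k \<noteq> 0 \<Longrightarrow> \<exists>n::nat. w (of_int k) = ereal (real n)"
proof -
  assume "k \<noteq> 0"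
  then obtain l where "k = 2 ^ multiplicity 2 k * l" "\<not> 2 dvd l"
    using multiplicity_decompose'[of k 2] by auto
  then show ?thesis using w_odd_multiple[of l "multiplicity 2 k"] by metis
qed

lemma w_Rats_cases:
  assumes "r \<in> \<rat>" "r \<noteq> 0"
  obtains e :: int where "w r = ereal (of_int e)"
proof -
  obtain p q :: int where pq: "q \<noteq> 0" "r = of_int p / of_int q" using Rats_cases'[OF assms(1)] by (metis less_irrefl)
  then have "p \<noteq> 0" using assms(2) by auto
  then obtain m n where mn: "w (of_int p) = ereal (real m)" "w (of_int q) = ereal (real n)"
    using w_int_integral pq(1) by blast
  have "w (of_int p) = w r + w (of_int q)" using w_mult[of r "of_int q"] pq assms(1) by simp
  then have "w r = ereal (of_int (int m - int n))" using mn by (cases "w r") auto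
  then show ?thesis by (rule that)
qed

text \<open>The residue field has two elements: \<open>r / s\<close> is a quotient of odd integers,
  so \<open>r / s + 1\<close> has an even numerator.\<close>

lemma w_add_same:
  assumes r: "r \<in> \<rat>" "s \<in> \<rat>" and e: "w r = ereal e" "w s = ereal e"
  shows "w (r + s) \<ge> ereal (e + 1)"
proof -
  have s0: "s \<noteq> 0" using e(2) w_0 by auto
  define t where "t = r / s"
  have t: "t \<in> \<rat>" "r = t * s" using r s0 by (auto simp: t_def)
  have "w r = w t + w s" unfolding t(2) by (rule w_mult[OF t(1) r(2)])
  then have wt: "w t = 0" using e by (cases "w t") auto
  obtain p q :: int where pq: "q \<noteq> 0" "coprime p q" "t = of_int p / of_int q"
    using Rats_cases'[OF t(1)] by (metis less_irrefl)
  have "w (of_int p) = w t + w (of_int q)" using w_mult[of t "of_int q"] pq t(1) by simp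
  then have "w (of_int p) = w (of_int q)" using wt by simp
  moreover have ev: "w (of_int k) \<noteq> 0" if "even k" for k
    using w_dvd[of 1 k] that by auto
  ultimately have "odd p" "odd q"
    using pq(2) w_odd coprime_common_divisor[of p q 2] by force+
  have "w ((t + 1) * of_int q) = w (t + 1) + w (of_int q)" using w_mult[of "t + 1" "of_int q"] t(1) by simp
  moreover have "(t + 1) * of_int q = of_int (p + q)" using pq by (simp add: field_simps)
  ultimately have "w (t + 1) = w (of_int (p + q))" using w_odd[OF \<open>odd q\<close>] by simp
  also have "\<dots> \<ge> ereal 1" using w_dvd[of 1 "p + q"] \<open>odd p\<close> \<open>odd q\<close> by simp
  finally have "w (t + 1) \<ge> ereal 1" .
  moreover have "w (r + s) = w (t + 1) + w s"
    using w_mult[of "t + 1" s] t r(2) by (simp add: distrib_right)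
  ultimately show ?thesis using e(2) add_right_mono[of "ereal 1" "w (t + 1)" "ereal e"] by (simp add: add.commute)
qed

lemma w_sum_ge:
  assumes "finite S" "\<And>k. k \<in> S \<Longrightarrow> g k \<in> \<rat>" "\<And>k. k \<in> S \<Longrightarrow> w (g k) \<ge> c"
  shows "w (sum g S) \<ge> c"
  using assms
proof (induction S)
  case (insert k S)
  then show ?case using w_add_ge[of "g k" "sum g S" c] by (simp add: Rats_sum)
qed (simp add: w_0)

text \<open>By \<open>w_add_same\<close> terms of equal valuation gain a factor 2 in pairs, so only
  the parity of their number matters.\<close>

lemma w_sum_same:
  assumes "finite S" "\<And>k. k \<in> S \<Longrightarrow> g k \<in> \<rat>" "\<And>k. k \<in> S \<Longrightarrow> w (g k) = ereal e"
  shows "if odd (card S) then w (sum g S) = ereal e else w (sum g S) \<ge> ereal (e + 1)"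
  using assms
proof (induction S)
  case (insert k S)
  have gk: "g k \<in> \<rat>" "sum g S \<in> \<rat>" "w (g k) = ereal e" using insert by (auto intro: Rats_sum)
  show ?case
  proof (cases "odd (card S)")
    case True
    then have "w (sum g S) = ereal e" using insert by auto
    then show ?thesis using w_add_same[OF gk(1,2,3)] True insert by simp
  next
    case False
    then have "w (sum g S) \<ge> ereal (e + 1)" using insert by auto
    then have "w (g k) < w (sum g S)" unfolding gk(3) by (rule less_le_trans[rotated]) simp
    then show ?thesis using w_add_eq[OF gk(1,2)] gk(3) False insert by simp
  qed
qed (simp add: w_0)

text \<open>The fourth power is the inverse of an odd integer. Additivity of \<open>v\<close> is
  available for algebraic numbers, hence the intermediate power \<open>u ^ 2\<close> has to be shown
  algebraic as well.\<close>

lemma v_eq_0_of_power4: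
  assumes u: "u ^ 4 * of_nat n = 1" and n: "odd n"
  shows "algebraic u" "v u = 0"
proof -
  have n0: "n \<noteq> 0" using n by (rule odd_pos[THEN gr_implies_not0])
  then have u4: "u ^ 4 = of_real (1 / real n)" using u by (simp add: field_simps)
  have r: "algebraic (complex_of_real (1 / real n))" by (rule algebraic_Rats) simp
  show au: "algebraic u"
    by (rule algebraic_root[OF r, of "Polynomial.monom 1 4"]) (simp_all add: poly_monom u4 degree_monom_eq)
  have au2: "algebraic (u ^ 2)"
    by (rule algebraic_root[OF r, of "Polynomial.monom 1 2"]) (simp_all add: poly_monom u4 degree_monom_eq flip: power_mult)
  have au4: "algebraic (u ^ 4)" using r u4 by simp
  have an: "algebraic (of_nat n :: complex)" using algebraic_Rats[of "real n"] by simp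
  have "v (u ^ 4) = v (u ^ 2) + v (u ^ 2)" using v_mult[OF au2 au2] by (simp flip: power_add)
  moreover have "v (u ^ 2) = v u + v u" using v_mult[OF au au] by (simp add: power2_eq_square)
  moreover have "v (u ^ 4) + v (of_nat n) = v 1" using v_mult[OF au4 an] u by simp
  moreover have "v (of_nat n) = 0" using w_odd[of "int n"] n by (simp add: w_def)
  moreover have "v 1 = 0" using w_1 by (simp add: w_def)
  moreover have "u \<noteq> 0" using u by auto
  then have "\<bar>v u\<bar> \<noteq> \<infinity>" using v_eq_infinity_iff[OF au] v_not_minf[OF au] by auto
  ultimately show "v u = 0" by (cases "v u") auto
qed

end

section \<open>The recursion over subsets and its valuations\<close>

locale arith_setting = nonrect_newform + two_adic
begin

lemma xval_rational:
  assumes P: "odd_primes P" "coprime (\<Prod>P) N" and L: "L1 \<in> \<rat>"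
  shows "xval P \<in> \<rat>"
proof (cases "P = {}")
  case False
  then obtain z where "xval P = of_int ((\<Prod>q\<in>P. A q - 2) - (\<Prod>q\<in>P. int q - 1)) * L1 + 2 * of_int z"
    using xval_mod_2[OF P False] by blast
  then show ?thesis using L by (simp del: of_int_prod of_int_diff)
qed (simp add: xval_empty L)

lemma v_L_ratio:
  assumes P: "odd_primes P" "coprime (\<Prod>P) N" and L: "L1 \<in> \<rat>"
  shows "v (L_ratio a Op Om (\<Prod>P)) = w (xval P)"
proof -
  obtain u where u: "u ^ 4 * of_nat ((\<Prod>P)\<^sup>2) = 1" "L_ratio a Op Om (\<Prod>P) = u * of_real (xval P)"
    using L_ratio_eq_xval[OF P(1)] by blast
  have "odd (\<Prod>P)" using prime_dvd_prod_primes[OF P(1) two_is_prime_nat] P(1) by (auto simp: odd_primes_def)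
  then have "odd ((\<Prod>P)\<^sup>2)" by simp
  from v_eq_0_of_power4[OF u(1) this] show ?thesis
    using v_mult[of u "of_real (xval P)"] xval_rational[OF P L] by (simp add: u(2) w_def rat_imp_algebraic)
qed

text \<open>The Hecke factors by which \<open>psi (tsum P Q)\<close> differs from
  \<open>xval Q\<close>, see \<open>psi_tsum_eq\<close>.\<close>

definition coef :: "nat set \<Rightarrow> nat set \<Rightarrow> int" where
  "coef P Q = (\<Prod>q\<in>P - Q. A q - 2 * jac Q (int q))"

lemma xval_recursion:
  assumes P: "odd_primes P" "coprime (\<Prod>P) N"
  obtains z :: int where "xval P + (\<Sum>Q\<in>Pow P - {P}. of_int (coef P Q) * xval Q) =
    of_int (\<Prod>q\<in>P. int q - 1) * L1 + of_int (2 ^ card P * z)"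
proof -
  have fin: "finite (Pow P)" using P by (simp add: odd_primes_def)
  obtain z where z: "(\<Sum>Q\<in>Pow P. of_int (coef P Q) * xval Q) =
    of_int (\<Prod>q\<in>P. int q - 1) * L1 + 2 ^ card P * of_int z"
    using xval_sum_subsets[OF P] unfolding coef_def by blast
  have "coef P P = 1" by (simp add: coef_def)
  then have "xval P + (\<Sum>Q\<in>Pow P - {P}. of_int (coef P Q) * xval Q) = (\<Sum>Q\<in>Pow P. of_int (coef P Q) * xval Q)"
    using sum.remove[OF fin, of P "\<lambda>Q. of_int (coef P Q) * xval Q"] by simp
  then show ?thesis using z that[of z] by simp
qed

lemma subset_conditions:
  assumes P: "odd_primes P" "coprime (\<Prod>P) N" and Q: "Q \<subseteq> P"
  shows "odd_primes Q" "coprime (\<Prod>Q) N"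
proof -
  show Q': "odd_primes Q" by (rule odd_primes_subset[OF P(1) Q])
  show "coprime (\<Prod>Q) N"
    using not_dvd_N[OF P] coprime_prod_primes[OF Q', of N] Q by (auto simp: coprime_commute)
qed

lemma pow2_dvd_prod:
  assumes "\<And>q. q \<in> S \<Longrightarrow> 2 ^ n dvd (g q :: int)"
  shows "2 ^ (n * card S) dvd prod g S"
proof -
  have "(\<Prod>q\<in>S. 2 ^ n) dvd prod g S" by (rule prod_dvd_prod) (rule assms)
  then show ?thesis by (simp add: power_mult)
qed

lemma pow2_card_dvd_prod_minus_1:
  assumes "odd_primes P" shows "2 ^ card P dvd (\<Prod>q\<in>P. int q - 1)"
  using pow2_dvd_prod[of P 1 "\<lambda>q. int q - 1"] assms by (auto simp: odd_primes_def)

lemma w_mult_ge: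
  assumes "r \<in> \<rat>" "s \<in> \<rat>" "w r \<ge> ereal c" "w s \<ge> ereal d"
  shows "w (r * s) \<ge> ereal (c + d)"
  using add_mono[OF assms(3,4)] by (simp add: w_mult[OF assms(1,2)])

lemma jac_other_prime:
  assumes P: "odd_primes P" and Q: "Q \<subseteq> P" and q: "q \<in> P - Q"
  shows "jac Q (int q) = 1 \<or> jac Q (int q) = -1"
proof -
  have Q': "odd_primes Q" by (rule odd_primes_subset[OF P Q])
  have pq: "prime q" using P q by (auto simp: odd_primes_def)
  have "coprime q (\<Prod>Q)" using prime_dvd_prod_primes[OF Q' pq] pq q by (intro prime_imp_coprime) auto
  then have "jac Q (int q) \<noteq> 0" using jac_eq_0_iff[OF Q'] by simp
  then show ?thesis using jac_values[OF Q', of "int q"] by auto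
qed

lemma w_prod_eq_card:
  assumes "finite S" "\<And>q. q \<in> S \<Longrightarrow> w (of_int (g q)) = 1"
  shows "w (of_int (prod g S)) = ereal (real (card S))"
  using assms
proof (induction S)
  case (insert q S)
  have "w (of_int (g q) * of_int (prod g S)) = w (of_int (g q)) + w (of_int (prod g S))"
    by (rule w_mult) (simp_all del: of_int_prod)
  then show ?case using insert by (simp add: one_ereal_def del: of_int_prod)
qed (simp add: w_1 zero_ereal_def)

definition xval_rest :: "nat set \<Rightarrow> real" where
  "xval_rest P = (\<Sum>Q\<in>Pow P - {P}. of_int (coef P Q) * xval Q)"

text \<open>\<open>xval_recursion\<close> evaluates this quantity without reference to smaller sets.
  Hence \<open>xval P\<close> is treated as total minus rest, where the rest is known by
  induction.\<close>

definition xval_total :: "nat set \<Rightarrow> real" where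
  "xval_total P = xval P + xval_rest P"

lemma proper_subset:
  assumes P: "odd_primes P" "coprime (\<Prod>P) N" and L: "L1 \<in> \<rat>" and Q: "Q \<in> Pow P - {P}"
  shows "Q \<subseteq> P" "odd_primes Q" "coprime (\<Prod>Q) N" "xval Q \<in> \<rat>"
    "card Q < card P" "card (P - Q) + card Q = card P"
proof -
  have fin: "finite P" using P by (simp add: odd_primes_def)
  show "Q \<subseteq> P" using Q by blast
  then show "odd_primes Q" "coprime (\<Prod>Q) N" using subset_conditions[OF P] by auto
  then show "xval Q \<in> \<rat>" using L by (rule xval_rational)
  show "card Q < card P" using Q fin by (intro psubset_card_mono) auto
  show "card (P - Q) + card Q = card P"
    using Q fin card_mono[of P Q] card_Diff_subset[of Q P] finite_subset[of Q P] by auto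
qed

lemma xval_rest_rational:
  assumes "odd_primes P" "coprime (\<Prod>P) N" "L1 \<in> \<rat>"
  shows "xval_rest P \<in> \<rat>"
  unfolding xval_rest_def by (rule Rats_sum) (use proper_subset(4)[OF assms] in auto)

text \<open>The two summands on the right of the recursion are bounded separately, and
  \<open>c\<close> may be any common lower bound.\<close>

lemma xval_total:
  assumes P: "odd_primes P" "coprime (\<Prod>P) N" and L: "L1 \<in> \<rat>"
    and n: "2 ^ n dvd (\<Prod>q\<in>P. int q - 1)" and l: "w L1 \<ge> ereal l"
    and c: "c \<le> real n + l" "c \<le> real (card P)"
  shows "xval_total P \<in> \<rat>" "w (xval_total P) \<ge> ereal c"
proof -
  obtain z where z: "xval_total P = of_int (\<Prod>q\<in>P. int q - 1) * L1 + of_int (2 ^ card P * z)"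
    using xval_recursion[OF P] unfolding xval_total_def xval_rest_def by blast
  show "xval_total P \<in> \<rat>" unfolding z using L by (auto simp del: of_int_prod)
  show "w (xval_total P) \<ge> ereal c" unfolding z
  proof (rule w_add_ge)
    have "w (of_int (\<Prod>q\<in>P. int q - 1) * L1) \<ge> ereal (real n + l)"
      by (rule w_mult_ge[OF Rats_of_int L w_dvd[OF n] l])
    then show "w (of_int (\<Prod>q\<in>P. int q - 1) * L1) \<ge> ereal c"
      using c(1) by (elim order_trans[rotated]) simp
    have "w (of_int (2 ^ card P * z)) \<ge> ereal (real (card P))" by (rule w_dvd) simp
    then show "w (of_int (2 ^ card P * z)) \<ge> ereal c"
      using c(2) by (elim order_trans[rotated]) simp
  qed (use L in \<open>auto simp del: of_int_prod\<close>)
qed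

text \<open>The common inductive step of the lower bounds. What remains to be supplied for a proper
  subset is a power of 2 in its Hecke factors and a bound for its \<open>xval\<close> that together
  reach \<open>c\<close>.\<close>

lemma xval_ge_by_recursion:
  assumes P: "odd_primes P" "coprime (\<Prod>P) N" and L: "L1 \<in> \<rat>"
    and n: "2 ^ n dvd (\<Prod>q\<in>P. int q - 1)" and l: "w L1 \<ge> ereal l"
    and c: "c \<le> real n + l" "c \<le> real (card P)"
    and terms: "\<And>Q. Q \<in> Pow P - {P} \<Longrightarrow>
      \<exists>k d. 2 ^ k dvd coef P Q \<and> w (xval Q) \<ge> ereal d \<and> c \<le> real k + d"
  shows "w (xval P) \<ge> ereal c"
proof -
  have "w (xval_rest P) \<ge> ereal c" unfolding xval_rest_def
  proof (rule w_sum_ge)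
    fix Q assume Q: "Q \<in> Pow P - {P}"
    then obtain k d where kd: "2 ^ k dvd coef P Q" "w (xval Q) \<ge> ereal d" "c \<le> real k + d"
      using terms by blast
    have "w (of_int (coef P Q) * xval Q) \<ge> ereal (real k + d)"
      by (rule w_mult_ge[OF Rats_of_int proper_subset(4)[OF P L Q] w_dvd[OF kd(1)] kd(2)])
    then show "w (of_int (coef P Q) * xval Q) \<ge> ereal c"
      using kd(3) by (elim order_trans[rotated]) simp
  qed (use P proper_subset(4)[OF P L] in \<open>auto simp: odd_primes_def\<close>)
  then have "w (xval_total P - xval_rest P) \<ge> ereal c"
    by (intro w_diff_ge xval_total[OF P L n l c] xval_rest_rational[OF P L])
  then show ?thesis by (simp add: xval_total_def)
qed

text \<open>Each prime of \<open>P - Q\<close> gives a factor 2 in \<open>coef P Q\<close> and each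
  prime of \<open>Q\<close> one in \<open>xval Q\<close>, so every term reaches
  \<open>card P\<close> up to the defect \<open>\<mu>\<close> of \<open>L1\<close>. The condition
  \<open>\<mu> \<le> 0\<close> reflects the multiple of \<open>2 ^ card P\<close> in the recursion,
  for which no better valuation is known.\<close>

lemma xval_ge:
  assumes P: "odd_primes P" "coprime (\<Prod>P) N" and L: "L1 \<in> \<rat>"
    and ev: "\<And>q. q \<in> P \<Longrightarrow> even (A q)" and mu: "\<mu> \<le> 0" "w L1 \<ge> ereal \<mu>"
  shows "w (xval P) \<ge> ereal (real (card P) + \<mu>)"
  using P ev
proof (induction "card P" arbitrary: P rule: less_induct)
  case less
  note P = less.prems(1,2)
  show ?case
  proof (rule xval_ge_by_recursion[OF P L pow2_card_dvd_prod_minus_1[OF P(1)] mu(2)])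
    fix Q assume Q: "Q \<in> Pow P - {P}"
    note Q' = proper_subset[OF P L Q]
    have "w (xval Q) \<ge> ereal (real (card Q) + \<mu>)"
      by (rule less.hyps[OF Q'(5,2,3)]) (use Q'(1) less.prems(3) in auto)
    moreover have "2 ^ (1 * card (P - Q)) dvd coef P Q" unfolding coef_def
      by (rule pow2_dvd_prod) (use less.prems(3) in auto)
    moreover have "real (card P) = real (1 * card (P - Q)) + real (card Q)" using Q'(6) by linarith
    ultimately show "\<exists>k d. 2 ^ k dvd coef P Q \<and> w (xval Q) \<ge> ereal d \<and> real (card P) + \<mu> \<le> real k + d"
      by fastforce
  qed (use mu in auto)
qed

text \<open>Here \<open>L1\<close> may have one more 2 in its denominator. It enters the recursion
  directly only in the unit-count term and in the term \<open>Q = {}\<close>, where the accompanying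
  factor is divisible by \<open>2 ^ (2 * card P)\<close>; as \<open>P\<close> is not empty, the
  surplus covers the loss.\<close>

lemma xval_ge_of_4_dvd:
  assumes P: "odd_primes P" "coprime (\<Prod>P) N" and L: "L1 \<in> \<rat>"
    and A4: "\<And>q. q \<in> P \<Longrightarrow> 4 dvd A q - 2" and q4: "\<And>q. q \<in> P \<Longrightarrow> 4 dvd int q - 1"
    and mu: "\<mu> \<le> 0" "w L1 \<ge> ereal (\<mu> - 1)" and ne: "P \<noteq> {}"
  shows "w (xval P) \<ge> ereal (real (card P) + \<mu>)"
  using P A4 q4 ne
proof (induction "card P" arbitrary: P rule: less_induct)
  case less
  note P = less.prems(1,2)
  have card_P: "card P \<ge> 1" using less.prems(1,5) by (simp add: Suc_le_eq card_gt_0_iff odd_primes_def)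
  have dvd: "2 ^ (2 * card P) dvd (\<Prod>q\<in>P. int q - 1)"
    by (rule pow2_dvd_prod) (use less.prems(4) in auto)
  show ?case
  proof (rule xval_ge_by_recursion[OF P L dvd mu(2)])
    fix Q assume Q: "Q \<in> Pow P - {P}"
    note Q' = proper_subset[OF P L Q]
    have k: "2 ^ (2 * card (P - Q)) dvd coef P Q" unfolding coef_def
    proof (rule pow2_dvd_prod)
      fix q assume q: "q \<in> P - Q"
      then have "4 dvd A q - 2" using less.prems(3) by blast
      \<comment> \<open>\<open>jac Q q\<close> is 1 or -1, and \<open>A q - 2\<close> and
        \<open>A q + 2\<close> are both divisible by 4.\<close>
      then show "2\<^sup>2 dvd A q - 2 * jac Q (int q)"
        using jac_other_prime[OF P(1) Q'(1) q] by auto presburger+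
    qed
    have card: "real (card P) = real (card (P - Q)) + real (card Q)" "real (card (P - Q)) \<ge> 1"
      using Q'(5,6) by linarith+
    show "\<exists>k d. 2 ^ k dvd coef P Q \<and> w (xval Q) \<ge> ereal d \<and> real (card P) + \<mu> \<le> real k + d"
    proof (cases "Q = {}")
      case True
      then show ?thesis using k mu(2) card by (intro exI[of _ "2 * card (P - Q)"] exI[of _ "\<mu> - 1"]) (simp add: xval_empty)
    next
      case False
      have "w (xval Q) \<ge> ereal (real (card Q) + \<mu>)"
        by (rule less.hyps[OF Q'(5,2,3)]) (use Q'(1) False less.prems(3,4) in auto)
      then show ?thesis using k card by (intro exI[of _ "2 * card (P - Q)"] exI[of _ "real (card Q) + \<mu>"]) simp
    qed
  qed (use mu card_P in auto)
qed

text \<open>The \<open>2 ^ card P - 1\<close> terms of the recursion that belong to the proper subsets all have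
  valuation \<open>card P + l\<close>; as their number is odd, they do not cancel.\<close>

lemma xval_eq_of_negative:
  assumes P: "odd_primes P" "coprime (\<Prod>P) N" and L: "L1 \<in> \<rat>"
    and A4: "\<And>q. q \<in> P \<Longrightarrow> 4 dvd A q" and q4: "\<And>q. q \<in> P \<Longrightarrow> 4 dvd int q - 1"
    and l: "l \<le> -1" "w L1 = ereal l"
  shows "w (xval P) = ereal (real (card P) + l)"
  using P A4 q4
proof (induction "card P" arbitrary: P rule: less_induct)
  case less
  note P = less.prems(1,2)
  have fin: "finite P" using P by (simp add: odd_primes_def)
  show ?case
  proof (cases "P = {}")
    case True
    then show ?thesis using l by (simp add: xval_empty)
  next
    case False
    then have card_P: "card P \<ge> 1" using fin by (simp add: Suc_le_eq card_gt_0_iff)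
    have w_term: "w (of_int (coef P Q) * xval Q) = ereal (real (card P) + l)" if Q: "Q \<in> Pow P - {P}" for Q
    proof -
      note Q' = proper_subset[OF P L Q]
      have IH: "w (xval Q) = ereal (real (card Q) + l)"
        by (rule less.hyps[OF Q'(5,2,3)]) (use Q'(1) less.prems(3,4) in auto)
      have "w (of_int (coef P Q)) = ereal (real (card (P - Q)))" unfolding coef_def
      proof (rule w_prod_eq_card)
        fix q assume q: "q \<in> P - Q"
        then obtain k where k: "A q = 4 * k" using less.prems(3) by blast
        have o: "odd (2 * k - jac Q (int q))" using jac_other_prime[OF P(1) Q'(1) q] by auto
        have "A q - 2 * jac Q (int q) = 2 ^ 1 * (2 * k - jac Q (int q))" using k by simp
        then show "w (of_int (A q - 2 * jac Q (int q))) = 1"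
          using w_odd_multiple[OF o, of 1] by (simp only: one_ereal_def of_nat_1)
      qed (use fin in auto)
      moreover have "w (of_int (coef P Q) * xval Q) = w (of_int (coef P Q)) + w (xval Q)"
        by (rule w_mult[OF Rats_of_int Q'(4)])
      ultimately show ?thesis using IH by (simp flip: Q'(6))
    qed
    have "card (Pow P - {P}) = 2 ^ card P - 1" using fin by (simp add: card_Pow)
    then have "odd (card (Pow P - {P}))" using card_P by simp
    then have wT: "w (xval_rest P) = ereal (real (card P) + l)" unfolding xval_rest_def
      using w_sum_same[of "Pow P - {P}" "\<lambda>Q. of_int (coef P Q) * xval Q" "real (card P) + l"]
        fin proper_subset(4)[OF P L] w_term by simp
    have "2 ^ (2 * card P) dvd (\<Prod>q\<in>P. int q - 1)"
      by (rule pow2_dvd_prod) (use less.prems(4) in auto)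
    \<comment> \<open>The total lies strictly above the rest: \<open>2 * card P + l\<close> and
      \<open>card P\<close> are both at least \<open>card P + l + 1\<close>, because
      \<open>card P \<ge> 1\<close> and \<open>l \<le> -1\<close>.\<close>
    note total = xval_total[OF P L this, of l "real (card P) + l + 1"]
    have T: "xval_rest P \<in> \<rat>" by (rule xval_rest_rational[OF P L])
    have "w (xval_total P) \<ge> ereal (real (card P) + l + 1)" using total l card_P by simp
    then have "w (- xval_rest P) < w (xval_total P)"
      unfolding w_minus[OF T] wT by (elim less_le_trans[rotated]) simp
    moreover have "xval_total P \<in> \<rat>" using total l card_P by simp
    ultimately have "w (- xval_rest P + xval_total P) = w (- xval_rest P)" using T by (intro w_add_eq) auto
    then show ?thesis unfolding w_minus[OF T] wT by (simp add: xval_total_def)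
  qed
qed

section \<open>Valuations of integers read as congruences\<close>

lemma w_int_eq_0D: "w (of_int n) = 0 \<Longrightarrow> odd n"
  using w_dvd[of 1 n] by auto

lemma w_int_ge_1D: "w (of_int n) \<ge> 1 \<Longrightarrow> even n"
  by (rule ccontr) (simp add: w_odd)

lemma w_int_eq_1D: "w (of_int n) = 1 \<Longrightarrow> even n \<and> \<not> 4 dvd n"
  using w_dvd[of 2 n] w_odd[of n] by auto

lemma w_int_ge_2D:
  assumes "w (of_int n) \<ge> 2" shows "4 dvd n"
proof (rule ccontr)
  assume n4: "\<not> 4 dvd n"
  have "w (of_int n) \<le> 1"
  proof (cases "odd n")
    case True then show ?thesis using w_odd by simp
  next
    case False
    then obtain k where k: "n = 2 ^ 1 * k" by auto
    then have "odd k" using n4 by auto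
    then show ?thesis using w_odd_multiple[of k 1] k by (simp add: one_ereal_def)
  qed
  then have "(2::ereal) \<le> 1" using assms by (rule order_trans[rotated])
  then show False by simp
qed

end

section \<open>Lower bounds and equality cases\<close>

lemma prime_cong_1_mod_4:
  assumes q: "prime q" "odd q" and e: "Legendre (-1) (int q) = 1"
  shows "4 dvd int q - 1"
proof -
  have q2: "q > 2" by (rule odd_prime_gt_2[OF q])
  have "[Legendre (-1) (int q) = (-1) ^ ((q - 1) div 2)] (mod int q)"
    by (rule euler_criterion[OF q(1) q2])
  then have c: "[1 = (-1) ^ ((q - 1) div 2)] (mod int q)" using e by simp
  have "even ((q - 1) div 2)"
  proof (rule ccontr)
    assume "odd ((q - 1) div 2)"
    then have "int q dvd 2" using c by (simp add: cong_iff_dvd_diff)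
    then show False using q2 zdvd_imp_le[of "int q" 2] by simp
  qed
  moreover have "even (q - 1)" using q(2) by simp
  ultimately have "4 dvd q - 1" by presburger
  then have "int 4 dvd int (q - 1)" by (simp only: int_dvd_int_iff)
  then show ?thesis using q2 by (simp add: of_nat_diff)
qed

context arith_setting
begin

lemma w_L1_not_minf: "L1 \<in> \<rat> \<Longrightarrow> w L1 \<noteq> - \<infinity>"
  by (cases "L1 = 0") (use w_finite[of L1] w_0 in auto)

text \<open>By \<open>xval_mod_2\<close> the value is an integer times \<open>L1\<close> plus an
  even integer. Serves the case that some \<open>A q\<close> is odd.\<close>

lemma w_xval_ge_min_1:
  assumes P: "odd_primes P" "coprime (\<Prod>P) N" "P \<noteq> {}" and L: "L1 \<in> \<rat>"
  shows "w (xval P) \<ge> min 1 (w L1)"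
proof -
  define D where "D = (\<Prod>q\<in>P. A q - 2) - (\<Prod>q\<in>P. int q - 1)"
  obtain z where z: "xval P = of_int D * L1 + 2 * of_int z" using xval_mod_2[OF P] unfolding D_def by blast
  have "w (of_int D * L1) = w (of_int D) + w L1" by (rule w_mult) (use L in auto)
  then have "w (of_int D * L1) \<ge> w L1" using w_int[of D] add_right_mono[of 0 "w (of_int D)" "w L1"] by simp
  moreover have "w (2 * of_int z) \<ge> 1" using w_dvd[of 1 "2 * z"] by (simp add: one_ereal_def)
  ultimately show ?thesis unfolding z using L by (intro w_add_ge) (auto intro: min.coboundedI1 min.coboundedI2)
qed

text \<open>The coefficient of \<open>L1\<close> in \<open>xval_mod_2\<close> is odd: the product of
  the \<open>A q - 2\<close> is odd and, as \<open>P\<close> is not empty, that of the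
  \<open>q - 1\<close> is even.\<close>

lemma w_xval_eq_0:
  assumes P: "odd_primes P" "coprime (\<Prod>P) N" "P \<noteq> {}" and L: "L1 \<in> \<rat>" "w L1 = 0"
    and od: "\<And>q. q \<in> P \<Longrightarrow> odd (A q)"
  shows "w (xval P) = 0"
proof -
  have fin: "finite P" using P by (simp add: odd_primes_def)
  define D where "D = (\<Prod>q\<in>P. A q - 2) - (\<Prod>q\<in>P. int q - 1)"
  obtain z where z: "xval P = of_int D * L1 + 2 * of_int z" using xval_mod_2[OF P] unfolding D_def by blast
  have "odd (\<Prod>q\<in>P. A q - 2)" using od fin by (simp add: even_prod_iff)
  moreover have "even (\<Prod>q\<in>P. int q - 1)" using P fin by (auto simp: even_prod_iff odd_primes_def)
  ultimately have "odd D" by (simp add: D_def)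
  moreover have "w (of_int D * L1) = w (of_int D) + w L1" by (rule w_mult) (use L in auto)
  ultimately have 0: "w (of_int D * L1) = 0" using L by (simp add: w_odd)
  have "w (2 * of_int z) \<ge> 1" using w_dvd[of 1 "2 * z"] by (simp add: one_ereal_def)
  then have "w (of_int D * L1) < w (2 * of_int z)" unfolding 0 by (elim less_le_trans[rotated]) simp
  then show ?thesis unfolding z using w_add_eq[of "of_int D * L1" "2 * of_int z"] L 0 by simp
qed

text \<open>The real number \<open>\<mu>\<close> of \<open>xval_ge\<close> is taken to be
  \<open>min 0 (w L1)\<close>, which is finite even when \<open>L1 = 0\<close>; this is the origin
  of the minimum in the theorem.\<close>

lemma w_xval_ge_even:
  assumes P: "odd_primes P" "coprime (\<Prod>P) N" and L: "L1 \<in> \<rat>"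
    and ev: "\<And>q. q \<in> P \<Longrightarrow> even (A q)"
  shows "w (xval P) \<ge> ereal (real (card P)) + min 0 (w L1)"
proof -
  have "min 0 (w L1) \<noteq> \<infinity>" "min 0 (w L1) \<noteq> - \<infinity>"
    using w_L1_not_minf[OF L] by (auto simp: min_def)
  then obtain \<mu> where mu: "min 0 (w L1) = ereal \<mu>" by (cases "min 0 (w L1)") auto
  then have "ereal \<mu> \<le> 0" "ereal \<mu> \<le> w L1" by (metis min.cobounded1, metis min.cobounded2)
  then have "w (xval P) \<ge> ereal (real (card P) + \<mu>)" by (intro xval_ge[OF P L ev]) auto
  then show ?thesis by (simp add: mu)
qed

text \<open>The added 1 is the gain that the theorem records as
  \<open>kron (frak_v v a m) 2\<close>.\<close>

lemma w_xval_ge_4_dvd: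
  assumes P: "odd_primes P" "coprime (\<Prod>P) N" "P \<noteq> {}" and L: "L1 \<in> \<rat>"
    and A4: "\<And>q. q \<in> P \<Longrightarrow> 4 dvd A q - 2" and q4: "\<And>q. q \<in> P \<Longrightarrow> 4 dvd int q - 1"
  shows "w (xval P) \<ge> ereal (real (card P)) + min 0 (w L1 + 1)"
proof -
  have "w L1 + 1 \<noteq> - \<infinity>" using w_L1_not_minf[OF L] by (cases "w L1") auto
  then have "min 0 (w L1 + 1) \<noteq> \<infinity>" "min 0 (w L1 + 1) \<noteq> - \<infinity>" by (auto simp: min_def)
  then obtain \<mu> where mu: "min 0 (w L1 + 1) = ereal \<mu>" by (cases "min 0 (w L1 + 1)") auto
  then have "ereal \<mu> \<le> 0" "ereal \<mu> \<le> w L1 + 1" by (metis min.cobounded1, metis min.cobounded2)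
  then have "\<mu> \<le> 0" "ereal (\<mu> - 1) \<le> w L1"
    using w_L1_not_minf[OF L] by (auto simp: one_ereal_def) (cases "w L1"; simp)
  then have "w (xval P) \<ge> ereal (real (card P) + \<mu>)" by (intro xval_ge_of_4_dvd[OF P(1,2) L A4 q4 _ _ P(3)])
  then show ?thesis by (simp add: mu)
qed

text \<open>A negative valuation excludes \<open>L1 = 0\<close>, and valuations of nonzero rationals
  are integers, so \<open>w L1 < 0\<close> means \<open>w L1 \<le> -1\<close>, the gap that
  \<open>xval_eq_of_negative\<close> asks for.\<close>

lemma w_xval_eq_negative:
  assumes P: "odd_primes P" "coprime (\<Prod>P) N" and L: "L1 \<in> \<rat>" "w L1 < 0"
    and A4: "\<And>q. q \<in> P \<Longrightarrow> 4 dvd A q" and q4: "\<And>q. q \<in> P \<Longrightarrow> 4 dvd int q - 1"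
  shows "w (xval P) = ereal (real (card P)) + w L1"
proof -
  have "L1 \<noteq> 0" using L(2) w_0 by auto
  then obtain e where e: "w L1 = ereal (of_int e)" using w_Rats_cases[OF L(1)] by blast
  then have "e < 0" using L(2) by simp
  then have "w (xval P) = ereal (real (card P) + of_int e)"
    by (intro xval_eq_of_negative[OF P L(1) A4 q4 _ e]) simp_all
  then show ?thesis by (simp add: e)
qed

end

theorem theorem4p2:
  fixes N :: nat and f :: "complex \<Rightarrow> complex" and a :: "nat \<Rightarrow> complex"
    and E :: wmodel and \<Phi> :: "(complex \<Rightarrow> complex) \<times> (complex \<Rightarrow> complex)" and manin :: complex
    and \<Omega>p \<Omega>m :: real and v :: "complex \<Rightarrow> ereal"
    and P :: "nat set" and m r :: nat
  assumes newform: "rational_newform2 N f a"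
    and optimal: "optimal_curve N f a E \<Phi> manin"
    and manin: "manin = 1"
    and nonrect: "nonrectangular (period_lattice N f) \<Omega>p \<Omega>m"
    and val: "two_adic_valuation v"
    and P: "finite P" "P \<noteq> {}" "\<forall>q\<in>P. prime q \<and> odd q"
    and m: "m = \<Prod>P" "coprime m N"
    and r: "r = card P"
  shows
    "(P \<subseteq> prime_set v N a 0 \<union> prime_set v N a 1 \<union> prime_set v N a 2 \<longrightarrow>
        (let lower = frak_w v a m * ereal (real r)
               + min (kron (frak_v v a m) 0) (v (L_ratio a \<Omega>p \<Omega>m 1))
         in v (L_ratio a \<Omega>p \<Omega>m m) \<ge> lower \<and>
            (v (L_ratio a \<Omega>p \<Omega>m 1) = 0 \<and> P \<subseteq> prime_set v N a 0 \<longrightarrow>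
               v (L_ratio a \<Omega>p \<Omega>m m) = lower))) \<and>
     (P \<subseteq> prime_set_pm v N a 1 0 \<union> prime_set_pm v N a 1 1 \<union> prime_set_pm v N a 1 2 \<longrightarrow>
        (let lower = frak_w v a m * ereal (real r)
               + min (kron (frak_v v a m) 0)
                     (v (L_ratio a \<Omega>p \<Omega>m 1) + kron (frak_v v a m) 2)
         in v (L_ratio a \<Omega>p \<Omega>m m) \<ge> lower \<and>
            ((v (L_ratio a \<Omega>p \<Omega>m 1) = 0 \<and> P \<subseteq> prime_set_pm v N a 1 0) \<or>
             (v (L_ratio a \<Omega>p \<Omega>m 1) < 0 \<and> P \<subseteq> prime_set_pm v N a 1 1) \<longrightarrow>
               v (L_ratio a \<Omega>p \<Omega>m m) = lower)))"
proof -
  \<comment> \<open>The set contains affine points only, so this is the trace of Frobenius; as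
    \<open>q\<close> minus a cardinality it is at most \<open>q\<close>.\<close>
  define A where "A q = int q - int (card {(x, y). x \<in> {0..<int q} \<and> y \<in> {0..<int q} \<and> int q dvd wpoly E x y})" for q
  have attached: "attached_curve N a E" using optimal by (simp add: optimal_curve_def)
  interpret arith_setting N f a \<Omega>p \<Omega>m A v
  proof
    show "rational_newform2 N f a" "nonrectangular (period_lattice N f) \<Omega>p \<Omega>m" "two_adic_valuation v"
      by fact+
    show "a q = of_int (A q)" if "prime q" "\<not> q dvd N" for q
      using attached that by (simp add: attached_curve_def A_def)
    show "A q \<le> int q" for q by (simp add: A_def)
  qed
  have oP: "odd_primes P" using P by (simp add: odd_primes_def)
  have cP: "coprime (\<Prod>P) N" using m by simp
  have qN: "\<not> q dvd N" if "q \<in> P" for q using not_dvd_N[OF oP cP that] .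
  have L: "L1 \<in> \<rat>" using P(2,3) qN L1_rational by blast
  \<comment> \<open>The L-value of \<open>f\<close> itself is the case of the empty set of
    primes.\<close>
  have v1: "v (L_ratio a \<Omega>p \<Omega>m 1) = w L1"
    using v_L_ratio[of "{}"] L by (simp add: odd_primes_def xval_empty)
  have vm: "v (L_ratio a \<Omega>p \<Omega>m m) = w (xval P)"
    unfolding m(1) by (rule v_L_ratio[OF oP cP L])
  have vq: "v (a q - 2) = w (of_int (A q - 2))" if "q \<in> P" for q
    using a_int[of q] P(3) qN[OF that] that by (simp add: w_def)
  define V where "V = frak_v v a m"
  have V: "V = Min ((\<lambda>q. v (a q - 2)) ` P)"
    by (simp add: V_def frak_v_def m(1) prime_factors_prod_primes[OF oP])
  have V_in: "V \<in> (\<lambda>q. v (a q - 2)) ` P" unfolding V using P by (intro Min_in) auto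
  have V_le: "V \<le> v (a q - 2)" if "q \<in> P" for q unfolding V using P that by (intro Min_le) auto
  have V_const: "V = c" if "\<And>q. q \<in> P \<Longrightarrow> v (a q - 2) = c" for c
    using V_in that by auto
  have val_cases: "v (a q - 2) = 0 \<or> v (a q - 2) = 1 \<or> v (a q - 2) = 2"
    if "P \<subseteq> prime_set v N a 0 \<union> prime_set v N a 1 \<union> prime_set v N a 2" "q \<in> P" for q
    using that by (auto simp: prime_set_def prime_set_pm_def zero_ereal_def one_ereal_def)
  \<comment> \<open>For \<open>V = 0\<close> the theorem has \<open>frak_w v a m = 0\<close> and
    \<open>kron V 0 = 1\<close>, so this is exactly the bound claimed.\<close>
  have bound_0: "w (xval P) \<ge> min 1 (w L1)" by (rule w_xval_ge_min_1[OF oP cP P(2) L])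
  have bound_pos: "w (xval P) \<ge> ereal (real r) + min 0 (w L1)"
    if "P \<subseteq> prime_set v N a 0 \<union> prime_set v N a 1 \<union> prime_set v N a 2" "V \<noteq> 0"
  proof -
    \<comment> \<open>\<open>V\<close> is a minimum of nonnegative values, so a single odd
      \<open>A q\<close> would force \<open>V = 0\<close>.\<close>
    have "even (A q)" if q: "q \<in> P" for q
    proof -
      have "v (a q - 2) \<ge> 1"
      proof (cases "v (a q - 2) = 0")
        case True
        then have "V \<le> 0" using V_le[OF q] by simp
        moreover obtain p where "p \<in> P" "V = v (a p - 2)" using V_in by blast
        then have "V \<ge> 0" using vq[of p] w_int[of "A p - 2"] by simp
        ultimately show ?thesis using \<open>V \<noteq> 0\<close> by simp
      next
        case False
        then show ?thesis using val_cases[OF \<open>P \<subseteq> _\<close> q] by (auto simp: one_ereal_def)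
      qed
      then show ?thesis using w_int_ge_1D[of "A q - 2"] vq[OF q] by simp
    qed
    then show ?thesis unfolding r by (rule w_xval_ge_even[OF oP cP L])
  qed
  \<comment> \<open>Serves the equality claims of both parts: with \<open>V = 0\<close> and
    \<open>w L1 = 0\<close> either lower bound is \<open>min 1 0\<close>.\<close>
  have eq_0: "w (xval P) = 0 \<and> V = 0" if "w L1 = 0" "P \<subseteq> prime_set v N a 0"
  proof -
    have v0: "v (a q - 2) = 0" if "q \<in> P" for q
      using that \<open>P \<subseteq> _\<close> by (auto simp: prime_set_def prime_set_pm_def zero_ereal_def)
    have "odd (A q)" if "q \<in> P" for q
      using v0[OF that] vq[OF that] w_int_eq_0D[of "A q - 2"] by simp
    then show ?thesis using w_xval_eq_0[OF oP cP P(2) L that(1)] V_const[of 0] v0 by simp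
  qed
  have q4: "4 dvd int q - 1" if "q \<in> prime_set_pm v N a 1 i" "q \<in> P" for q i
  proof (rule prime_cong_1_mod_4)
    show "prime q" "odd q" using P(3) that by auto
    then show "Legendre (-1) (int q) = 1"
      using that quad_char_prod_primes[of "{q}"] by (simp add: prime_set_pm_def odd_primes_def jac_def)
  qed
  let ?lhs = "v (L_ratio a \<Omega>p \<Omega>m m)"
  let ?low1 = "frak_w v a m * ereal (real r) + min (kron V 0) (v (L_ratio a \<Omega>p \<Omega>m 1))"
  let ?low2 = "frak_w v a m * ereal (real r) + min (kron V 0) (v (L_ratio a \<Omega>p \<Omega>m 1) + kron V 2)"
  have part1: "?lhs \<ge> ?low1"
    if "P \<subseteq> prime_set v N a 0 \<union> prime_set v N a 1 \<union> prime_set v N a 2"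
    using bound_0 bound_pos[OF that]
    by (simp add: frak_w_def kron_def v1[unfolded One_nat_def] vm V_def[symmetric])
  have part1_eq: "?lhs = ?low1"
    if "v (L_ratio a \<Omega>p \<Omega>m 1) = 0" "P \<subseteq> prime_set v N a 0"
    using eq_0[OF _ that(2)] that(1) by (simp add: frak_w_def kron_def v1[unfolded One_nat_def] vm V_def[symmetric])
  have pm_sub: "prime_set_pm v N a 1 i \<subseteq> prime_set v N a i" for i by (auto simp: prime_set_def)
  have part2: "?lhs \<ge> ?low2"
    if sub: "P \<subseteq> prime_set_pm v N a 1 0 \<union> prime_set_pm v N a 1 1 \<union> prime_set_pm v N a 1 2"
  \<comment> \<open>The two lower bounds differ only by \<open>kron V 2\<close>. For
    \<open>V = 2\<close> every \<open>A q - 2\<close> is divisible by 4 and the sharper estimate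
    applies; otherwise part (i) is enough.\<close>
  proof (cases "V = 2")
    case False
    have "P \<subseteq> prime_set v N a 0 \<union> prime_set v N a 1 \<union> prime_set v N a 2" using sub pm_sub by blast
    from part1[OF this] show ?thesis using False by (simp add: kron_def)
  next
    case True
    have "4 dvd A q - 2" if "q \<in> P" for q
      using V_le[OF that] vq[OF that] w_int_ge_2D[of "A q - 2"] True by simp
    moreover have "4 dvd int q - 1" if "q \<in> P" for q using that sub q4 by blast
    ultimately have "w (xval P) \<ge> ereal (real (card P)) + min 0 (w L1 + 1)"
      by (intro w_xval_ge_4_dvd[OF oP cP P(2) L])
    then show ?thesis using True by (simp add: frak_w_def kron_def v1[unfolded One_nat_def] vm V_def[symmetric] r)
  qed
  have part2_eq: "?lhs = ?low2"
    if "(v (L_ratio a \<Omega>p \<Omega>m 1) = 0 \<and> P \<subseteq> prime_set_pm v N a 1 0) \<or>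
        (v (L_ratio a \<Omega>p \<Omega>m 1) < 0 \<and> P \<subseteq> prime_set_pm v N a 1 1)"
    using that
  proof
    assume h: "v (L_ratio a \<Omega>p \<Omega>m 1) = 0 \<and> P \<subseteq> prime_set_pm v N a 1 0"
    then have "w L1 = 0" "P \<subseteq> prime_set v N a 0" using v1 pm_sub[of 0] by auto
    then have "w (xval P) = 0 \<and> V = 0" by (rule eq_0)
    then show ?thesis using h by (simp add: frak_w_def kron_def vm V_def[symmetric])
  next
    assume h: "v (L_ratio a \<Omega>p \<Omega>m 1) < 0 \<and> P \<subseteq> prime_set_pm v N a 1 1"
    have v1': "v (a q - 2) = 1" if "q \<in> P" for q
      using that h by (auto simp: prime_set_pm_def one_ereal_def)
    \<comment> \<open>Valuation exactly 1 means that \<open>A q - 2\<close> is 2 modulo 4.\<close>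
    have "4 dvd A q" if "q \<in> P" for q
    proof -
      have "even (A q - 2) \<and> \<not> 4 dvd A q - 2"
        using v1'[OF that] vq[OF that] w_int_eq_1D[of "A q - 2"] by simp
      then show ?thesis by presburger
    qed
    moreover have "4 dvd int q - 1" if "q \<in> P" for q using that h q4 by blast
    ultimately have "w (xval P) = ereal (real (card P)) + w L1"
      using h v1 by (intro w_xval_eq_negative[OF oP cP L]) auto
    moreover have "V = 1" using V_const v1' by blast
    \<comment> \<open>With \<open>V = 1\<close> both Kronecker deltas vanish, and the minimum in the
      bound is \<open>w L1\<close> itself.\<close>
    moreover have "min 0 (w L1) = w L1" using h v1 by (simp add: min_absorb2 less_imp_le)
    ultimately show ?thesis by (simp add: frak_w_def kron_def v1[unfolded One_nat_def] vm V_def[symmetric] r)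
  qed
  show ?thesis unfolding Let_def V_def[symmetric]
    using part1 part1_eq part2 part2_eq by blast
qed

end
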